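(* There are, up to isomorphism, precisely three $T_3$-snarks.
   Context: All graphs are finite and loopless; edge colorings are proper. A snark is a cyclically $4$-edge connected cubic graph of girth at least $5$ admitting no $3$-edge coloring. $T_3$ is the unique tree with all vertex degrees in $\{1,3\}$ having a $3$-valent vertex with distance $3$ to all leaves (it has $22$ vertices, $12$ of which are leaves). A $T_3$-snark is a snark which has a spanning tree isomorphic to $T_3$. *)

theory Defs
  imports Main "HOL-Library.Extended_Nat"
begin

text \<open>
  Undirected graphs are represented as simple graphs, with two-element sets of vertices as edges.
  No generality is lost by leaving out parallel edges: a pair of them is a cycle of
  length 2, so a loopless multigraph of girth at least 5 is simple.
\<close>

record 'a ugraph =
  verts :: "'a set"
  edges :: "'a set set"

definition fin_graph :: "'a ugraph \<Rightarrow> bool" where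
  "fin_graph G \<longleftrightarrow> finite (verts G) \<and> (\<forall>e\<in>edges G. e \<subseteq> verts G \<and> card e = 2)"

definition graph_iso :: "'a ugraph \<Rightarrow> 'b ugraph \<Rightarrow> bool" where
  "graph_iso G H \<longleftrightarrow> (\<exists>f. bij_betw f (verts G) (verts H) \<and> edges H = (\<lambda>e. f ` e) ` edges G)"

definition degree :: "'a ugraph \<Rightarrow> 'a \<Rightarrow> nat" where
  "degree G v = card {e \<in> edges G. v \<in> e}"

definition cubic :: "'a ugraph \<Rightarrow> bool" where
  "cubic G \<longleftrightarrow> (\<forall>v\<in>verts G. degree G v = 3)"

definition del_edges :: "'a ugraph \<Rightarrow> 'a set set \<Rightarrow> 'a ugraph" where
  "del_edges G X = \<lparr>verts = verts G, edges = edges G - X\<rparr>"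

definition walk :: "'a ugraph \<Rightarrow> 'a \<Rightarrow> 'a list \<Rightarrow> 'a \<Rightarrow> bool" where
  "walk G u xs v \<longleftrightarrow> xs \<noteq> [] \<and> hd xs = u \<and> last xs = v \<and> set xs \<subseteq> verts G \<and>
     successively (\<lambda>x y. {x, y} \<in> edges G) xs"

definition graph_dist :: "'a ugraph \<Rightarrow> 'a \<Rightarrow> 'a \<Rightarrow> enat" where
  "graph_dist G u v = (INF xs\<in>{xs. walk G u xs v}. enat (length xs - 1))"

definition connected_graph :: "'a ugraph \<Rightarrow> bool" where
  "connected_graph G \<longleftrightarrow> verts G \<noteq> {} \<and> (\<forall>u\<in>verts G. \<forall>v\<in>verts G. \<exists>xs. walk G u xs v)"

text \<open>Components are given by their vertex sets.\<close>

definition components :: "'a ugraph \<Rightarrow> 'a set set" where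
  "components G = (\<lambda>u. {v. \<exists>xs. walk G u xs v}) ` verts G"

text \<open>A cycle is the list of its vertices in cyclic order, without repetition of the first one.\<close>

definition is_cycle :: "'a ugraph \<Rightarrow> 'a list \<Rightarrow> bool" where
  "is_cycle G xs \<longleftrightarrow> length xs \<ge> 3 \<and> distinct xs \<and> set xs \<subseteq> verts G \<and>
     successively (\<lambda>x y. {x, y} \<in> edges G) xs \<and> {last xs, hd xs} \<in> edges G"

definition girth :: "'a ugraph \<Rightarrow> enat" where
  "girth G = (INF xs\<in>{xs. is_cycle G xs}. enat (length xs))"

definition is_tree :: "'a ugraph \<Rightarrow> bool" where
  "is_tree T \<longleftrightarrow> fin_graph T \<and> connected_graph T \<and> (\<nexists>xs. is_cycle T xs)"

definition spanning_tree :: "'a ugraph \<Rightarrow> 'a ugraph \<Rightarrow> bool" where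
  "spanning_tree T G \<longleftrightarrow> is_tree T \<and> verts T = verts G \<and> edges T \<subseteq> edges G"

text \<open>
  Deleting fewer than \<open>k\<close> edges never leaves two distinct components both of which contain a cycle.
  (For a cubic graph and \<open>k > 0\<close> the case \<open>X = {}\<close> includes connectedness.)
\<close>

definition cyclically_edge_connected :: "nat \<Rightarrow> 'a ugraph \<Rightarrow> bool" where
  "cyclically_edge_connected k G \<longleftrightarrow>
     (\<forall>X\<subseteq>edges G. card X < k \<longrightarrow>
        \<not> (\<exists>C\<in>components (del_edges G X). \<exists>D\<in>components (del_edges G X). C \<noteq> D \<and>
             (\<exists>xs. is_cycle (del_edges G X) xs \<and> set xs \<subseteq> C) \<and>
             (\<exists>ys. is_cycle (del_edges G X) ys \<and> set ys \<subseteq> D)))"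

definition proper_edge_coloring :: "nat \<Rightarrow> 'a ugraph \<Rightarrow> ('a set \<Rightarrow> nat) \<Rightarrow> bool" where
  "proper_edge_coloring k G c \<longleftrightarrow> (\<forall>e\<in>edges G. c e < k) \<and>
     (\<forall>e\<in>edges G. \<forall>f\<in>edges G. e \<noteq> f \<and> e \<inter> f \<noteq> {} \<longrightarrow> c e \<noteq> c f)"

definition snark :: "'a ugraph \<Rightarrow> bool" where
  "snark G \<longleftrightarrow> fin_graph G \<and> cubic G \<and> cyclically_edge_connected 4 G \<and> girth G \<ge> 5 \<and>
     \<not> (\<exists>c. proper_edge_coloring 3 G c)"

text \<open>
  The tree \<open>T\<^sub>3\<close> is determined up to isomorphism by the following property, so
  being isomorphic to \<open>T\<^sub>3\<close> means having this property.
\<close>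

definition is_T3 :: "'a ugraph \<Rightarrow> bool" where
  "is_T3 T \<longleftrightarrow> is_tree T \<and> (\<forall>v\<in>verts T. degree T v \<in> {1, 3}) \<and>
     (\<exists>r\<in>verts T. degree T r = 3 \<and> (\<forall>l\<in>verts T. degree T l = 1 \<longrightarrow> graph_dist T r l = 3))"

definition T3_snark :: "'a ugraph \<Rightarrow> bool" where
  "T3_snark G \<longleftrightarrow> snark G \<and> (\<exists>T. spanning_tree T G \<and> is_T3 T)"

end

(*
The twelve leaves of a spanning T_3 induce a 2-regular graph, so a T_3-snark is T_3 plus a disjoint
union of cycles through its leaves, and girth 5 leaves only the cycle lengths 12, 5 + 7 and 6 + 6.
Traversing these cycles leaf by leaf gives a search tree. Whenever an automorphism of T_3 fixes all
leaves visited so far, only one leaf of an orbit needs to be tried as the next one; and a partial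
traversal is abandoned once some 3-edge-colouring of T_3 extends along it and gives all remaining
pendant edges the same colour, because then the order of the remaining leaves does not matter.
42 cyclic arrangements without a 3-edge-colouring remain. Each of them either is isomorphic to one
of three explicit graphs or has a cyclic 3-edge cut; the three graphs are told apart by their
numbers of 6-cycles.
*)

theory Submission
  imports Defs
begin

section \<open>Isomorphisms\<close>

text \<open>The obstacle is symmetry. Skipping a leaf because an automorphism of the tree makes it
  interchangeable with a smaller one replaces the given leaf relation by another one with an
  isomorphic graph, so the search cannot follow one fixed relation. Completeness is therefore stated
  for a property \<open>P\<close> of leaf relations closed under \<open>swaps\<close>, and the
  arrangement found belongs to some relation with \<open>P\<close>. Each replacement fixes all
  visited leaves and lowers the number of the chosen leaf, so finitely many of them lead to a leaf
  that the search tries. Colourings are used in one direction only: a tree colouring that extends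
  along all leaf cycles contradicts the snark property. After renaming colours the edges at the root
  are \<open>Red\<close>, \<open>Green\<close>, \<open>Blue\<close>, which leaves 2^9 tree
  colourings; a selection of them is enough. Along a path of leaves the pendant colours and the
  entering colour determine all further colours, and a cycle closes exactly when the entering colour
  returns.\<close>

definition iso_by :: "('a \<Rightarrow> 'b) \<Rightarrow> 'a ugraph \<Rightarrow> 'b ugraph \<Rightarrow> bool" where
  "iso_by f G H \<longleftrightarrow> bij_betw f (verts G) (verts H) \<and> edges H = (\<lambda>e. f ` e) ` edges G"

lemma graph_iso_iff: "graph_iso G H \<longleftrightarrow> (\<exists>f. iso_by f G H)"
  by (simp add: graph_iso_def iso_by_def)

lemma iso_by_comp: "iso_by f G H \<Longrightarrow> iso_by g H K \<Longrightarrow> iso_by (g \<circ> f) G K"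
  unfolding iso_by_def by (auto intro: bij_betw_trans)

lemma iso_byD:
  assumes "iso_by f G H"
  shows "inj_on f (verts G)" "verts H = f ` verts G" "edges H = (\<lambda>e. f ` e) ` edges G"
  using assms by (auto simp: iso_by_def bij_betw_def)

lemma graph_iso_trans: "graph_iso G H \<Longrightarrow> graph_iso H K \<Longrightarrow> graph_iso G K"
  unfolding graph_iso_iff using iso_by_comp by blast

lemma fin_graph_subset: "fin_graph G \<Longrightarrow> e \<in> edges G \<Longrightarrow> e \<subseteq> verts G"
  by (auto simp: fin_graph_def)

lemma fin_graph_edge:
  assumes "fin_graph G" "{x, y} \<in> edges G"
  shows "x \<in> verts G" "y \<in> verts G" "x \<noteq> y"
  using assms by (fastforce simp: fin_graph_def)+

lemma fin_graph_edgeE: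
  assumes "fin_graph G" "e \<in> edges G"
  obtains x y where "e = {x, y}" "x \<noteq> y" "x \<in> verts G" "y \<in> verts G"
  using assms by (auto simp: fin_graph_def card_2_iff)

lemma finite_edges: "fin_graph G \<Longrightarrow> finite (edges G)"
  by (rule finite_subset[of _ "Pow (verts G)"]) (auto simp: fin_graph_def)

text \<open>\<open>fin_graph\<close> puts every edge inside the vertex set, the only place where the
  inverse function undoes \<open>f\<close>.\<close>

lemma iso_by_inv:
  assumes "iso_by f G H" "fin_graph G"
  shows "iso_by (the_inv_into (verts G) f) H G"
proof -
  let ?g = "the_inv_into (verts G) f"
  note f = iso_byD(1,2)[OF assms(1)] and E = iso_byD(3)[OF assms(1)]
  have "?g ` f ` e = e" if "e \<in> edges G" for e
    using fin_graph_subset[OF assms(2) that] f(1)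
    by (force simp: image_image the_inv_into_f_f subset_iff)
  then have "(\<lambda>e. ?g ` e) ` edges H = edges G"
    unfolding E image_image by (simp add: image_image)
  then show ?thesis
    using assms(1) by (simp add: iso_by_def bij_betw_the_inv_into)
qed

lemma fin_graph_iso:
  assumes "iso_by f G H" "fin_graph G"
  shows "fin_graph H"
proof -
  note f = iso_byD(1,2)[OF assms(1)] and E = iso_byD(3)[OF assms(1)]
  have "card (f ` e) = 2" if "e \<in> edges G" for e
    using that assms(2) f(1) by (metis card_image fin_graph_def inj_on_subset)
  then show ?thesis
    using assms(2) unfolding fin_graph_def f(2) E by blast
qed

lemma graph_iso_sym: "graph_iso G H \<Longrightarrow> fin_graph G \<Longrightarrow> graph_iso H G"
  by (auto simp: graph_iso_iff dest: iso_by_inv)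

lemma iso_by_edge: "iso_by f G H \<Longrightarrow> {x, y} \<in> edges G \<Longrightarrow> {f x, f y} \<in> edges H"
  using iso_byD(3)[of f G H] imageI[of "{x, y}" "edges G" "\<lambda>e. f ` e"] by simp

lemma iso_by_successively:
  assumes "iso_by f G H"
  shows "successively (\<lambda>x y. {x, y} \<in> edges G) xs \<Longrightarrow>
    successively (\<lambda>x y. {x, y} \<in> edges H) (map f xs)"
  by (induction xs rule: induct_list012) (simp_all add: iso_by_edge[OF assms])

lemma iso_by_walk:
  assumes "iso_by f G H" "walk G u xs v"
  shows "walk H (f u) (map f xs) (f v)"
  using assms(2) iso_by_successively[OF assms(1), of xs] iso_byD(2)[OF assms(1)]
  by (auto simp: walk_def hd_map last_map)

lemma iso_by_cycle:
  assumes "iso_by f G H" "is_cycle G xs"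
  shows "is_cycle H (map f xs)"
proof -
  have xs: "set xs \<subseteq> verts G" "xs \<noteq> []"
    using assms(2) by (auto simp: is_cycle_def)
  then have "distinct (map f xs)"
    using assms(2) iso_byD(1)[OF assms(1)]
    by (auto simp: distinct_map is_cycle_def intro: inj_on_subset)
  moreover have "f ` set xs \<subseteq> verts H"
    using xs iso_byD(2)[OF assms(1)] by auto
  ultimately show ?thesis
    using assms(2) xs(2) iso_by_edge[OF assms(1)] iso_by_successively[OF assms(1), of xs]
    by (simp add: is_cycle_def hd_map last_map)
qed

lemma girth_ge_iff: "girth G \<ge> enat k \<longleftrightarrow> (\<forall>xs. is_cycle G xs \<longrightarrow> k \<le> length xs)"
  by (auto simp: girth_def le_INF_iff)

lemma iso_by_degree:
  assumes "iso_by f G H" "fin_graph G" "v \<in> verts G"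
  shows "degree H (f v) = degree G v"
proof -
  have f: "inj_on f (verts G)" and E: "edges H = (\<lambda>e. f ` e) ` edges G"
    using assms(1) by (auto simp: iso_by_def bij_betw_def)
  have sub: "\<And>e. e \<in> edges G \<Longrightarrow> e \<subseteq> verts G"
    using assms(2) by (rule fin_graph_subset)
  have "{e \<in> edges H. f v \<in> e} = (\<lambda>e. f ` e) ` {e \<in> edges G. v \<in> e}"
    unfolding E using sub assms(3) f by (auto dest: inj_onD)
  moreover have "inj_on (\<lambda>e. f ` e) {e \<in> edges G. v \<in> e}"
    using sub by (intro inj_onI) (metis (lifting) f inj_on_image_eq_iff mem_Collect_eq)
  ultimately show ?thesis
    by (simp add: degree_def card_image)
qed

lemma iso_by_del_edges:
  assumes "iso_by f G H" "fin_graph G" "X \<subseteq> edges G"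
  shows "iso_by f (del_edges G X) (del_edges H ((\<lambda>e. f ` e) ` X))"
proof -
  have f: "inj_on f (verts G)" and E: "edges H = (\<lambda>e. f ` e) ` edges G"
    using assms(1) by (auto simp: iso_by_def bij_betw_def)
  have "inj_on (\<lambda>e. f ` e) (edges G)"
    using fin_graph_subset[OF assms(2)]
    by (intro inj_onI) (metis (lifting) f inj_on_image_eq_iff)
  then have "edges H - (\<lambda>e. f ` e) ` X = (\<lambda>e. f ` e) ` (edges G - X)"
    unfolding E using assms(3) by (simp add: inj_on_image_set_diff)
  then show ?thesis
    using assms(1) by (simp add: iso_by_def del_edges_def)
qed

lemma fin_graph_del_edges: "fin_graph G \<Longrightarrow> fin_graph (del_edges G X)"
  by (auto simp: fin_graph_def del_edges_def)

lemma iso_by_components: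
  assumes "iso_by f G H" "fin_graph G" "C \<in> components G"
  shows "f ` C \<in> components H"
proof -
  let ?g = "the_inv_into (verts G) f"
  obtain u where u: "u \<in> verts G" "C = {v. \<exists>xs. walk G u xs v}"
    using assms(3) by (auto simp: components_def)
  note inv = iso_byD(1,2)[OF assms(1)]
  have "f ` C = {v. \<exists>xs. walk H (f u) xs v}"
  proof (intro equalityI subsetI)
    fix y assume "y \<in> f ` C"
    then show "y \<in> {v. \<exists>xs. walk H (f u) xs v}"
      using u iso_by_walk[OF assms(1)] by blast
  next
    fix y assume "y \<in> {v. \<exists>xs. walk H (f u) xs v}"
    then obtain xs where xs: "walk H (f u) xs y"
      by blast
    then have "walk G (?g (f u)) (map ?g xs) (?g y)"
      using iso_by_walk[OF iso_by_inv[OF assms(1,2)]] by blast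
    moreover have "y \<in> verts H"
      using xs last_in_set[of xs] by (auto simp: walk_def)
    ultimately show "y \<in> f ` C"
      using u inv f_the_inv_into_f[OF inv(1)]
      by (intro image_eqI[of _ _ "?g y"]) (auto simp: the_inv_into_f_f)
  qed
  then show ?thesis
    using u(1) inv by (auto simp: components_def)
qed

lemma components_subset:
  assumes "C \<in> components G"
  shows "C \<subseteq> verts G"
proof
  fix v assume "v \<in> C"
  then obtain u xs where "walk G u xs v"
    using assms by (auto simp: components_def)
  then show "v \<in> verts G"
    using last_in_set[of xs] by (auto simp: walk_def)
qed

section \<open>Isomorphism invariance of the snark conditions\<close>

lemma cyclically_edge_connectedD:
  assumes "cyclically_edge_connected k G" "X \<subseteq> edges G" "card X < k"
    "C \<in> components (del_edges G X)" "is_cycle (del_edges G X) xs" "set xs \<subseteq> C"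
    "D \<in> components (del_edges G X)" "is_cycle (del_edges G X) ys" "set ys \<subseteq> D"
  shows "C = D"
proof (rule ccontr)
  assume "C \<noteq> D"
  moreover have "\<not> (\<exists>C\<in>components (del_edges G X). \<exists>D\<in>components (del_edges G X). C \<noteq> D \<and>
             (\<exists>xs. is_cycle (del_edges G X) xs \<and> set xs \<subseteq> C) \<and>
             (\<exists>ys. is_cycle (del_edges G X) ys \<and> set ys \<subseteq> D))"
    using assms(1-3) by (simp add: cyclically_edge_connected_def)
  ultimately show False
    using assms(4-) by blast
qed

text \<open>A separating edge set of \<open>H\<close> is pulled back along the inverse map. Taking
  images cannot increase cardinality, and injectivity on vertices keeps the two components
  distinct.\<close>

lemma cyclically_edge_connected_iso:
  assumes f: "iso_by f G H" and fin: "fin_graph G" and c: "cyclically_edge_connected k G"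
  shows "cyclically_edge_connected k H"
  unfolding cyclically_edge_connected_def
proof (intro allI impI notI)
  fix X assume X: "X \<subseteq> edges H" "card X < k"
  assume "\<exists>C\<in>components (del_edges H X). \<exists>D\<in>components (del_edges H X). C \<noteq> D \<and>
             (\<exists>xs. is_cycle (del_edges H X) xs \<and> set xs \<subseteq> C) \<and>
             (\<exists>ys. is_cycle (del_edges H X) ys \<and> set ys \<subseteq> D)"
  then obtain C D xs ys where C: "C \<in> components (del_edges H X)"
    "is_cycle (del_edges H X) xs" "set xs \<subseteq> C"
    and D: "D \<in> components (del_edges H X)" "is_cycle (del_edges H X) ys" "set ys \<subseteq> D"
    and ne: "C \<noteq> D"
    by blast
  define g where "g = the_inv_into (verts G) f"
  define Y where "Y = (\<lambda>e. g ` e) ` X"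
  have finH: "fin_graph H"
    using f fin by (rule fin_graph_iso)
  have g: "iso_by g H G"
    unfolding g_def using f fin by (rule iso_by_inv)
  have g': "iso_by g (del_edges H X) (del_edges G Y)"
    unfolding Y_def using g finH X(1) by (rule iso_by_del_edges)
  have Y: "Y \<subseteq> edges G"
    using g X(1) by (auto simp: Y_def iso_by_def)
  have "finite X"
    using X(1) finite_edges[OF finH] finite_subset by blast
  then have cardY: "card Y < k"
    using X(2) card_image_le[of X "\<lambda>e. g ` e"] by (simp add: Y_def)
  have comp: "g ` C \<in> components (del_edges G Y)" "g ` D \<in> components (del_edges G Y)"
    using iso_by_components[OF g' fin_graph_del_edges[OF finH]] C(1) D(1) by auto
  have gne: "g ` C \<noteq> g ` D"
  proof -
    have "C \<subseteq> verts H" "D \<subseteq> verts H"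
      using components_subset C(1) D(1) by (fastforce simp: del_edges_def)+
    moreover have "inj_on g (verts H)"
      using iso_byD(1)[OF g] .
    ultimately show ?thesis
      using ne inj_on_image_eq_iff[of g "verts H" C D] by blast
  qed
  have cyc: "is_cycle (del_edges G Y) (map g xs)" "is_cycle (del_edges G Y) (map g ys)"
    using iso_by_cycle[OF g'] C(2) D(2) by auto
  have sets: "set (map g xs) \<subseteq> g ` C" "set (map g ys) \<subseteq> g ` D"
    using C(3) D(3) by auto
  show False
    using cyclically_edge_connectedD[OF c Y cardY comp(1) cyc(1) sets(1) comp(2) cyc(2) sets(2)] gne
    by contradiction
qed

lemma proper_edge_coloringD:
  assumes "proper_edge_coloring k G c"
  shows "e \<in> edges G \<Longrightarrow> c e < k"
    and "d \<in> edges G \<Longrightarrow> e \<in> edges G \<Longrightarrow> d \<noteq> e \<Longrightarrow> d \<inter> e \<noteq> {} \<Longrightarrow> c d \<noteq> c e"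
  using assms by (simp_all add: proper_edge_coloring_def)

lemma proper_edge_coloring_iso:
  assumes f: "iso_by f G H" and fin: "fin_graph G" and c: "proper_edge_coloring k H c"
  shows "proper_edge_coloring k G (\<lambda>e. c (f ` e))"
proof -
  note inj = iso_byD(1)[OF f]
  have E: "f ` e \<in> edges H" if "e \<in> edges G" for e
    using that iso_byD(3)[OF f] by simp
  show ?thesis
    unfolding proper_edge_coloring_def
  proof (intro conjI ballI impI)
    fix e assume "e \<in> edges G"
    then show "c (f ` e) < k"
      by (rule proper_edge_coloringD(1)[OF c E])
  next
    fix d e assume de: "d \<in> edges G" "e \<in> edges G" "d \<noteq> e \<and> d \<inter> e \<noteq> {}"
    then have "f ` d \<noteq> f ` e"
      using fin_graph_subset[OF fin] inj_on_image_eq_iff[OF inj] by simp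
    moreover have "f ` d \<inter> f ` e \<noteq> {}"
      using de by blast
    ultimately show "c (f ` d) \<noteq> c (f ` e)"
      by (rule proper_edge_coloringD(2)[OF c E[OF de(1)] E[OF de(2)]])
  qed
qed

lemma snark_iso:
  assumes "graph_iso G H" "snark G"
  shows "snark H"
proof -
  obtain f where f: "iso_by f G H"
    using assms(1) by (auto simp: graph_iso_iff)
  have fin: "fin_graph G"
    using assms(2) by (simp add: snark_def)
  have "cubic H"
    using assms(2) iso_by_degree[OF f fin] iso_byD(2)[OF f] by (auto simp: cubic_def snark_def)
  moreover have "girth H \<ge> 5"
  proof -
    have "5 \<le> length xs" if "is_cycle H xs" for xs
      using iso_by_cycle[OF iso_by_inv[OF f fin] that] assms(2) girth_ge_iff[of 5 G]
      by (auto simp: snark_def numeral_eq_enat)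
    then show ?thesis
      using girth_ge_iff[of 5 H] by (simp add: numeral_eq_enat)
  qed
  moreover have "\<not> (\<exists>c. proper_edge_coloring 3 H c)"
    using proper_edge_coloring_iso[OF f fin] assms(2) by (auto simp: snark_def)
  ultimately show ?thesis
    using fin_graph_iso[OF f fin] cyclically_edge_connected_iso[OF f fin] assms(2)
    by (simp add: snark_def)
qed

text \<open>The invariant that separates the three snarks. Cycles are counted as lists, so one of
  length \<open>n\<close> counts 2n times; this is invariant too and avoids a quotient by rotation
  and reversal.\<close>

lemma card_cycles_iso:
  assumes "graph_iso G H" "fin_graph G"
  shows "card {xs. is_cycle G xs \<and> length xs = n} = card {xs. is_cycle H xs \<and> length xs = n}"
proof -
  obtain f where f: "iso_by f G H"
    using assms(1) by (auto simp: graph_iso_iff)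
  let ?g = "the_inv_into (verts G) f"
  note inj = iso_byD(1,2)[OF f]
  have "bij_betw (map f) {xs. is_cycle G xs \<and> length xs = n} {xs. is_cycle H xs \<and> length xs = n}"
  proof (rule bij_betw_byWitness[where f' = "map ?g"])
    show "\<forall>xs\<in>{xs. is_cycle G xs \<and> length xs = n}. map ?g (map f xs) = xs"
      using inj by (auto simp: is_cycle_def the_inv_into_f_f subset_iff intro!: map_idI)
    show "\<forall>xs\<in>{xs. is_cycle H xs \<and> length xs = n}. map f (map ?g xs) = xs"
      using inj by (auto simp: is_cycle_def f_the_inv_into_f subset_iff intro!: map_idI)
  qed (use iso_by_cycle[OF f] iso_by_cycle[OF iso_by_inv[OF f assms(2)]] in auto)
  then show ?thesis
    by (rule bij_betw_same_card)
qed

section \<open>Distances in trees\<close>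

lemma walk_append:
  assumes "walk G u xs v" "{v, w} \<in> edges G" "w \<in> verts G"
  shows "walk G u (xs @ [w]) w"
  using assms by (auto simp: walk_def successively_append_iff)

lemma walk_snoc_cases:
  assumes "walk G u xs v" "length xs > 1"
  obtains ys w where "walk G u ys w" "{w, v} \<in> edges G" "xs = ys @ [v]"
proof -
  obtain ys where ys: "xs = ys @ [v]"
    using assms(1) by (metis append_butlast_last_id walk_def)
  then have "ys \<noteq> []"
    using assms(2) by auto
  then have "walk G u ys (last ys)" "{last ys, v} \<in> edges G"
    using assms(1) by (auto simp: ys walk_def successively_append_iff)
  then show ?thesis
    using that ys by blast
qed

lemma walk_rev: "walk G u xs v \<Longrightarrow> walk G v (rev xs) u"
  by (auto simp: walk_def hd_rev last_rev insert_commute)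

lemma walk_join:
  assumes "walk G u xs v" "walk G v ys w"
  shows "walk G u (xs @ tl ys) w"
proof (cases "tl ys")
  case Nil
  then have "ys = [v]"
    using assms(2) by (cases ys) (auto simp: walk_def)
  then show ?thesis
    using assms by (simp add: walk_def)
next
  case (Cons z zs)
  then have "ys = v # z # zs"
    using assms(2) by (cases ys) (auto simp: walk_def)
  then show ?thesis
    using assms by (auto simp: walk_def successively_append_iff)
qed

text \<open>Cutting out the part between two occurrences of a vertex shortens the walk.\<close>

lemma walk_distinct:
  assumes "walk G u xs v"
  obtains ys where "walk G u ys v" "distinct ys" "set ys \<subseteq> set xs"
  using assms
proof (induction xs arbitrary: thesis rule: length_induct)
  case (1 xs)
  show ?case
  proof (cases "distinct xs")
    case True
    then show ?thesis
      using "1.prems" by blast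
  next
    case False
    then obtain as bs cs y where xs: "xs = as @ [y] @ bs @ [y] @ cs"
      using not_distinct_decomp by blast
    have "walk G u (as @ [y] @ cs) v"
      using "1.prems"(2) unfolding walk_def xs
      by (auto simp: successively_append_iff hd_append successively_Cons)
    moreover have "length (as @ [y] @ cs) < length xs" "set (as @ [y] @ cs) \<subseteq> set xs"
      by (auto simp: xs)
    ultimately show ?thesis
      using "1.IH" "1.prems"(1) by (metis subset_trans)
  qed
qed

definition nbrs :: "'a ugraph \<Rightarrow> 'a \<Rightarrow> 'a set" where
  "nbrs G v = {u. {v, u} \<in> edges G}"

lemma edges_at: "fin_graph G \<Longrightarrow> {e \<in> edges G. v \<in> e} = (\<lambda>u. {v, u}) ` nbrs G v"
proof (intro equalityI subsetI)
  fix e assume G: "fin_graph G" and e: "e \<in> {e \<in> edges G. v \<in> e}"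
  then obtain x y where "e = {x, y}"
    by (auto elim: fin_graph_edgeE)
  then show "e \<in> (\<lambda>u. {v, u}) ` nbrs G v"
    using e by (auto simp: nbrs_def insert_commute)
qed (auto simp: nbrs_def)

lemma degree_eq_card_nbrs: "fin_graph G \<Longrightarrow> degree G v = card (nbrs G v)"
  unfolding degree_def edges_at by (rule card_image) (auto simp: inj_on_def doubleton_eq_iff)

lemma finite_nbrs: "fin_graph G \<Longrightarrow> finite (nbrs G v)"
  by (rule finite_subset[of _ "verts G"]) (auto simp: nbrs_def fin_graph_edge fin_graph_def)

text \<open>A natural number version of \<open>graph_dist\<close>, convenient for induction. Walks
  are lists of vertices, hence one entry more than the number of edges.\<close>

definition dst :: "'a ugraph \<Rightarrow> 'a \<Rightarrow> 'a \<Rightarrow> nat" where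
  "dst G r v = (LEAST n. \<exists>xs. walk G r xs v \<and> length xs = Suc n)"

text \<open>
  Heap numbering of \<open>T\<^sub>3\<close>: the root is 0, its children are 1, 2, 3, the children of
  \<open>n \<in> {1..9}\<close> are \<open>2n + 2\<close> and \<open>2n + 3\<close>, and the leaves are 10, ..., 21.
\<close>

definition parent :: "nat \<Rightarrow> nat" where
  "parent n = (if n \<le> 3 then 0 else (n - 2) div 2)"

text \<open>The index among the siblings, counted from 0. Below the children of the root, first
  children have even and second children odd numbers.\<close>

definition child_pos :: "nat \<Rightarrow> nat" where
  "child_pos n = (if n \<le> 3 then n - 1 else n mod 2)"

definition level :: "nat \<Rightarrow> nat" where
  "level n = (if n = 0 then 0 else if n \<le> 3 then 1 else if n \<le> 9 then 2 else 3)"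

lemma parent_less: "n > 0 \<Longrightarrow> parent n < n"
  by (auto simp: parent_def)

text \<open>Above 3, \<open>parent\<close> and \<open>child_pos\<close> are the quotient and the
  remainder of \<open>n - 2\<close> modulo 2, so together they determine \<open>n\<close>.\<close>

lemma parent_pos_inj:
  assumes "child_pos m = child_pos n" "parent m = parent n" "level m = level n" "\<not> (m = 0 \<or> n = 0)"
  shows "m = n"
proof (cases "m \<le> 3")
  case True
  then have "n \<le> 3"
    using assms(3,4) by (auto simp: level_def split: if_splits)
  then show ?thesis
    using True assms by (auto simp: child_pos_def)
next
  case False
  then have "\<not> n \<le> 3"
    using assms(3,4) by (auto simp: level_def split: if_splits)
  have pos: "(k - 2) mod 2 = k mod 2" if "\<not> k \<le> 3" for k :: nat
  proof -
    have "k - 2 + 2 = k"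
      using that by linarith
    then show ?thesis
      using mod_add_self2[of "k - 2" 2] by (simp only:)
  qed
  have "(m - 2) div 2 = (n - 2) div 2" "(m - 2) mod 2 = (n - 2) mod 2"
    using False \<open>\<not> n \<le> 3\<close> assms(1,2) pos[of m] pos[of n] by (simp_all add: parent_def child_pos_def)
  then have "m - 2 = n - 2"
    by (metis div_mult_mod_eq)
  then show ?thesis
    using False \<open>\<not> n \<le> 3\<close> by linarith
qed

text \<open>The guard \<open>parent n < n\<close> makes termination evident for every argument;
  \<open>parent_less\<close> provides it for positive \<open>n\<close>.\<close>

fun heap_label :: "'a \<Rightarrow> ('a \<Rightarrow> 'a list) \<Rightarrow> nat \<Rightarrow> 'a" where
  "heap_label r cs n =
     (if n = 0 then r else if parent n < n then cs (heap_label r cs (parent n)) ! child_pos n else r)"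

declare heap_label.simps [simp del]

lemma heap_label_0 [simp]: "heap_label r cs 0 = r"
  by (simp add: heap_label.simps)

lemma heap_label_pos:
  "n > 0 \<Longrightarrow> heap_label r cs n = cs (heap_label r cs (parent n)) ! child_pos n"
  using parent_less[of n] by (simp add: heap_label.simps[of r cs n])

context
  fixes T :: "'a ugraph" and r :: 'a
  assumes tree: "is_tree T" and r: "r \<in> verts T"
begin

lemma fin_tree: "fin_graph T"
  using tree by (simp add: is_tree_def)

lemma tree_edge:
  "{x, y} \<in> edges T \<Longrightarrow> x \<in> verts T" "{x, y} \<in> edges T \<Longrightarrow> y \<in> verts T"
  "{x, y} \<in> edges T \<Longrightarrow> x \<noteq> y"
  using fin_graph_edge[OF fin_tree] by auto

lemma walk_length_pos: "walk T u xs v \<Longrightarrow> length xs = Suc (length xs - 1)"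
  by (cases xs) (auto simp: walk_def)

lemma dst_walk:
  assumes "v \<in> verts T"
  obtains xs where "walk T r xs v" "length xs = Suc (dst T r v)"
proof -
  obtain xs where "walk T r xs v"
    using tree r assms unfolding is_tree_def connected_graph_def by blast
  then have "\<exists>n xs. walk T r xs v \<and> length xs = Suc n"
    using walk_length_pos by blast
  then have "\<exists>xs. walk T r xs v \<and> length xs = Suc (dst T r v)"
    unfolding dst_def by (rule LeastI_ex)
  then show ?thesis
    using that by blast
qed

lemma dst_le: "walk T r xs v \<Longrightarrow> length xs = Suc n \<Longrightarrow> dst T r v \<le> n"
  unfolding dst_def by (rule Least_le) blast

lemma graph_dist_eq:
  assumes "v \<in> verts T"
  shows "graph_dist T r v = enat (dst T r v)"
proof (rule antisym)
  obtain xs where "walk T r xs v" "length xs = Suc (dst T r v)"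
    using dst_walk assms .
  then show "graph_dist T r v \<le> enat (dst T r v)"
    unfolding graph_dist_def by (intro INF_lower2[of xs]) auto
  show "enat (dst T r v) \<le> graph_dist T r v"
    unfolding graph_dist_def
    by (intro INF_greatest) (use dst_le walk_length_pos in \<open>metis enat_ord_simps(1) mem_Collect_eq\<close>)
qed

lemma dst_root: "dst T r r = 0"
  using dst_le[of "[r]" r 0] r by (auto simp: walk_def)

lemma dst_0: "v \<in> verts T \<Longrightarrow> dst T r v = 0 \<Longrightarrow> v = r"
  by (rule dst_walk, assumption) (auto simp: walk_def length_Suc_conv)

lemma dst_edge:
  assumes "{u, v} \<in> edges T"
  shows "dst T r v \<le> Suc (dst T r u)"
proof -
  obtain xs where "walk T r xs u" "length xs = Suc (dst T r u)"
    using dst_walk tree_edge(1)[OF assms] .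
  then show ?thesis
    using dst_le[of "xs @ [v]"] walk_append[of T r xs u v] tree_edge(2)[OF assms] assms by simp
qed

lemma parent_ex:
  assumes "v \<in> verts T" "v \<noteq> r"
  obtains u where "{u, v} \<in> edges T" "dst T r v = Suc (dst T r u)"
proof -
  obtain xs where xs: "walk T r xs v" "length xs = Suc (dst T r v)"
    using dst_walk assms(1) .
  have pos: "dst T r v > 0"
    using dst_0 assms by auto
  then obtain ys w where w: "walk T r ys w" "{w, v} \<in> edges T" "xs = ys @ [v]"
    using walk_snoc_cases[OF xs(1)] xs(2) by auto
  then have "Suc (dst T r w) \<le> dst T r v"
    using dst_le[of ys w "dst T r v - 1"] xs(2) pos by simp
  then show ?thesis
    using that[OF w(2)] dst_edge[OF w(2)] by simp
qed

text \<open>Apart from its end \<open>u\<close>, the walk built by repeatedly passing to a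
  predecessor contains only vertices closer to the root than \<open>u\<close>. None of these is
  \<open>v\<close>, which is at least as far away as \<open>u\<close>.\<close>

lemma walk_avoiding:
  assumes "u \<in> verts T" "u \<noteq> v" "dst T r u \<le> dst T r v"
  shows "\<exists>xs. walk T r xs u \<and> v \<notin> set xs"
  using assms
proof (induction "dst T r u" arbitrary: u)
  case 0
  then have "u = r"
    using dst_0 by simp
  then show ?case
    using 0 r by (intro exI[of _ "[r]"]) (auto simp: walk_def)
next
  case (Suc n)
  then have "u \<noteq> r"
    using dst_root by auto
  then obtain p where p: "{p, u} \<in> edges T" "dst T r u = Suc (dst T r p)"
    using parent_ex Suc.prems(1) by blast
  then obtain xs where "walk T r xs p" "v \<notin> set xs"
    using Suc.hyps(1)[of p] Suc.hyps(2) Suc.prems(3) tree_edge(1)[OF p(1)] by fastforce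
  then show ?case
    using walk_append[of T r xs p u] p Suc.prems by (intro exI[of _ "xs @ [u]"]) auto
qed

text \<open>This is where acyclicity enters: walks from the root to \<open>a\<close> and to
  \<open>b\<close> that avoid \<open>v\<close> would combine to a path from \<open>a\<close> to
  \<open>b\<close>, which \<open>v\<close> closes to a cycle. Allowing equal distances also excludes
  edges within a level.\<close>

lemma two_lower_neighbors:
  assumes "{v, a} \<in> edges T" "{v, b} \<in> edges T" "dst T r a \<le> dst T r v" "dst T r b \<le> dst T r v"
  shows "a = b"
proof (rule ccontr)
  assume "a \<noteq> b"
  obtain xs where xs: "walk T r xs a" "v \<notin> set xs"
    using walk_avoiding[of a v] assms tree_edge[OF assms(1)] by auto
  obtain ys where ys: "walk T r ys b" "v \<notin> set ys"
    using walk_avoiding[of b v] assms tree_edge[OF assms(2)] by auto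
  have "walk T a (rev xs @ tl ys) b"
    using walk_join walk_rev xs(1) ys(1) by metis
  then obtain zs where zs: "walk T a zs b" "distinct zs" "set zs \<subseteq> set (rev xs @ tl ys)"
    by (rule walk_distinct)
  moreover have "v \<notin> set (rev xs @ tl ys)"
    using xs(2) ys(2) by (cases ys) auto
  ultimately have "v \<notin> set zs"
    by blast
  \<comment> \<open>The ends \<open>a\<close> and \<open>b\<close> differ, so the path has at least
    two vertices and \<open>v\<close> completes it to a list of length at least 3.\<close>
  obtain z z' zs' where zz: "zs = z # z' # zs'"
    using zs(1) \<open>a \<noteq> b\<close> by (cases zs rule: remdups_adj.cases) (auto simp: walk_def)
  have "is_cycle T (v # zs)"
    using zs(1,2) assms(1,2) tree_edge(1)[OF assms(1)] \<open>v \<notin> set zs\<close>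
    unfolding is_cycle_def zz walk_def by (auto simp: insert_commute)
  then show False
    using tree by (simp add: is_tree_def)
qed

section \<open>Parents, children and the numbering of the tree\<close>

definition children :: "'a \<Rightarrow> 'a set" where
  "children v = {u. {v, u} \<in> edges T \<and> dst T r u = Suc (dst T r v)}"

lemma nbrs_root: "nbrs T r = children r"
proof -
  have "dst T r u = Suc (dst T r r)" if "{r, u} \<in> edges T" for u
    using dst_edge[OF that] dst_0[of u] tree_edge[OF that] dst_root by fastforce
  then show ?thesis
    by (auto simp: nbrs_def children_def)
qed

lemma nbrs_nonroot:
  assumes "v \<in> verts T" "v \<noteq> r"
  obtains p where "nbrs T v = insert p (children v)" "p \<notin> children v" "v \<in> children p"
proof -
  obtain p where p: "{p, v} \<in> edges T" "dst T r v = Suc (dst T r p)"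
    using parent_ex assms .
  have "u = p \<or> dst T r u = Suc (dst T r v)" if "{v, u} \<in> edges T" for u
    using two_lower_neighbors[of v u p] dst_edge[OF that] that p by (auto simp: insert_commute)
  then have "nbrs T v = insert p (children v)"
    using p by (auto simp: nbrs_def children_def insert_commute)
  then show ?thesis
    using that p by (auto simp: children_def)
qed

lemma children_inj: "u \<in> children p \<Longrightarrow> u \<in> children q \<Longrightarrow> p = q"
  using two_lower_neighbors[of u p q] by (auto simp: children_def insert_commute)

lemma finite_children: "finite (children v)"
  using finite_nbrs[OF fin_tree, of v] by (rule finite_subset[rotated]) (auto simp: children_def nbrs_def)

lemma children_verts: "u \<in> children v \<Longrightarrow> u \<in> verts T"
  using tree_edge by (auto simp: children_def)

context
  assumes deg: "\<forall>v\<in>verts T. degree T v \<in> {1, 3}" and deg_r: "degree T r = 3"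
    and leaves: "\<forall>l\<in>verts T. degree T l = 1 \<longrightarrow> graph_dist T r l = 3"
begin

lemma leaf_dst: "l \<in> verts T \<Longrightarrow> degree T l = 1 \<Longrightarrow> dst T r l = 3"
  using leaves graph_dist_eq[of l] by (auto simp: numeral_eq_enat)

lemma card_children_root: "card (children r) = 3"
  using deg_r by (simp add: degree_eq_card_nbrs[OF fin_tree] nbrs_root)

lemma card_children:
  assumes "v \<in> verts T" "v \<noteq> r"
  shows "Suc (card (children v)) = degree T v"
  using nbrs_nonroot[OF assms] finite_children[of v]
  by (metis card_insert_disjoint degree_eq_card_nbrs[OF fin_tree])

text \<open>A vertex at maximal distance has no children. It is therefore a leaf, and leaves are at
  distance 3.\<close>

lemma dst_le_3:
  assumes "v \<in> verts T"
  shows "dst T r v \<le> 3"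
proof -
  define m where "m = Max (dst T r ` verts T)"
  have fin: "finite (verts T)"
    using fin_tree by (simp add: fin_graph_def)
  then have "m \<in> dst T r ` verts T"
    unfolding m_def using r by (intro Max_in) auto
  then obtain w where w: "w \<in> verts T" "dst T r w = m"
    by blast
  have max: "dst T r u \<le> m" if "u \<in> verts T" for u
    unfolding m_def using fin that by simp
  have "children w = {}"
    using max w(2) children_verts by (fastforce simp: children_def)
  then have "w \<noteq> r" "degree T w = 1"
    using card_children_root card_children[OF w(1)] by fastforce+
  then have "m = 3"
    using leaf_dst w by simp
  then show ?thesis
    using max[OF assms] by simp
qed

lemma card_children_inner:
  assumes "v \<in> verts T" "v \<noteq> r" "dst T r v < 3"
  shows "card (children v) = 2"
  using card_children[OF assms(1,2)] leaf_dst[OF assms(1)] deg assms by fastforce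

definition child_lists :: "'a \<Rightarrow> 'a list" where
  "child_lists = (SOME f. \<forall>v. distinct (f v) \<and> set (f v) = children v)"

lemma child_lists: "distinct (child_lists v)" "set (child_lists v) = children v"
proof -
  have "\<exists>f. \<forall>v. distinct (f v) \<and> set (f v) = children v"
    using finite_distinct_list[OF finite_children] by metis
  then have "\<forall>v. distinct (child_lists v) \<and> set (child_lists v) = children v"
    unfolding child_lists_def by (rule someI_ex)
  then show "distinct (child_lists v)" "set (child_lists v) = children v"
    by auto
qed

lemma length_child_lists: "length (child_lists v) = card (children v)"
  using child_lists[of v] distinct_card by metis

abbreviation "lbl \<equiv> heap_label r child_lists"

text \<open>A number below 22 has a parent below 10, hence on a level below 3. There the root has
  three children and every other vertex two, so the child with index \<open>child_pos n\<close>
  exists.\<close>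

lemma label_in:
  assumes "n < 22"
  shows "lbl n \<in> verts T \<and> dst T r (lbl n) = level n \<and> (n > 0 \<longrightarrow> lbl n \<in> children (lbl (parent n)) \<and> child_pos n < card (children (lbl (parent n))))"
  using assms
proof (induction n rule: less_induct)
  case (less n)
  show ?case
  proof (cases "n = 0")
    case True
    then show ?thesis
      using r dst_root by (simp add: level_def)
  next
    case False
    let ?p = "lbl (parent n)"
    have p: "parent n < n" "parent n < 10" "level n = Suc (level (parent n))"
      using False less.prems by (auto simp: parent_def level_def)
    then have IH: "?p \<in> verts T" "dst T r ?p = level (parent n)"
      using less.IH[of "parent n"] less.prems by auto
    have pos: "child_pos n < length (child_lists ?p)"
    proof (cases "n \<le> 3")
      case True
      then have "?p = r"
        by (simp add: parent_def)
      then show ?thesis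
        using True False card_children_root by (simp add: length_child_lists child_pos_def)
    next
      case 2: False
      then have "parent n > 0" "level (parent n) < 3"
        using less.prems by (auto simp: parent_def level_def)
      moreover from this have "?p \<noteq> r"
        using IH(2) dst_root by (auto simp: level_def split: if_splits)
      ultimately have "card (children ?p) = 2"
        using card_children_inner IH by simp
      then show ?thesis
        using 2 by (simp add: length_child_lists child_pos_def)
    qed
    then have "lbl n \<in> children ?p"
      using child_lists(2)[of ?p] nth_mem False by (auto simp: heap_label_pos)
    then show ?thesis
      using IH p(3) pos children_verts[of "lbl n" ?p] by (simp add: children_def length_child_lists)
  qed
qed

lemma label_inj:
  assumes "m < 22" "n < 22" "lbl m = lbl n"
  shows "m = n"
  using assms
proof (induction m arbitrary: n rule: less_induct)
  case (less m)
  have lev: "level m = level n"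
    using label_in less.prems by metis
  show ?case
  proof (cases "m = 0 \<or> n = 0")
    case True
    then show ?thesis
      using lev by (auto simp: level_def split: if_splits)
  next
    case False
    have "lbl m \<in> children (lbl (parent m))" "lbl m \<in> children (lbl (parent n))"
      using label_in[OF less.prems(1)] label_in[OF less.prems(2)] False less.prems(3) by simp_all
    then have "lbl (parent m) = lbl (parent n)"
      by (rule children_inj)
    moreover have "parent m < m" "parent m < 22" "parent n < 22"
      using False less.prems by (auto simp: parent_def)
    ultimately have par: "parent m = parent n"
      using less.IH by blast
    let ?cs = "child_lists (lbl (parent n))"
    have "child_pos m < length ?cs" "child_pos n < length ?cs" "?cs ! child_pos m = ?cs ! child_pos n"
      using label_in[OF less.prems(1)] label_in[OF less.prems(2)] less.prems(3) False par
      by (auto simp: heap_label_pos length_child_lists)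
    then have "child_pos m = child_pos n"
      using child_lists(1) nth_eq_iff_index_eq by blast
    then show ?thesis
      using par lev False by (rule parent_pos_inj)
  qed
qed

lemma label_surj:
  assumes "v \<in> verts T"
  shows "\<exists>n<22. lbl n = v"
  using assms
proof (induction "dst T r v" arbitrary: v)
  case 0
  then show ?case
    using dst_0[of v] by (intro exI[of _ 0]) simp
next
  case (Suc k)
  then have "v \<noteq> r"
    using dst_root by auto
  then obtain p where p: "{p, v} \<in> edges T" "dst T r v = Suc (dst T r p)"
    using parent_ex Suc.prems by blast
  then obtain m where m: "m < 22" "lbl m = p"
    using Suc.hyps tree_edge(1)[OF p(1)] by fastforce
  have "v \<in> set (child_lists p)"
    using p child_lists by (auto simp: children_def)
  then obtain j where j: "j < length (child_lists p)" "child_lists p ! j = v"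
    by (auto simp: in_set_conv_nth)
  have "level m < 3"
    using label_in[OF m(1)] m(2) p(2) dst_le_3[OF Suc.prems] by simp
  then have m10: "m < 10"
    by (auto simp: level_def split: if_splits)
  show ?case
  proof (cases "m = 0")
    case True
    then have "j < 3" "p = r"
      using j m card_children_root by (auto simp: length_child_lists)
    then have "parent (Suc j) = 0" "child_pos (Suc j) = j"
      by (auto simp: parent_def child_pos_def)
    then have "lbl (Suc j) = v"
      using j(2) \<open>p = r\<close> by (simp add: heap_label_pos)
    then show ?thesis
      using \<open>j < 3\<close> by (intro exI[of _ "Suc j"]) simp
  next
    case False
    then have "p \<noteq> r"
      using label_inj[of m 0] m by auto
    then have "j < 2"
      using card_children_inner[of p] tree_edge(1)[OF p(1)] p(2) dst_le_3[OF Suc.prems] j(1)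
      by (simp add: length_child_lists)
    then have "parent (2 * m + 2 + j) = m" "child_pos (2 * m + 2 + j) = j"
      using False by (auto simp: parent_def child_pos_def)
    then have "lbl (2 * m + 2 + j) = v"
      using j(2) m(2) by (simp add: heap_label_pos)
    then show ?thesis
      using m10 \<open>j < 2\<close> by (intro exI[of _ "2 * m + 2 + j"]) simp
  qed
qed

lemma label_bij: "bij_betw lbl {0..<22} (verts T)"
proof (rule bij_betw_imageI)
  show "inj_on lbl {0..<22}"
    using label_inj by (auto intro: inj_onI)
  show "lbl ` {0..<22} = verts T"
  proof (intro equalityI subsetI)
    fix v assume "v \<in> verts T"
    then show "v \<in> lbl ` {0..<22}"
      using label_surj[of v] by auto
  qed (use label_in in auto)
qed

lemma label_edges: "edges T = (\<lambda>n. {lbl (parent n), lbl n}) ` {1..<22}"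
proof (intro equalityI subsetI)
  fix e assume e: "e \<in> edges T"
  then obtain x y where xy: "e = {x, y}"
    using fin_tree by (auto elim: fin_graph_edgeE)
  \<comment> \<open>Oriented away from the root, an edge is determined by its far end, which has
    only one parent.\<close>
  have *: "{u, v} \<in> (\<lambda>n. {lbl (parent n), lbl n}) ` {1..<22}"
    if uv: "{u, v} \<in> edges T" "dst T r u \<le> dst T r v" for u v
  proof -
    have "v \<noteq> r"
      using uv dst_root dst_0[of u] tree_edge[OF uv(1)] by auto
    then obtain p where p: "{p, v} \<in> edges T" "dst T r v = Suc (dst T r p)"
      using parent_ex tree_edge(2)[OF uv(1)] by blast
    then have "u = p"
      using two_lower_neighbors[of v u p] uv by (auto simp: insert_commute)
    obtain n where n: "n < 22" "lbl n = v"
      using label_surj tree_edge(2)[OF uv(1)] by blast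
    then have "n > 0"
      using \<open>v \<noteq> r\<close> by (cases n) auto
    then have "v \<in> children (lbl (parent n))"
      using label_in[OF n(1)] n(2) by auto
    moreover have "v \<in> children p"
      using p by (auto simp: children_def)
    ultimately have "lbl (parent n) = u"
      using children_inj \<open>u = p\<close> by blast
    then show ?thesis
      using n \<open>n > 0\<close> by (intro image_eqI[of _ _ n]) auto
  qed
  show "e \<in> (\<lambda>n. {lbl (parent n), lbl n}) ` {1..<22}"
    using *[of x y] *[of y x] e unfolding xy by (cases "dst T r x \<le> dst T r y") (auto simp: insert_commute)
next
  fix e assume "e \<in> (\<lambda>n. {lbl (parent n), lbl n}) ` {1..<22}"
  then show "e \<in> edges T"
    using label_in by (auto simp: children_def)
qed

end

end

text \<open>The uniqueness of the tree, in the form in which it is used: every such tree is a copy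
  of the heap numbering on 0, ..., 21.\<close>

lemma is_T3_labeling:
  assumes "is_T3 T"
  obtains f where "bij_betw f {0..<22} (verts T)" "edges T = (\<lambda>n. {f (parent n), f n}) ` {1..<22}"
proof -
  obtain r where A: "is_tree T" "r \<in> verts T" "\<forall>v\<in>verts T. degree T v \<in> {1, 3}"
    "degree T r = 3" "\<forall>l\<in>verts T. degree T l = 1 \<longrightarrow> graph_dist T r l = 3"
    using assms by (auto simp: is_T3_def)
  show ?thesis
    by (rule that[OF label_bij[OF A] label_edges[OF A]])
qed

section \<open>Searching the arrangements of the leaves\<close>

text \<open>A type with exactly twelve elements, so that relations and permutations of leaves need
  no range conditions.\<close>

datatype leaf = L0 | L1 | L2 | L3 | L4 | L5 | L6 | L7 | L8 | L9 | L10 | L11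

datatype color = Red | Green | Blue

text \<open>Meant for two distinct colours; the diagonal values only make the function
  total.\<close>

fun third :: "color \<Rightarrow> color \<Rightarrow> color" where
  "third Red Green = Blue" | "third Red Blue = Green" | "third Green Red = Blue"
| "third Green Blue = Red" | "third Blue Red = Green" | "third Blue Green = Red"
| "third Red Red = Red" | "third Green Green = Green" | "third Blue Blue = Blue"

text \<open>Encodes the binary choice at an inner vertex of the tree: if the edge from above has
  colour \<open>c\<close>, the edges to the two children get \<open>other c b\<close> and
  \<open>other c (\<not> b)\<close>.\<close>

fun other :: "color \<Rightarrow> bool \<Rightarrow> color" where
  "other Red False = Green" | "other Red True = Blue"
| "other Green False = Red" | "other Green True = Blue"
| "other Blue False = Red" | "other Blue True = Green"

text \<open>
  A 3-edge-colouring of \<open>T\<^sub>3\<close> that colours the edges at the root \<open>Red\<close>, \<open>Green\<close>, \<open>Blue\<close> is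
  given by nine binary choices, one at each child and one at each grandchild of the root. Only the
  colours \<open>lcol\<close> of the pendant edges matter for extending it to the leaf cycles.
\<close>

datatype tree_col = TC bool bool bool bool bool bool bool bool bool

fun lcol :: "tree_col \<Rightarrow> leaf \<Rightarrow> color" where
  "lcol (TC a b c d e f g h i) L0 = other (other Red a) b"
| "lcol (TC a b c d e f g h i) L1 = other (other Red a) (\<not> b)"
| "lcol (TC a b c d e f g h i) L2 = other (other Red (\<not> a)) c"
| "lcol (TC a b c d e f g h i) L3 = other (other Red (\<not> a)) (\<not> c)"
| "lcol (TC a b c d e f g h i) L4 = other (other Green d) e"
| "lcol (TC a b c d e f g h i) L5 = other (other Green d) (\<not> e)"
| "lcol (TC a b c d e f g h i) L6 = other (other Green (\<not> d)) f"
| "lcol (TC a b c d e f g h i) L7 = other (other Green (\<not> d)) (\<not> f)"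
| "lcol (TC a b c d e f g h i) L8 = other (other Blue g) h"
| "lcol (TC a b c d e f g h i) L9 = other (other Blue g) (\<not> h)"
| "lcol (TC a b c d e f g h i) L10 = other (other Blue (\<not> g)) i"
| "lcol (TC a b c d e f g h i) L11 = other (other Blue (\<not> g)) (\<not> i)"

fun sib :: "leaf \<Rightarrow> leaf" where
  "sib L0 = L1" | "sib L1 = L0" | "sib L2 = L3" | "sib L3 = L2" | "sib L4 = L5" | "sib L5 = L4"
| "sib L6 = L7" | "sib L7 = L6" | "sib L8 = L9" | "sib L9 = L8" | "sib L10 = L11" | "sib L11 = L10"

text \<open>
  \<open>CS k e d\<close>: under the tree colouring \<open>k\<close>, an edge of colour \<open>e\<close> enters the current leaf path and
  therefore an edge of colour \<open>d\<close> leaves it.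
\<close>

datatype cstate = CS tree_col color color

text \<open>Off the diagonal this is the table of \<open>third\<close>. A state dies when the
  arriving edge and the pendant edge of the new leaf have the same colour.\<close>

fun advance_state :: "color \<Rightarrow> color \<Rightarrow> tree_col \<Rightarrow> color \<Rightarrow> cstate list \<Rightarrow> cstate list" where
  "advance_state Red Red k e xs = xs" | "advance_state Green Green k e xs = xs" | "advance_state Blue Blue k e xs = xs"
| "advance_state Red Green k e xs = CS k e Blue # xs" | "advance_state Red Blue k e xs = CS k e Green # xs"
| "advance_state Green Red k e xs = CS k e Blue # xs" | "advance_state Green Blue k e xs = CS k e Red # xs"
| "advance_state Blue Red k e xs = CS k e Green # xs" | "advance_state Blue Green k e xs = CS k e Red # xs"

fun advance :: "leaf \<Rightarrow> cstate list \<Rightarrow> cstate list" where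
  "advance z [] = []"
| "advance z (CS k e d # xs) = advance_state (lcol k z) d k e (advance z xs)"

text \<open>The first leaf of a cycle may be entered by either colour that its pendant edge leaves
  free. Both guesses are kept until the cycle closes.\<close>

fun start_state :: "color \<Rightarrow> tree_col \<Rightarrow> cstate list \<Rightarrow> cstate list" where
  "start_state Red k xs = CS k Green Blue # CS k Blue Green # xs"
| "start_state Green k xs = CS k Red Blue # CS k Blue Red # xs"
| "start_state Blue k xs = CS k Red Green # CS k Green Red # xs"

fun start_states :: "leaf \<Rightarrow> tree_col list \<Rightarrow> cstate list" where
  "start_states z [] = []"
| "start_states z (k # ks) = start_state (lcol k z) k (start_states z ks)"

text \<open>On a closed cycle the edge that enters the first leaf is the edge that leaves the last
  one, so the guess must agree with the outcome.\<close>

fun closed_cols :: "cstate list \<Rightarrow> tree_col list" where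
  "closed_cols [] = []"
| "closed_cols (CS k e d # xs) = (if d = e then k # closed_cols xs else closed_cols xs)"

text \<open>With constant pendant colour \<open>c\<close> the path edges alternate between the other
  two colours. The list order of the leaves therefore stands for every order of them.\<close>

fun same_color_from :: "tree_col \<Rightarrow> color \<Rightarrow> leaf list \<Rightarrow> color \<Rightarrow> color \<Rightarrow> bool" where
  "same_color_from k c [] d e = (d = e)"
| "same_color_from k c (z # zs) d e = (if lcol k z = c then same_color_from k c zs (third c d) e else False)"

fun same_color_rest :: "leaf list \<Rightarrow> cstate list \<Rightarrow> bool" where
  "same_color_rest [] xs = False"
| "same_color_rest (z # zs) [] = False"
| "same_color_rest (z # zs) (CS k e d # xs) =
     (if if lcol k z = d then False else same_color_from k (lcol k z) (z # zs) d e then True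
      else same_color_rest (z # zs) xs)"

text \<open>Meant as a product of disjoint transpositions, hence as an involution.\<close>

type_synonym swap = "(leaf \<times> leaf) list"

fun moves :: "leaf \<Rightarrow> swap \<Rightarrow> bool" where
  "moves l [] = False"
| "moves l ((x, y) # s) = (if l = x then True else if l = y then True else moves l s)"

text \<open>The pairs in \<open>swaps\<close> have the smaller leaf first, so the second components
  are the leaves that a swap makes smaller.\<close>

fun lowers :: "leaf \<Rightarrow> swap list \<Rightarrow> bool" where
  "lowers l [] = False"
| "lowers l (s # ss) = (if l \<in> set (map snd s) then True else lowers l ss)"

text \<open>Closing the path joins \<open>x\<close> to \<open>s\<close>. The pairs of leaves at
  distance one or two across this seam are (x, s), (x, t) and (y, s), and none of them may be
  siblings; elsewhere \<open>ext_ok\<close> has ensured this.\<close>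

fun close_ok :: "leaf list \<Rightarrow> bool" where
  "close_ok (x # y # ws) =
     (let s = last ws; t = last (butlast ws) in sib x \<noteq> s \<and> sib x \<noteq> t \<and> sib y \<noteq> s)"
| "close_ok _ = False"

fun ext_ok :: "leaf list \<Rightarrow> leaf \<Rightarrow> bool" where
  "ext_ok [] z = False"
| "ext_ok [x] z = (sib z \<noteq> x)"
| "ext_ok (x # y # ws) z = (if sib z = x then False else sib z \<noteq> y)"

text \<open>Five is the least length of a leaf cycle. Fewer unvisited leaves cannot form a cycle of
  their own and must all join the current path; only then is the test for equal pendant colours
  conclusive.\<close>

fun at_least_5 :: "leaf list \<Rightarrow> bool" where
  "at_least_5 (a # b # c # d # e # xs) = True"
| "at_least_5 _ = False"

fun cands :: "leaf list \<Rightarrow> swap list \<Rightarrow> leaf list \<Rightarrow> leaf list" where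
  "cands p ss [] = []"
| "cands p ss (z # zs) =
     (if ext_ok p z then if lowers z ss then cands p ss zs else z # cands p ss zs
      else cands p ss zs)"

text \<open>
  The first argument is fuel; \<open>al\<close> holds the colourings that extend to the part traversed so far,
  \<open>ss\<close> the swaps fixing all visited leaves, \<open>us\<close> the unvisited leaves, \<open>ds\<close> the closed cycles and
  \<open>p\<close> the current path, most recent leaf first. A candidate that a swap in \<open>ss\<close> maps to a smaller
  leaf is skipped (\<open>lowers\<close>).
\<close>

fun grow :: "nat \<Rightarrow> cstate list \<Rightarrow> swap list \<Rightarrow> leaf list \<Rightarrow> leaf list list \<Rightarrow> leaf list
    \<Rightarrow> leaf list list list" where
  "grow 0 al ss us ds p = []"
| "grow (Suc n) al ss us ds p =
     (if if at_least_5 us then False else same_color_rest us al then []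
      else (if if at_least_5 p then close_ok p else False then
              if us = [] then if closed_cols al = [] then [p # ds] else []
              else if at_least_5 us then
                grow n (start_states (hd us) (closed_cols al)) (filter (\<lambda>s. \<not> moves (hd us) s) ss)
                  (tl us) (p # ds) [hd us]
              else []
            else []) @
           concat (map (\<lambda>z. grow n (advance z al) (filter (\<lambda>s. \<not> moves z s) ss)
                              (remove1 z us) ds (z # p))
                     (cands p ss us)))"

text \<open>Six swaps exchange sibling leaves, three exchange the two pairs of leaves below a child
  of the root, and three exchange branches at the root. Together they generate the automorphism
  group of the tree.\<close>

definition swaps :: "swap list" where
  "swaps = [[(L0, L1)], [(L2, L3)], [(L4, L5)], [(L6, L7)], [(L8, L9)], [(L10, L11)],
     [(L0, L2), (L1, L3)], [(L4, L6), (L5, L7)], [(L8, L10), (L9, L11)],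
     [(L0, L4), (L1, L5), (L2, L6), (L3, L7)], [(L4, L8), (L5, L9), (L6, L10), (L7, L11)],
     [(L0, L8), (L1, L9), (L2, L10), (L3, L11)]]"

text \<open>
  The search is sound for any list of tree colourings. This one, found by a greedy covering
  heuristic, is short and leaves only arrangements without any 3-edge-colouring.
\<close>

context
begin

private abbreviation (input) "F \<equiv> False"
private abbreviation (input) "T \<equiv> True"

definition tree_cols :: "tree_col list" where
  "tree_cols = [
     TC F F F T F T T F T, TC F T T F F T F F T, TC F F T T T F F F F, TC T F F T F F T T F,
     TC T T F T F F T F F, TC T F F T F T F T T, TC T F F T F T T F T, TC T F F T T F F F F,
     TC F F F T F T F F T, TC T T T T T T F T T, TC T F F T F T T T T, TC F T F T T F F F F,
     TC F T T F T T T T F, TC F F F T F F T T F, TC T F F T F F T F T, TC T T F F F T F F F,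
     TC T F F T F T T F F, TC T F T T T T F T T, TC F F T F F T F T T, TC F F F T F T T T T,
     TC T T T T F T T T T, TC F F F T F T T F F, TC T F F T F T F F T, TC F F T F F T F F F,
     TC T T T F T F F T F, TC T T T F F T T F T, TC F F F T F F F T T, TC T F F F F T F F F,
     TC F T T T T F F F T, TC T T F T T F F F F, TC F T T T F F F F F, TC F F T T F F T F F,
     TC T T T T T T T T F, TC T T F F F F F F T, TC F T F F F T F F F, TC F F F T F F T F T,
     TC T T F T T F F F T, TC F F T F F T T T T, TC T F T F F T F F T, TC T F T T F T T T F,
     TC T T T F T T F T T, TC T F T T T T T T T, TC F F T F F T F F T, TC F T T T T T F F T,
     TC T F F T F F F F F, TC F F T T T F F F T, TC T T T T T F F F F, TC F T F F F F T F F,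
     TC T T F T F T T F F, TC T T F T T T F F T, TC T F T T T F F F T, TC T T T F F T F F F,
     TC T T F F F F T F F, TC F T F F T F T T T, TC F F T T F T T F T, TC T T F T T F T T T,
     TC T T T T T F F F T, TC T F F T F F T F F, TC F F F T F T F T T, TC F F F T F F F F F,
     TC F T T T T F T F F, TC T T F T F T F T T, TC T T T F F F T T T, TC F T T T T F T T T,
     TC T T T F F T F F T, TC F T F T F F T F F, TC F F T T F T F T T, TC F T F T F T T T T,
     TC F T T F F T T F F, TC T T T T F T F T T, TC F T T F F F F F F, TC T F T T F T T T T,
     TC F F F T F F T F F, TC F F T F T T T T T, TC F F F T T T F T T, TC T F T T F T F T F,
     TC T T T T T F T F T, TC T F T T F F F T T, TC T T F F F T F F T, TC F F F F T T F F F,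
     TC F F F F T T T T T, TC T F F F T T F F F, TC T F T T F T T F T, TC F T T T F F T F F,
     TC T F F F F T F F T, TC F T T F T F T T F, TC F F F T T F T F F, TC F T F T T F F F T,
     TC F T T F T T F T T, TC T T F T F T T T T, TC F F T F T T T F T, TC F T F F F T F F T,
     TC F T F T F T T F F, TC T F T F T T T T T, TC T F T T T F F F F, TC F T F T T F T F F,
     TC T T T T F T T F T, TC F F F T F T F F F, TC F F T F F T T F T, TC T T F F F T T T T,
     TC T T F F T T F F F, TC F F T T F F F T T, TC F T T F F T F T F, TC T T F T T F T F F,
     TC F F F F T T F F T, TC F F F T F T T T F, TC F F T F T T F T F, TC F T T T T F F T F,
     TC F T T T T F F T T, TC T T F T F F F F F, TC F F F F F T T F F, TC F F F F T T T F T,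
     TC F F T T T F F T F, TC F F T T T T F F T, TC F T F T T T F F F, TC T F F F F T T F F,
     TC T F F T F T F F F, TC T F T T T F F T T, TC F F F F F F F F T, TC F F T F F F F T F,
     TC F T F F T F F T F, TC T T T F F F F F T]"

end

text \<open>The first path may start at \<open>L0\<close> because every leaf lies on a cycle. Each
  call of \<open>grow\<close> uses up one unvisited leaf, so any fuel above 11 is enough.\<close>

definition uncolored :: "leaf list list list" where
  "uncolored = grow 13 (start_states L0 tree_cols) (filter (\<lambda>s. \<not> moves L0 s) swaps)
     [L1, L2, L3, L4, L5, L6, L7, L8, L9, L10, L11] [] [L0]"

section \<open>The graph of a leaf relation\<close>

fun vtx :: "leaf \<Rightarrow> nat" where
  "vtx L0 = 10" | "vtx L1 = 11" | "vtx L2 = 12" | "vtx L3 = 13" | "vtx L4 = 14" | "vtx L5 = 15"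
| "vtx L6 = 16" | "vtx L7 = 17" | "vtx L8 = 18" | "vtx L9 = 19" | "vtx L10 = 20" | "vtx L11 = 21"

definition tree_edges :: "nat set set" where
  "tree_edges = (\<lambda>n. {parent n, n}) ` {1..<22}"

definition leaf_graph :: "(leaf \<Rightarrow> leaf \<Rightarrow> bool) \<Rightarrow> nat ugraph" where
  "leaf_graph E = \<lparr>verts = {0..<22}, edges = tree_edges \<union> {{vtx u, vtx v} | u v. E u v}\<rparr>"

lemma vtx_ge: "10 \<le> vtx u" and vtx_less: "vtx u < 22"
  by (cases u; simp)+

lemma vtx_inj: "vtx u = vtx v \<longleftrightarrow> u = v"
  by (cases u; cases v; simp)

lemma vtx_surj:
  assumes "10 \<le> n" "n < 22"
  shows "\<exists>u. vtx u = n"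
proof -
  have "list_all (\<lambda>n. n \<in> set (map vtx [L0, L1, L2, L3, L4, L5, L6, L7, L8, L9, L10, L11])) [10..<22]"
    by code_simp
  moreover have "n \<in> set [10..<22]"
    using assms unfolding set_upt by simp
  ultimately have "n \<in> set (map vtx [L0, L1, L2, L3, L4, L5, L6, L7, L8, L9, L10, L11])"
    unfolding list_all_iff by (rule bspec)
  then show ?thesis
    unfolding set_map by blast
qed

lemma parent_less_10: "n < 22 \<Longrightarrow> parent n < 10"
  by (auto simp: parent_def)

lemma parent_vtx: "parent (vtx u) < vtx v"
  using parent_less_10[OF vtx_less[of u]] vtx_ge[of v] by simp

lemma tree_edge_vtx: "{parent (vtx u), vtx u} \<in> tree_edges"
  using vtx_ge[of u] vtx_less[of u] by (auto simp: tree_edges_def)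

lemma parent_sib: "parent (vtx (sib u)) = parent (vtx u)"
  by (cases u) (simp_all add: parent_def)

lemma sib_neq: "sib u \<noteq> u" "u \<noteq> sib u"
  by (cases u; simp)+

lemma card_tree_edges_inner:
  assumes "n < 10"
  shows "card {e \<in> tree_edges. n \<in> e} = 3"
proof -
  let ?ms = "filter (\<lambda>m. n = parent m \<or> n = m) [1..<22]"
  have "{e \<in> tree_edges. n \<in> e} = (\<lambda>m. {parent m, m}) ` set ?ms"
    by (auto simp: tree_edges_def)
  moreover have "inj_on (\<lambda>m. {parent m, m}) (set ?ms)"
  proof (rule inj_onI)
    fix m m' assume "m \<in> set ?ms" "m' \<in> set ?ms" "{parent m, m} = {parent m', m'}"
    then show "m = m'"
      using parent_less[of m] parent_less[of m'] by (auto simp: doubleton_eq_iff)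
  qed
  moreover have "card (set ?ms) = length ?ms"
    by (rule distinct_card) simp
  moreover have "list_all (\<lambda>n. length (filter (\<lambda>m. n = parent m \<or> n = m) [1..<22]) = 3) [0..<10]"
    by code_simp
  then have "length ?ms = 3"
    using assms by (simp only: list_all_iff) simp
  ultimately show ?thesis
    by (simp add: card_image)
qed

text \<open>The vertices numbered below 10 have three tree edges each, which exhausts their degree
  in \<open>H\<close>. All edges outside the tree therefore join leaves, and recording these as a
  relation recovers \<open>H\<close>.\<close>

lemma T3_snark_leaf_graph:
  fixes H :: "'a ugraph"
  assumes "T3_snark H"
  obtains E where "symp E" "graph_iso H (leaf_graph E)"
proof -
  obtain T where sn: "snark H" and T: "spanning_tree T H" "is_T3 T"
    using assms by (auto simp: T3_snark_def)
  obtain f where f: "bij_betw f {0..<22} (verts T)"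
    and ed: "edges T = (\<lambda>n. {f (parent n), f n}) ` {1..<22}"
    using is_T3_labeling[OF T(2)] .
  have fin: "fin_graph H"
    using sn by (simp add: snark_def)
  have vT: "verts T = verts H" "edges T \<subseteq> edges H"
    using T(1) by (auto simp: spanning_tree_def)
  have inj: "inj_on f {0..<22}" and im: "verts H = f ` {0..<22}"
    using f vT by (auto simp: bij_betw_def)
  have edT: "edges T = (\<lambda>e. f ` e) ` tree_edges"
    by (auto simp: ed tree_edges_def image_image)
  have tree_sub: "e \<subseteq> {0..<22}" if "e \<in> tree_edges" for e
    using that parent_less_10 by (fastforce simp: tree_edges_def)
  define E where "E u v \<longleftrightarrow> {f (vtx u), f (vtx v)} \<in> edges H" for u v
  have inner: "e \<in> edges T" if "n < 10" "e \<in> edges H" "f n \<in> e" for n e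
  proof -
    have fn: "f n \<in> verts H"
      using that(1) im by auto
    have "{e \<in> edges T. f n \<in> e} = (\<lambda>e. f ` e) ` {e \<in> tree_edges. n \<in> e}"
    proof -
      have "f n \<in> f ` e \<longleftrightarrow> n \<in> e" if "e \<in> tree_edges" for e
        using inj_on_image_mem_iff[OF inj _ tree_sub[OF that], of n] \<open>n < 10\<close> by simp
      then show ?thesis
        unfolding edT by blast
    qed
    moreover have "inj_on (\<lambda>e. f ` e) {e \<in> tree_edges. n \<in> e}"
    proof (rule inj_onI)
      fix d e assume "d \<in> {e \<in> tree_edges. n \<in> e}" "e \<in> {e \<in> tree_edges. n \<in> e}" "f ` d = f ` e"
      then show "d = e"
        using inj_on_image_eq_iff[OF inj, of d e] tree_sub by simp
    qed
    ultimately have "card {e \<in> edges T. f n \<in> e} = 3"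
      using card_tree_edges_inner[OF that(1)] by (simp add: card_image)
    moreover have "card {e \<in> edges H. f n \<in> e} = 3"
      using sn fn by (simp add: snark_def cubic_def degree_def)
    moreover have "{e \<in> edges T. f n \<in> e} \<subseteq> {e \<in> edges H. f n \<in> e}" "finite {e \<in> edges H. f n \<in> e}"
      using vT finite_edges[OF fin] by auto
    ultimately have "{e \<in> edges T. f n \<in> e} = {e \<in> edges H. f n \<in> e}"
      using card_subset_eq by metis
    then show ?thesis
      using that by blast
  qed
  have eH: "edges H = (\<lambda>e. f ` e) ` edges (leaf_graph E)"
  proof (intro equalityI subsetI)
    fix e assume e: "e \<in> edges H"
    then obtain x y where "e = {x, y}" "x \<in> verts H" "y \<in> verts H"
      using fin by (auto elim: fin_graph_edgeE)
    then obtain i j where ij: "e = {f i, f j}" "i < 22" "j < 22"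
      using im by auto
    show "e \<in> (\<lambda>e. f ` e) ` edges (leaf_graph E)"
    proof (cases "i < 10 \<or> j < 10")
      case True
      then have "e \<in> edges T"
        using inner e ij by auto
      then show ?thesis
        by (auto simp: edT leaf_graph_def)
    next
      case False
      then obtain u v where "vtx u = i" "vtx v = j"
        using vtx_surj[of i] vtx_surj[of j] ij by auto
      then have "E u v" "e = f ` {vtx u, vtx v}"
        using e ij by (auto simp: E_def)
      then show ?thesis
        by (intro image_eqI[of _ _ "{vtx u, vtx v}"]) (auto simp: leaf_graph_def)
    qed
  next
    fix e assume "e \<in> (\<lambda>e. f ` e) ` edges (leaf_graph E)"
    then show "e \<in> edges H"
      using vT(2) by (auto simp: leaf_graph_def edT E_def)
  qed
  have "bij_betw f (verts (leaf_graph E)) (verts H)"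
    using f vT by (simp add: leaf_graph_def)
  with eH have iso: "graph_iso (leaf_graph E) H"
    unfolding graph_iso_def by blast
  have "symp E"
    by (auto simp: symp_def E_def insert_commute)
  have "fin_graph (leaf_graph E)"
    unfolding fin_graph_def
  proof (intro conjI ballI)
    fix e assume e: "e \<in> edges (leaf_graph E)"
    show sub: "e \<subseteq> verts (leaf_graph E)"
      using e tree_sub[of e] vtx_less by (auto simp: leaf_graph_def)
    then have "inj_on f e"
      using inj by (auto simp: leaf_graph_def intro: inj_on_subset)
    moreover have "card (f ` e) = 2"
      using e fin imageI[OF e, of "\<lambda>e. f ` e"] unfolding fin_graph_def eH by blast
    ultimately show "card e = 2"
      by (simp add: card_image)
  qed (simp add: leaf_graph_def)
  then have "graph_iso H (leaf_graph E)"
    using graph_iso_sym iso by blast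
  then show ?thesis
    using that \<open>symp E\<close> by blast
qed

section \<open>The graph induced on the leaves\<close>

text \<open>
  What girth 5 means for the leaves: a path of one or two leaf edges joining siblings would close up
  to a cycle of length 3 or 4 through their common neighbour in the tree.
\<close>

definition leaf_rel :: "(leaf \<Rightarrow> leaf \<Rightarrow> bool) \<Rightarrow> bool" where
  "leaf_rel E \<longleftrightarrow> symp E \<and> (\<forall>u. card {v. E u v} = 2) \<and> (\<forall>u. \<not> E u u) \<and>
     (\<forall>u. \<not> E u (sib u)) \<and> (\<forall>u v. E u v \<longrightarrow> \<not> E v (sib u)) \<and>
     (\<forall>u v w. E u v \<longrightarrow> E v w \<longrightarrow> \<not> E w u) \<and>
     (\<forall>u v w x. E u v \<longrightarrow> E v w \<longrightarrow> E w x \<longrightarrow> u \<noteq> w \<longrightarrow> v \<noteq> x \<longrightarrow> \<not> E x u)"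

lemma snark_no_3_cycle:
  assumes "snark G" "{a, b} \<in> edges G" "{b, c} \<in> edges G" "{c, a} \<in> edges G"
  shows False
proof -
  have fin: "fin_graph G" and g: "girth G \<ge> enat 5"
    using assms(1) by (auto simp: snark_def numeral_eq_enat)
  have "is_cycle G [a, b, c]"
    using assms(2-4) fin_graph_edge[OF fin assms(2)] fin_graph_edge[OF fin assms(3)]
      fin_graph_edge[OF fin assms(4)] by (auto simp: is_cycle_def)
  then have "5 \<le> length [a, b, c]"
    using g unfolding girth_ge_iff by blast
  then show False
    by simp
qed

lemma snark_no_4_cycle:
  assumes "snark G" "{a, b} \<in> edges G" "{b, c} \<in> edges G" "{c, d} \<in> edges G" "{d, a} \<in> edges G"
    "a \<noteq> c" "b \<noteq> d"
  shows False
proof -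
  have fin: "fin_graph G" and g: "girth G \<ge> enat 5"
    using assms(1) by (auto simp: snark_def numeral_eq_enat)
  have "is_cycle G [a, b, c, d]"
    using assms(2-) fin_graph_edge[OF fin assms(2)] fin_graph_edge[OF fin assms(3)]
      fin_graph_edge[OF fin assms(4)] fin_graph_edge[OF fin assms(5)] by (auto simp: is_cycle_def)
  then have "5 \<le> length [a, b, c, d]"
    using g unfolding girth_ge_iff by blast
  then show False
    by simp
qed

lemma leaf_rel_of_snark:
  assumes sn: "snark (leaf_graph E)" and sym: "symp E"
  shows "leaf_rel E"
proof -
  let ?G = "leaf_graph E"
  have fin: "fin_graph ?G"
    using sn by (simp add: snark_def)
  have E: "{vtx u, vtx v} \<in> edges ?G" if "E u v" for u v
    using that by (auto simp: leaf_graph_def)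
  have p1: "{parent (vtx u), vtx u} \<in> edges ?G" for u
    using tree_edge_vtx[of u] by (simp add: leaf_graph_def)
  have p2: "{vtx u, parent (vtx u)} \<in> edges ?G" for u
    using p1[of u] by (simp add: insert_commute)
  have tree_nbr: "w = parent (vtx u)" if "{vtx u, w} \<in> tree_edges" for u w
  proof -
    obtain n where n: "n \<in> {1..<22}" "{vtx u, w} = {parent n, n}"
      using \<open>{vtx u, w} \<in> tree_edges\<close> unfolding tree_edges_def by blast
    then show ?thesis
      using parent_less_10[of n] vtx_ge[of u] by (auto simp: doubleton_eq_iff)
  qed
  show ?thesis
    unfolding leaf_rel_def
  proof (intro conjI allI impI)
    show "symp E"
      by (rule sym)
  next
    fix u
    show "card {v. E u v} = 2"
  proof -
    have "nbrs ?G (vtx u) = insert (parent (vtx u)) (vtx ` {v. E u v})"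
    proof (intro equalityI subsetI)
      fix w assume "w \<in> nbrs ?G (vtx u)"
      then consider "{vtx u, w} \<in> tree_edges" | a b where "{vtx u, w} = {vtx a, vtx b}" "E a b"
        by (auto simp: nbrs_def leaf_graph_def)
      then show "w \<in> insert (parent (vtx u)) (vtx ` {v. E u v})"
      proof cases
        case 1
        then show ?thesis
          using tree_nbr by blast
      next
        case 2
        then show ?thesis
          using sympD[OF sym 2(2)] by (auto simp: doubleton_eq_iff vtx_inj)
      qed
    next
      fix w assume "w \<in> insert (parent (vtx u)) (vtx ` {v. E u v})"
      then show "w \<in> nbrs ?G (vtx u)"
        using p2[of u] E by (auto simp: nbrs_def)
    qed
    moreover have "parent (vtx u) \<notin> vtx ` {v. E u v}"
    proof
      assume "parent (vtx u) \<in> vtx ` {v. E u v}"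
      then obtain v where "parent (vtx u) = vtx v"
        by blast
      then show False
        using parent_vtx[of u v] by simp
    qed
    moreover have "card (nbrs ?G (vtx u)) = 3"
      using sn vtx_less[of u] degree_eq_card_nbrs[OF fin, of "vtx u"]
      by (simp add: snark_def cubic_def leaf_graph_def)
    moreover have "card (vtx ` {v. E u v}) = card {v. E u v}"
      by (rule card_image) (auto simp: inj_on_def vtx_inj)
    moreover have "finite (vtx ` {v. E u v})"
      using vtx_less by (auto intro: finite_subset[of _ "{..<22}"])
    ultimately show ?thesis
      by simp
  qed
  next
    fix u
    show "\<not> E u u"
      using fin_graph_edge(3)[OF fin E[of u u]] by blast
  next
    fix u
    have "{vtx (sib u), parent (vtx u)} \<in> edges ?G"
      using p2[of "sib u"] by (simp add: parent_sib)
    then show "\<not> E u (sib u)"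
      using snark_no_3_cycle[OF sn E _ p1, of u "sib u"] by blast
  next
    fix u v assume uv: "E u v"
    have "{vtx (sib u), parent (vtx u)} \<in> edges ?G"
      using p2[of "sib u"] by (simp add: parent_sib)
    moreover have "vtx u \<noteq> vtx (sib u)" "vtx v \<noteq> parent (vtx u)"
      using parent_vtx[of u v] sib_neq[of u] by (simp_all add: vtx_inj)
    ultimately show "\<not> E v (sib u)"
      using snark_no_4_cycle[OF sn E[OF uv] E _ p1] by blast
  next
    fix u v w assume "E u v" "E v w"
    then show "\<not> E w u"
      using snark_no_3_cycle[OF sn E E E] by blast
  next
    fix u v w x assume a: "E u v" "E v w" "E w x" "u \<noteq> w" "v \<noteq> x"
    show "\<not> E x u"
    proof
      assume "E x u"
      then show False
        using snark_no_4_cycle[OF sn E[OF a(1)] E[OF a(2)] E[OF a(3)] E[of x u]] a(4,5)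
        by (simp add: vtx_inj)
    qed
  qed
qed

section \<open>Cycles of the leaf graph\<close>

text \<open>The oriented edges of the closed walk through \<open>d\<close>, including the one from
  the last entry back to the first.\<close>

definition cpairs :: "'b list \<Rightarrow> ('b \<times> 'b) set" where
  "cpairs d = set (zip d (rotate1 d))"

lemma cpairs_Cons: "cpairs (x # xs) = set (zip (x # xs) (xs @ [x]))"
  by (simp add: cpairs_def)

lemma cpairs_rotate1: "cpairs (rotate1 d) = cpairs d"
proof -
  have "zip (rotate1 d) (rotate1 (rotate1 d)) = rotate1 (zip d (rotate1 d))"
  proof (cases d rule: remdups_adj.cases)
    case (3 a b ys)
    then show ?thesis
      using zip_append[of "b # ys" "ys @ [a]" "[a]" "[b]"] by simp
  qed simp_all
  then show ?thesis
    by (simp add: cpairs_def)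
qed

lemma cpairs_append: "cpairs (xs @ ys) = cpairs (ys @ xs)"
proof (induction xs arbitrary: ys)
  case (Cons x xs)
  have "cpairs ((x # xs) @ ys) = cpairs (rotate1 (x # xs @ ys))"
    by (simp only: cpairs_rotate1 append_Cons)
  also have "\<dots> = cpairs (xs @ (ys @ [x]))"
    by simp
  finally show ?case
    using Cons[of "ys @ [x]"] by simp
qed simp

lemma cpairs_subset: "(u, v) \<in> cpairs d \<Longrightarrow> u \<in> set d \<and> v \<in> set d"
  by (auto simp: cpairs_def dest: set_zip_leftD set_zip_rightD)

definition cyc :: "('b \<Rightarrow> 'b \<Rightarrow> bool) \<Rightarrow> 'b list \<Rightarrow> bool" where
  "cyc E d \<longleftrightarrow> length d \<ge> 3 \<and> distinct d \<and> (\<forall>(u, v)\<in>cpairs d. E u v)"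

lemma rotate_to_front:
  assumes "u \<in> set d"
  obtains d' where "cpairs (u # d') = cpairs d" "set (u # d') = set d" "length (u # d') = length d"
    "distinct (u # d') \<longleftrightarrow> distinct d"
proof -
  obtain as bs where d: "d = as @ u # bs"
    using split_list[OF assms] by blast
  show ?thesis
    by (rule that[of "bs @ as"]) (auto simp: d cpairs_append[of as])
qed

text \<open>Once \<open>u\<close> is rotated to the front, its successor is the second entry and its
  predecessor the last one; they differ because there are at least three entries.\<close>

lemma cyc_neighbours:
  assumes "distinct d" "length d \<ge> 3" "u \<in> set d"
  obtains a b where "(u, a) \<in> cpairs d" "(b, u) \<in> cpairs d" "a \<noteq> b" "a \<in> set d" "b \<in> set d"
    "\<And>v. (u, v) \<in> cpairs d \<Longrightarrow> v = a" "\<And>v. (v, u) \<in> cpairs d \<Longrightarrow> v = b"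
proof -
  obtain d' where d': "cpairs (u # d') = cpairs d" "set (u # d') = set d" "length (u # d') = length d"
    "distinct (u # d')"
    using rotate_to_front[OF assms(3)] assms(1) by metis
  then obtain a e where e: "d' = a # e"
    using assms(2) by (cases d') auto
  then obtain e' b where e': "e = e' @ [b]"
    using assms(2) d'(3) by (cases e rule: rev_cases) auto
  have cp: "cpairs d = set (zip (u # a # e' @ [b]) (a # e' @ [b, u]))"
    using d'(1) by (simp add: cpairs_Cons e e')
  have z: "zip (u # a # e' @ [b]) (a # e' @ [b, u]) = (u, a) # zip (a # e') (e' @ [b]) @ [(b, u)]"
    using zip_append[of "a # e'" "e' @ [b]" "[b]" "[u]"] by simp
  show ?thesis
  proof (rule that[of a b])
    show "(u, a) \<in> cpairs d" "(b, u) \<in> cpairs d"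
      unfolding cp z by simp_all
    show "a \<noteq> b" "a \<in> set d" "b \<in> set d"
      using d'(2,4) by (auto simp: e e')
    show "v = a" if "(u, v) \<in> cpairs d" for v
      using that d'(4) unfolding cp z by (auto simp: e e' dest: set_zip_leftD)
    show "v = b" if "(v, u) \<in> cpairs d" for v
      using that d'(4) unfolding cp z by (auto simp: e e' dest: set_zip_rightD)
  qed
qed

lemma successively_zip:
  "successively P xs \<Longrightarrow> (xs \<noteq> [] \<Longrightarrow> P (last xs) y) \<Longrightarrow> (u, v) \<in> set (zip xs (tl xs @ [y])) \<Longrightarrow> P u v"
  by (induction xs rule: induct_list012) auto

lemma cyc_of_path:
  assumes "successively E p" "E (last p) (hd p)" "length p \<ge> 3" "distinct p"
  shows "cyc E p"
proof -
  have "rotate1 p = tl p @ [hd p]"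
    using assms(3) by (cases p) auto
  then show ?thesis
    using successively_zip[OF assms(1), of "hd p"] assms by (auto simp: cyc_def cpairs_def)
qed

lemma card_2_third:
  assumes "card {v. P v} = 2" "P a" "P b" "P c" "a \<noteq> b"
  shows "c = a \<or> c = b"
proof -
  have "{v. P v} = {a, b}"
    using assms by (intro card_subset_eq[symmetric]) (auto intro: card_ge_0_finite)
  then show ?thesis
    using assms(4) by blast
qed

lemma at_least_5_iff: "at_least_5 xs \<longleftrightarrow> 5 \<le> length xs"
  by (induction xs rule: at_least_5.induct) auto

text \<open>The invariant of the search with respect to the relation looked for: what has been
  traversed consists of cycles of \<open>E\<close> and one path of \<open>E\<close>, and
  \<open>us\<close> lists all other leaves.\<close>

definition consistent :: "(leaf \<Rightarrow> leaf \<Rightarrow> bool) \<Rightarrow> leaf list \<Rightarrow> leaf list list \<Rightarrow> leaf list \<Rightarrow> bool" where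
  "consistent E us ds p \<longleftrightarrow> p \<noteq> [] \<and> distinct us \<and> distinct (p @ concat ds) \<and>
     set us = - set (p @ concat ds) \<and> successively E p \<and> (\<forall>d\<in>set ds. cyc E d)"

definition leaf_cycles :: "(leaf \<Rightarrow> leaf \<Rightarrow> bool) \<Rightarrow> leaf list list \<Rightarrow> bool" where
  "leaf_cycles E w \<longleftrightarrow> distinct (concat w) \<and> set (concat w) = UNIV \<and> (\<forall>d\<in>set w. cyc E d)"

context
  fixes E :: "leaf \<Rightarrow> leaf \<Rightarrow> bool"
  assumes rel: "leaf_rel E"
begin

lemmas leaf_rel_conjs = rel[unfolded leaf_rel_def]

lemma E_sym: "E u v \<Longrightarrow> E v u"
  by (rule sympD[OF leaf_rel_conjs[THEN conjunct1]])

lemma E_card: "card {v. E u v} = 2"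
  by (rule leaf_rel_conjs[THEN conjunct2, THEN conjunct1, rule_format])

lemma E_third: "E u a \<Longrightarrow> E u b \<Longrightarrow> E u c \<Longrightarrow> a \<noteq> b \<Longrightarrow> c = a \<or> c = b"
  by (rule card_2_third[of "E u", OF E_card])

lemma E_irrefl: "\<not> E u u"
  by (rule leaf_rel_conjs[THEN conjunct2, THEN conjunct2, THEN conjunct1, rule_format])

lemma E_sib: "E u v \<Longrightarrow> v \<noteq> sib u"
  using leaf_rel_conjs[THEN conjunct2, THEN conjunct2, THEN conjunct2, THEN conjunct1, rule_format, of u] by auto

lemma E_sib2: "E u v \<Longrightarrow> E v w \<Longrightarrow> w \<noteq> sib u"
  using leaf_rel_conjs[THEN conjunct2, THEN conjunct2, THEN conjunct2, THEN conjunct2, THEN conjunct1,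
      rule_format, of u v] by auto

lemma E_3: "E u v \<Longrightarrow> E v w \<Longrightarrow> E w u \<Longrightarrow> False"
  using leaf_rel_conjs[THEN conjunct2, THEN conjunct2, THEN conjunct2, THEN conjunct2, THEN conjunct2,
      THEN conjunct1, rule_format, of u v w] by simp

lemma E_4: "E u v \<Longrightarrow> E v w \<Longrightarrow> E w x \<Longrightarrow> E x u \<Longrightarrow> u \<noteq> w \<Longrightarrow> v \<noteq> x \<Longrightarrow> False"
  using leaf_rel_conjs[THEN conjunct2, THEN conjunct2, THEN conjunct2, THEN conjunct2, THEN conjunct2,
      THEN conjunct2, rule_format, of u v w x] by simp

lemma E_other:
  obtains b where "E u b" "b \<noteq> a"
proof -
  have "\<not> {v. E u v} \<subseteq> {a}"
    using E_card[of u] card_mono[of "{a}" "{v. E u v}"] by fastforce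
  then show ?thesis
    using that by auto
qed

text \<open>Every leaf has only two neighbours and the cycle already supplies both, so there are no
  chords.\<close>

lemma cyc_E_iff:
  assumes "cyc E d" "u \<in> set d"
  shows "E u v \<longleftrightarrow> (u, v) \<in> cpairs d \<or> (v, u) \<in> cpairs d"
proof -
  have d: "distinct d" "3 \<le> length d" "\<And>u v. (u, v) \<in> cpairs d \<Longrightarrow> E u v"
    using assms(1) by (auto simp: cyc_def)
  obtain a b where ab: "(u, a) \<in> cpairs d" "(b, u) \<in> cpairs d" "a \<noteq> b"
    using cyc_neighbours[OF d(1,2) assms(2)] by metis
  then have "E u a" "E u b"
    using d(3) E_sym by blast+
  then show ?thesis
    using E_third[of u a b v] ab d(3) E_sym by blast
qed

lemma cyc_closed: "cyc E d \<Longrightarrow> u \<in> set d \<Longrightarrow> E u v \<Longrightarrow> v \<in> set d"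
  using cyc_E_iff cpairs_subset by metis

lemma complete_E_iff:
  assumes "leaf_cycles E w"
  shows "E u v \<longleftrightarrow> (\<exists>d\<in>set w. (u, v) \<in> cpairs d \<or> (v, u) \<in> cpairs d)"
proof
  assume "E u v"
  moreover obtain d where "d \<in> set w" "u \<in> set d"
    using assms by (auto simp: leaf_cycles_def)
  ultimately show "\<exists>d\<in>set w. (u, v) \<in> cpairs d \<or> (v, u) \<in> cpairs d"
    using assms cyc_E_iff by (metis leaf_cycles_def)
next
  assume "\<exists>d\<in>set w. (u, v) \<in> cpairs d \<or> (v, u) \<in> cpairs d"
  then obtain d where "d \<in> set w" and uv: "(u, v) \<in> cpairs d \<or> (v, u) \<in> cpairs d"
    by blast
  then have "E a b" if "(a, b) \<in> cpairs d" for a b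
    using assms that by (auto simp: leaf_cycles_def cyc_def)
  then show "E u v"
    using uv E_sym by blast
qed

text \<open>A set of leaves closed under adjacency contains a whole cycle, hence five leaves.\<close>

lemma closed_ge_5:
  assumes "finite U" "u \<in> U" "\<And>u v. u \<in> U \<Longrightarrow> E u v \<Longrightarrow> v \<in> U"
  shows "5 \<le> card U"
proof -
  obtain a where a: "E u a"
    using E_other by blast
  obtain b where b: "E u b" "b \<noteq> a"
    using E_other by blast
  obtain c where c: "E a c" "c \<noteq> u"
    using E_other by blast
  obtain d where d: "E c d" "d \<noteq> a"
    using E_other by blast
  \<comment> \<open>The path b, u, a, c, d has five distinct leaves because cycles of length 3 and 4
    are excluded.\<close>
  have "c \<noteq> b"
    using E_3[OF a c(1)] E_sym[OF b(1)] by blast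
  moreover have "d \<noteq> u"
    using E_3[OF a c(1)] d(1) by blast
  moreover have "d \<noteq> b"
    using E_4[OF a c(1) d(1)] E_sym[OF b(1)] c(2) d(2) by blast
  moreover have "u \<noteq> a" "u \<noteq> b" "a \<noteq> c" "c \<noteq> d"
    using a b c d E_irrefl by auto
  ultimately have "card {u, a, b, c, d} = 5"
    using b(2) c(2) d(2) by simp
  moreover have "{u, a, b, c, d} \<subseteq> U"
    using assms(2,3) a b(1) c(1) d(1) by blast
  ultimately show ?thesis
    using card_mono[OF assms(1), of "{u, a, b, c, d}"] by simp
qed

text \<open>The head of the path has a neighbour \<open>z\<close> different from its predecessor. If
  \<open>z\<close> has been visited, it can only be the other end of the path, and then the path
  closes to a cycle.\<close>

lemma next_step:
  assumes con: "consistent E us ds p"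
  shows "(\<exists>z\<in>set us. E (hd p) z) \<or> (at_least_5 p \<and> close_ok p \<and> cyc E p \<and> (us = [] \<or> at_least_5 us))"
proof -
  obtain x q where p: "p = x # q"
    using con by (cases p) (auto simp: consistent_def)
  have dist: "distinct (x # q)" "set us = - set (p @ concat ds)" "distinct us"
    and suc: "successively E (x # q)" and cyc: "\<And>d. d \<in> set ds \<Longrightarrow> cyc E d"
    and x_ds: "\<And>d u. d \<in> set ds \<Longrightarrow> u \<in> set p \<Longrightarrow> u \<notin> set d"
    using con by (auto simp: consistent_def p)
  have not_ds: "z \<notin> set d" if "E u z" "u \<in> set p" "d \<in> set ds" for u z d
    using cyc_closed[OF cyc[OF that(3)] _ E_sym[OF that(1)]] x_ds that by blast
  show ?thesis
  proof (cases q)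
    case Nil
    obtain z where z: "E x z"
      using E_other by blast
    then have "z \<in> set us"
      using not_ds[OF z] E_irrefl[of x] by (auto simp: dist p Nil)
    then show ?thesis
      using z p by auto
  next
    case (Cons y ws)
    have xy: "E x y"
      using suc by (simp add: Cons)
    obtain z where z: "E x z" "z \<noteq> y"
      using E_other by blast
    show ?thesis
    proof (cases "z \<in> set us")
      case True
      then show ?thesis
        using z p by auto
    next
      case False
      then have "z \<in> set ws"
      proof -
        have "z \<notin> set (concat ds)" "z \<noteq> x"
          using not_ds[OF z(1)] z(1) E_irrefl[of x] by (auto simp: p)
        moreover have "z \<in> set (p @ concat ds)"
          using False unfolding dist(2) by blast
        ultimately show ?thesis
          using z(2) by (simp add: p Cons)
      qed
      then obtain as bs where ws: "ws = as @ z # bs"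
        by (meson split_list)
      \<comment> \<open>An inner leaf of the path has both its neighbours on the path already, so it
        cannot be joined to \<open>x\<close> as well.\<close>
      have "bs = []"
      proof (rule ccontr)
        assume "bs \<noteq> []"
        then obtain b bs' where bs: "bs = b # bs'"
          by (cases bs) auto
        have "successively E ((x # y # as) @ z # b # bs')"
          using suc by (simp add: Cons ws bs)
        then have "E z b" "E (last (y # as)) z"
          unfolding successively_append_iff by simp_all
        moreover have "last (y # as) \<noteq> b" "x \<noteq> b" "x \<noteq> last (y # as)"
          using dist(1) last_in_set[of "y # as"] unfolding Cons ws bs by auto
        ultimately show False
          using E_third[OF \<open>E z b\<close> E_sym[OF \<open>E (last (y # as)) z\<close>] E_sym[OF z(1)]] by auto
      qed
      then have lastp: "last (y # ws) = z"
        by (simp add: ws)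
      \<comment> \<open>Here a triangle is excluded, and a 4-cycle below with \<open>as'\<close>; so
        a path that closes has at least five leaves.\<close>
      have "as \<noteq> []"
        using E_3[OF xy _ E_sym[OF z(1)]] suc unfolding Cons ws \<open>bs = []\<close> by auto
      then obtain as' t where as: "as = as' @ [t]"
        by (cases as rule: rev_cases) auto
      have tz: "E t z"
        using suc unfolding Cons ws as \<open>bs = []\<close>
        by (simp add: successively_append_iff successively_Cons split: if_splits)
      have "as' \<noteq> []"
      proof
        assume "as' = []"
        then have "E y t"
          using suc unfolding Cons ws as by simp
        moreover have "x \<noteq> t"
          using dist(1) unfolding Cons ws as by auto
        ultimately show False
          using E_4[OF xy _ tz E_sym[OF z(1)]] z(2) by blast
      qed
      then have "length p \<ge> 5"
        by (cases as') (simp_all add: p Cons ws as)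
      have "cyc E p"
        using suc dist(1) E_sym[OF z(1)] \<open>length p \<ge> 5\<close> lastp
        by (intro cyc_of_path) (simp_all add: p Cons)
      have "close_ok p"
        using E_sib[OF z(1)] E_sib2[OF z(1) E_sym[OF tz]] E_sib2[OF E_sym[OF xy] z(1)]
        by (simp add: p Cons ws as \<open>bs = []\<close> butlast_append)
      \<comment> \<open>Once \<open>p\<close> is closed, all visited leaves lie on complete cycles,
        so the unvisited ones are closed under adjacency.\<close>
      moreover have "us = [] \<or> at_least_5 us"
      proof (cases us)
        case Nil
        then show ?thesis by simp
      next
        case (Cons u us')
        have "v \<in> set us" if "u \<in> set us" "E u v" for u v
        proof -
          have "v \<notin> set d" if "d \<in> set ds" for d
            using cyc_closed[OF cyc[OF that] _ E_sym[OF \<open>E u v\<close>]] \<open>u \<in> set us\<close> that dist(2) by auto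
          moreover have "v \<notin> set p"
            using cyc_closed[OF \<open>cyc E p\<close> _ E_sym[OF \<open>E u v\<close>]] \<open>u \<in> set us\<close> dist(2) by auto
          ultimately show ?thesis
            by (simp add: dist(2))
        qed
        then have "5 \<le> card (set us)"
          by (intro closed_ge_5[of _ u]) (simp_all add: Cons)
        then show ?thesis
          using dist(3) by (simp add: at_least_5_iff distinct_card)
      qed
      ultimately show ?thesis
        using \<open>cyc E p\<close> \<open>length p \<ge> 5\<close> by (simp add: at_least_5_iff)
    qed
  qed
qed

lemma consistent_extend:
  assumes "consistent E us ds p" "z \<in> set us" "E (hd p) z"
  shows "consistent E (remove1 z us) ds (z # p)"
  using assms E_sym[OF assms(3)] by (auto simp: consistent_def successively_Cons)

lemma consistent_close:
  assumes "consistent E us ds p" "cyc E p" "us \<noteq> []"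
  shows "consistent E (tl us) (p # ds) [hd us]"
  using assms by (cases us) (auto simp: consistent_def)

lemma complete_close:
  assumes "consistent E [] ds p" "cyc E p"
  shows "leaf_cycles E (p # ds)"
  using assms by (auto simp: consistent_def leaf_cycles_def)

end

section \<open>Automorphisms of the tree\<close>

fun swap_app :: "swap \<Rightarrow> leaf \<Rightarrow> leaf" where
  "swap_app [] l = l"
| "swap_app ((x, y) # s) l = (if l = x then y else if l = y then x else swap_app s l)"

definition all_leaves :: "leaf list" where
  "all_leaves = [L0, L1, L2, L3, L4, L5, L6, L7, L8, L9, L10, L11]"

lemma set_all_leaves: "set all_leaves = UNIV"
proof -
  have "x \<in> set all_leaves" for x
    by (cases x) (simp_all add: all_leaves_def)
  then show ?thesis
    by blast
qed

text \<open>
  Extends a permutation of the leaves upwards: a parent follows its first child.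
\<close>

fun extend :: "nat \<Rightarrow> swap \<Rightarrow> nat \<Rightarrow> nat" where
  "extend 0 s n = 0"
| "extend (Suc k) s n =
     (if n = 0 then 0 else if n < 10 then parent (extend k s (2 * n + 2))
      else vtx (swap_app s (all_leaves ! (n - 10))))"

text \<open>All facts about the swaps that are used later, in one evaluation. Descending from a
  child of the root to a leaf takes three calls of \<open>extend\<close>, which is within the fuel
  4.\<close>

lemma swaps_check:
  "list_all (\<lambda>s. list_all (\<lambda>l. swap_app s (swap_app s l) = l \<and> (moves l s \<longleftrightarrow> swap_app s l \<noteq> l) \<and>
      (l \<in> set (map snd s) \<longrightarrow> vtx (swap_app s l) < vtx l) \<and> extend 4 s (vtx l) = vtx (swap_app s l)) all_leaves \<and>
    list_all (\<lambda>n. extend 4 s n < 22 \<and> extend 4 s (extend 4 s n) = n \<and>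
      (n > 0 \<longrightarrow> extend 4 s n > 0 \<and> extend 4 s (parent n) = parent (extend 4 s n))) [0..<22]) swaps"
  by code_simp

lemma
  assumes "s \<in> set swaps"
  shows swap_invol: "swap_app s (swap_app s l) = l"
    and swap_moves: "moves l s \<longleftrightarrow> swap_app s l \<noteq> l"
    and swap_lowers: "l \<in> set (map snd s) \<Longrightarrow> vtx (swap_app s l) < vtx l"
    and extend_vtx: "extend 4 s (vtx l) = vtx (swap_app s l)"
  using bspec[OF swaps_check[unfolded list_all_iff] assms] UNIV_I[of l]
  unfolding set_all_leaves[symmetric] by simp_all

lemma
  assumes "s \<in> set swaps" "n < 22"
  shows extend_less: "extend 4 s n < 22"
    and extend_invol: "extend 4 s (extend 4 s n) = n"
    and extend_pos: "n > 0 \<Longrightarrow> extend 4 s n > 0"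
    and extend_parent: "n > 0 \<Longrightarrow> extend 4 s (parent n) = parent (extend 4 s n)"
  using bspec[OF swaps_check[unfolded list_all_iff] assms(1)] assms(2) by (simp_all del: extend.simps)

abbreviation swap_rel :: "swap \<Rightarrow> (leaf \<Rightarrow> leaf \<Rightarrow> bool) \<Rightarrow> leaf \<Rightarrow> leaf \<Rightarrow> bool" where
  "swap_rel s E \<equiv> (\<lambda>u v. E (swap_app s u) (swap_app s v))"

text \<open>\<open>extend 4 s\<close> commutes with \<open>parent\<close>, hence is an automorphism
  of the tree. It is its own inverse, so pulling the leaf edges back along it is the same as pushing
  them forward.\<close>

lemma graph_iso_swap:
  assumes s: "s \<in> set swaps"
  shows "graph_iso (leaf_graph E) (leaf_graph (swap_rel s E))"
  unfolding graph_iso_def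
proof (intro exI conjI)
  let ?g = "extend 4 s"
  show "bij_betw ?g (verts (leaf_graph E)) (verts (leaf_graph (swap_rel s E)))"
    by (rule bij_betw_byWitness[where f' = ?g])
      (auto simp: leaf_graph_def extend_less[OF s] extend_invol[OF s] simp del: extend.simps)
  have tree: "?g ` {parent n, n} \<in> tree_edges" if "n \<in> {1..<22}" for n
    using that extend_parent[OF s, of n] extend_less[OF s, of n] extend_pos[OF s, of n]
    by (auto simp: tree_edges_def simp del: extend.simps)
  show "edges (leaf_graph (swap_rel s E)) = (\<lambda>e. ?g ` e) ` edges (leaf_graph E)"
  proof (intro equalityI subsetI)
    fix e assume "e \<in> edges (leaf_graph (swap_rel s E))"
    then consider "e \<in> tree_edges"
      | u v where "e = {vtx u, vtx v}" "E (swap_app s u) (swap_app s v)"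
      by (auto simp: leaf_graph_def)
    then show "e \<in> (\<lambda>e. ?g ` e) ` edges (leaf_graph E)"
    proof cases
      case 1
      then obtain n where n: "n \<in> {1..<22}" "e = {parent n, n}"
        by (auto simp: tree_edges_def)
      have "parent n < 22"
        using n(1) parent_less_10[of n] by simp
      then have "?g ` (?g ` {parent n, n}) = {parent n, n}"
        using n(1) extend_invol[OF s] by (simp del: extend.simps)
      then show ?thesis
        using tree[OF n(1)] n(2) by (intro image_eqI[of _ _ "?g ` {parent n, n}"])
          (auto simp: leaf_graph_def simp del: extend.simps)
    next
      case 2
      then show ?thesis
        by (intro image_eqI[of _ _ "{vtx (swap_app s u), vtx (swap_app s v)}"])
          (auto simp: leaf_graph_def extend_vtx[OF s] swap_invol[OF s] simp del: extend.simps)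
    qed
  next
    fix e assume "e \<in> (\<lambda>e. ?g ` e) ` edges (leaf_graph E)"
    then obtain e' where e': "e' \<in> edges (leaf_graph E)" "e = ?g ` e'"
      by blast
    then consider "e' \<in> tree_edges" | u v where "e' = {vtx u, vtx v}" "E u v"
      by (auto simp: leaf_graph_def)
    then show "e \<in> edges (leaf_graph (swap_rel s E))"
    proof cases
      case 1
      then obtain n where "n \<in> {1..<22}" "e' = {parent n, n}"
        by (auto simp: tree_edges_def)
      then show ?thesis
        using tree[of n] e'(2) by (simp add: leaf_graph_def del: extend.simps)
    next
      case 2
      then have "e = {vtx (swap_app s u), vtx (swap_app s v)}"
        using e'(2) by (simp add: extend_vtx[OF s] del: extend.simps)
      moreover have "swap_rel s E (swap_app s u) (swap_app s v)"
        using 2 by (simp add: swap_invol[OF s])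
      ultimately show ?thesis
        unfolding leaf_graph_def by auto
    qed
  qed
qed

section \<open>Completeness of the search\<close>

text \<open>
  \<open>trail k e p d\<close>: with pendant colours given by \<open>k\<close>, entering the path \<open>p\<close> (listed backwards)
  by an edge of colour \<open>e\<close> forces the edge leaving it to have colour \<open>d\<close>.
\<close>

inductive trail :: "tree_col \<Rightarrow> color \<Rightarrow> leaf list \<Rightarrow> color \<Rightarrow> bool" for k e where
  trail_Nil: "trail k e [] e"
| trail_Cons: "trail k e p d \<Longrightarrow> lcol k z \<noteq> d \<Longrightarrow> trail k e (z # p) (third (lcol k z) d)"

text \<open>One tree colouring serves all cycles, but each cycle has its own entering
  colour.\<close>

definition colors :: "tree_col \<Rightarrow> leaf list list \<Rightarrow> bool" where
  "colors k w \<longleftrightarrow> (\<forall>d\<in>set w. \<exists>e. trail k e d e)"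

text \<open>Only soundness is recorded: every state promises a colouring of the part traversed so
  far. Missing states would merely weaken the pruning.\<close>

definition valid :: "cstate list \<Rightarrow> leaf list list \<Rightarrow> leaf list \<Rightarrow> bool" where
  "valid al ds p \<longleftrightarrow> (\<forall>k e d. CS k e d \<in> set al \<longrightarrow> colors k ds \<and> trail k e p d)"

section \<open>Soundness of the colour states\<close>

lemma advance_state_subset:
  "CS k e d \<in> set (advance_state c d' k' e' xs) \<Longrightarrow>
     CS k e d \<in> set xs \<or> k = k' \<and> e = e' \<and> c \<noteq> d' \<and> d = third c d'"
  by (cases c; cases d') auto

lemma advance_mem:
  "CS k e d \<in> set (advance z al) \<Longrightarrow> \<exists>d'. CS k e d' \<in> set al \<and> lcol k z \<noteq> d' \<and> d = third (lcol k z) d'"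
proof (induction z al rule: advance.induct)
  case (2 z k' e' d' xs)
  then show ?case
    using advance_state_subset[of k e d "lcol k' z" d' k' e' "advance z xs"] by auto
qed simp

lemma start_state_subset:
  "CS k e d \<in> set (start_state c k' xs) \<Longrightarrow> CS k e d \<in> set xs \<or> k = k' \<and> c \<noteq> e \<and> d = third c e"
  by (cases c) auto

lemma start_states_mem:
  "CS k e d \<in> set (start_states z ks) \<Longrightarrow> k \<in> set ks \<and> lcol k z \<noteq> e \<and> d = third (lcol k z) e"
proof (induction z ks rule: start_states.induct)
  case (2 z k' ks)
  then show ?case
    using start_state_subset[of k e d "lcol k' z" k' "start_states z ks"] by auto
qed simp

lemma closed_cols_mem: "k \<in> set (closed_cols al) \<Longrightarrow> \<exists>e. CS k e e \<in> set al"
  by (induction al rule: closed_cols.induct) (auto split: if_splits)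

lemma valid_advance: "valid al ds p \<Longrightarrow> valid (advance z al) ds (z # p)"
  unfolding valid_def using advance_mem trail_Cons by metis

lemma valid_closed:
  assumes "valid al ds p" "k \<in> set (closed_cols al)"
  shows "colors k (p # ds)"
  using closed_cols_mem[OF assms(2)] assms(1) by (auto simp: valid_def colors_def)

lemma valid_start:
  assumes "\<And>k. k \<in> set ks \<Longrightarrow> colors k ds"
  shows "valid (start_states z ks) ds [z]"
  unfolding valid_def
proof (intro allI impI)
  fix k e d assume "CS k e d \<in> set (start_states z ks)"
  then have "k \<in> set ks" "lcol k z \<noteq> e" "d = third (lcol k z) e"
    using start_states_mem by blast+
  then show "colors k ds \<and> trail k e [z] d"
    using assms trail_Cons[OF trail_Nil] by simp
qed

lemma same_color_from_iff:
  "same_color_from k c zs d e \<longleftrightarrow> (\<forall>z\<in>set zs. lcol k z = c) \<and> (third c ^^ length zs) d = e"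
  by (induction k c zs d e rule: same_color_from.induct) (auto simp: funpow_swap1)

lemma same_color_rest_mem:
  "same_color_rest us al \<Longrightarrow> \<exists>k e d c. CS k e d \<in> set al \<and> c \<noteq> d \<and> (\<forall>z\<in>set us. lcol k z = c) \<and>
     (third c ^^ length us) d = e"
proof (induction us al rule: same_color_rest.induct)
  case (3 z zs k e d xs)
  show ?case
  proof (cases "lcol k z \<noteq> d \<and> same_color_from k (lcol k z) (z # zs) d e")
    case True
    then show ?thesis
      unfolding same_color_from_iff by (metis list.set_intros(1))
  next
    case False
    then have "same_color_rest (z # zs) xs"
      using 3(2) by (auto split: if_splits)
    then show ?thesis
      using 3(1) False by (metis list.set_intros(2))
  qed
qed simp_all

lemma third_neq: "c \<noteq> d \<Longrightarrow> third c d \<noteq> c" "c \<noteq> d \<Longrightarrow> third c d \<noteq> d"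
  by (cases c; cases d; simp)+

text \<open>If all remaining pendant edges have the same colour, their order does not matter.\<close>

lemma same_color_completion:
  assumes rel: "leaf_rel E" and "length us < 5"
    and "consistent E us ds p" "colors k ds" "trail k e p d" "\<forall>z\<in>set us. lcol k z = c" "c \<noteq> d"
    "(third c ^^ length us) d = e"
  shows "\<exists>w. leaf_cycles E w \<and> colors k w"
  using assms(2-)
proof (induction "length us" arbitrary: us p d)
  case 0
  then have "us = []"
    by simp
  then have "cyc E p"
    using next_step[OF rel 0(3)] by simp
  then have "leaf_cycles E (p # ds)"
    using complete_close[OF rel] 0(3) \<open>us = []\<close> by simp
  moreover have "colors k (p # ds)"
    using 0(4,5,8) \<open>us = []\<close> by (auto simp: colors_def)
  ultimately show ?case
    by blast
next
  case (Suc n)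
  \<comment> \<open>Fewer than five unvisited leaves cannot form a further cycle, so the path cannot
    close yet and \<open>next_step\<close> must extend it.\<close>
  then have "us \<noteq> []" "\<not> at_least_5 us"
    by (auto simp: at_least_5_iff)
  then obtain z where z: "z \<in> set us" "E (hd p) z"
    using next_step[OF rel Suc.prems(2)] by blast
  have len: "length us = Suc (length (remove1 z us))"
    using z(1) Suc.hyps(2) by (simp add: length_remove1)
  have c: "lcol k z = c"
    using Suc.prems(5) z(1) by blast
  show ?case
  proof (rule Suc.hyps(1))
    show "n = length (remove1 z us)" "length (remove1 z us) < 5"
      using Suc.hyps(2) Suc.prems(1) len by auto
    show "consistent E (remove1 z us) ds (z # p)"
      by (rule consistent_extend[OF rel Suc.prems(2) z])
    show "trail k e (z # p) (third c d)"
      using trail_Cons[OF Suc.prems(4), of z] Suc.prems(6) c by simp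
    show "(third c ^^ length (remove1 z us)) (third c d) = e"
      using Suc.prems(7) unfolding len by (simp add: funpow_swap1)
    show "\<forall>z\<in>set (remove1 z us). lcol k z = c"
      using Suc.prems(5) by (meson notin_set_remove1)
    show "colors k ds" "c \<noteq> third c d"
      using Suc.prems(3,6) third_neq(1)[of c d] by auto
  qed
qed

lemma lowers_iff: "lowers l ss \<longleftrightarrow> (\<exists>s\<in>set ss. l \<in> set (map snd s))"
  by (induction l ss rule: lowers.induct) auto

lemma set_cands: "set (cands p ss us) = {z \<in> set us. ext_ok p z \<and> \<not> lowers z ss}"
  by (induction p ss us rule: cands.induct) auto

lemma cyc_cong:
  assumes "cyc E d" "\<And>u. u \<in> set d \<Longrightarrow> swap_app s u = u"
  shows "cyc (swap_rel s E) d"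
  using assms cpairs_subset[of _ _ d] unfolding cyc_def by fastforce

lemma consistent_swap:
  assumes "consistent E us ds p" "\<And>u. u \<notin> set us \<Longrightarrow> swap_app s u = u"
  shows "consistent (swap_rel s E) us ds p"
proof -
  have us: "set us = - set (p @ concat ds)"
    using assms(1) by (simp add: consistent_def)
  have "successively (swap_rel s E) p"
  proof (rule successively_mono[where P = E])
    show "successively E p"
      using assms(1) by (simp add: consistent_def)
    fix x y assume "x \<in> set p" "y \<in> set p" "E x y"
    then show "swap_rel s E x y"
      using assms(2) us by simp
  qed
  moreover have "cyc (swap_rel s E) d" if "d \<in> set ds" for d
    using cyc_cong[of E d s] assms that us by (auto simp: consistent_def)
  ultimately show ?thesis
    using assms(1) by (simp add: consistent_def)
qed

text \<open>\<open>P\<close> will say that \<open>E\<close> is symmetric and that its leaf graph is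
  isomorphic to the given snark. \<open>P_uncol\<close> then expresses the absence of a
  3-edge-colouring in terms of leaf cycles.\<close>

context
  fixes P :: "(leaf \<Rightarrow> leaf \<Rightarrow> bool) \<Rightarrow> bool"
  assumes P_swap: "\<And>E s. P E \<Longrightarrow> s \<in> set swaps \<Longrightarrow> P (swap_rel s E)"
    and P_rel: "\<And>E. P E \<Longrightarrow> leaf_rel E"
    and P_uncol: "\<And>E w k. P E \<Longrightarrow> leaf_cycles E w \<Longrightarrow> \<not> colors k w"
begin

text \<open>If a swap in \<open>ss\<close> lowers \<open>z\<close>, the relation is replaced by its
  image under that swap. The visited part is fixed and stays consistent, while the next leaf gets a
  smaller number, so the process ends.\<close>

lemma lowest_candidate:
  assumes "P E" "consistent E us ds p" "z \<in> set us" "E (hd p) z"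
    and ss: "set ss \<subseteq> set swaps" "\<And>s u. s \<in> set ss \<Longrightarrow> u \<notin> set us \<Longrightarrow> swap_app s u = u"
  shows "\<exists>E' z'. P E' \<and> consistent E' us ds p \<and> z' \<in> set us \<and> E' (hd p) z' \<and> \<not> lowers z' ss"
  using assms(1-4)
proof (induction "vtx z" arbitrary: E z rule: less_induct)
  case less
  show ?case
  proof (cases "lowers z ss")
    case False
    then show ?thesis
      using less.prems by blast
  next
    case True
    then obtain s where s: "s \<in> set ss" "z \<in> set (map snd s)"
      by (auto simp: lowers_iff)
    have sw: "s \<in> set swaps"
      using s(1) ss(1) by blast
    let ?z = "swap_app s z"
    have lt: "vtx ?z < vtx z"
      using swap_lowers[OF sw s(2)] .
    \<comment> \<open>An involution that fixes the visited leaves maps unvisited leaves to unvisited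
      ones.\<close>
    have "?z \<in> set us"
    proof (rule ccontr)
      assume "?z \<notin> set us"
      then have "swap_app s ?z = ?z"
        using ss(2)[OF s(1)] by blast
      then show False
        using lt swap_invol[OF sw, of z] by simp
    qed
    moreover have "hd p \<notin> set us"
      using less.prems(2) by (cases p) (auto simp: consistent_def)
    then have "swap_rel s E (hd p) ?z"
      using less.prems(4) ss(2)[OF s(1), of "hd p"] by (simp add: swap_invol[OF sw])
    moreover have "consistent (swap_rel s E) us ds p"
      using consistent_swap[OF less.prems(2)] ss(2)[OF s(1)] by blast
    ultimately show ?thesis
      using less.hyps[OF lt P_swap[OF less.prems(1) sw]] by blast
  qed
qed

lemma ext_ok_step:
  assumes rel: "leaf_rel E" and con: "consistent E us ds p" and z: "E (hd p) z"
  shows "ext_ok p z"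
proof -
  obtain x q where p: "p = x # q"
    using con by (cases p) (auto simp: consistent_def)
  have zx: "E z x" "E x z"
    using E_sym[OF rel z] z by (simp_all add: p)
  show ?thesis
  proof (cases q)
    case Nil
    then show ?thesis
      using E_sib[OF rel zx(1)] by (auto simp: p)
  next
    case (Cons y ws)
    then have "E x y"
      using con by (simp add: consistent_def p)
    then show ?thesis
      using E_sib[OF rel zx(1)] E_sib2[OF rel zx(1)] by (auto simp: p Cons)
  qed
qed

text \<open>\<open>next_step\<close> tells which branch of \<open>grow\<close> follows the relation.
  That branch is not pruned, since pruning would yield a colouring of a complete leaf arrangement,
  against \<open>P_uncol\<close>.\<close>

lemma grow_complete:
  assumes "P E" "consistent E us ds p" "length us < n" "valid al ds p"
    "set ss \<subseteq> set swaps" "\<And>s u. s \<in> set ss \<Longrightarrow> u \<notin> set us \<Longrightarrow> swap_app s u = u"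
  shows "\<exists>w\<in>set (grow n al ss us ds p). \<exists>E'. P E' \<and> leaf_cycles E' w"
  using assms
proof (induction n arbitrary: E al ss us ds p)
  case 0
  then show ?case by simp
next
  case (Suc n)
  note rel = P_rel[OF Suc.prems(1)]
  have ss_filter: "set (filter (\<lambda>s. \<not> moves z s) ss) \<subseteq> set swaps"
    "s \<in> set (filter (\<lambda>s. \<not> moves z s) ss) \<Longrightarrow> u \<notin> set us \<or> u = z \<Longrightarrow> swap_app s u = u" for s u z
    using Suc.prems(5,6) swap_moves by auto
  have not_mono: "\<not> (\<not> at_least_5 us \<and> same_color_rest us al)"
  proof
    assume *: "\<not> at_least_5 us \<and> same_color_rest us al"
    then obtain k e d c where k: "CS k e d \<in> set al" "c \<noteq> d" "\<forall>z\<in>set us. lcol k z = c"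
      "(third c ^^ length us) d = e"
      using same_color_rest_mem by meson
    have "colors k ds" "trail k e p d"
      using Suc.prems(4) k(1) unfolding valid_def by blast+
    then obtain w where "leaf_cycles E w" "colors k w"
      using same_color_completion[OF rel _ Suc.prems(2) _ _ k(3,2,4)] * by (auto simp: at_least_5_iff)
    then show False
      using P_uncol[OF Suc.prems(1)] by blast
  qed
  consider z where "z \<in> set us" "E (hd p) z"
    | "at_least_5 p" "close_ok p" "cyc E p" "us = []"
    | "at_least_5 p" "close_ok p" "cyc E p" "us \<noteq> []" "at_least_5 us"
    using next_step[OF rel Suc.prems(2)] by blast
  then show ?case
  proof cases
    case (1 z)
    obtain E' z' where E': "P E'" "consistent E' us ds p" "z' \<in> set us" "E' (hd p) z'" "\<not> lowers z' ss"
      using lowest_candidate[OF Suc.prems(1,2) 1 Suc.prems(5,6)] by blast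
    note rel' = P_rel[OF E'(1)]
    let ?g = "grow n (advance z' al) (filter (\<lambda>s. \<not> moves z' s) ss) (remove1 z' us) ds (z' # p)"
    have mem: "z' \<in> set (cands p ss us)"
      using E'(3,5) ext_ok_step[OF rel' E'(2,4)] by (simp add: set_cands)
    have "\<exists>w\<in>set ?g. \<exists>E'. P E' \<and> leaf_cycles E' w"
    proof (rule Suc.IH[OF E'(1)])
      show "consistent E' (remove1 z' us) ds (z' # p)"
        by (rule consistent_extend[OF rel' E'(2,3,4)])
      show "length (remove1 z' us) < n"
      proof -
        have "length (remove1 z' us) = length us - 1"
          using E'(3) by (simp add: length_remove1)
        moreover have "0 < length us"
          by (rule length_pos_if_in_set[OF E'(3)])
        ultimately show ?thesis
          using Suc.prems(3) by linarith
      qed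
      show "valid (advance z' al) ds (z' # p)"
        by (rule valid_advance[OF Suc.prems(4)])
      show "set (filter (\<lambda>s. \<not> moves z' s) ss) \<subseteq> set swaps"
        by (rule ss_filter(1))
      fix s u assume "s \<in> set (filter (\<lambda>s. \<not> moves z' s) ss)" "u \<notin> set (remove1 z' us)"
      then show "swap_app s u = u"
        using ss_filter(2)[of s z' u] by (meson in_set_remove1)
    qed
    moreover have "set ?g \<subseteq> set (grow (Suc n) al ss us ds p)"
      using not_mono mem by auto
    ultimately show ?thesis
      by blast
  next
    case 2
    have con: "leaf_cycles E (p # ds)"
      using complete_close[OF rel] Suc.prems(2) 2 by simp
    \<comment> \<open>A state that survives the closing would be a colouring of the finished
      arrangement.\<close>
    have "closed_cols al = []"
    proof (rule ccontr)
      assume "closed_cols al \<noteq> []"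
      then have "hd (closed_cols al) \<in> set (closed_cols al)"
        by simp
      then show False
        using valid_closed[OF Suc.prems(4)] P_uncol[OF Suc.prems(1) con] by blast
    qed
    then have "p # ds \<in> set (grow (Suc n) al ss us ds p)"
      using not_mono 2 by simp
    then show ?thesis
      using con Suc.prems(1) by blast
  next
    case 3
    let ?g = "grow n (start_states (hd us) (closed_cols al)) (filter (\<lambda>s. \<not> moves (hd us) s) ss)
                  (tl us) (p # ds) [hd us]"
    have "\<exists>w\<in>set ?g. \<exists>E'. P E' \<and> leaf_cycles E' w"
    proof (rule Suc.IH[OF Suc.prems(1)])
      show "consistent E (tl us) (p # ds) [hd us]"
        by (rule consistent_close[OF rel Suc.prems(2) 3(3,4)])
      show "length (tl us) < n"
        using Suc.prems(3) 3(4) by (cases us) auto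
      show "valid (start_states (hd us) (closed_cols al)) (p # ds) [hd us]"
        by (rule valid_start) (rule valid_closed[OF Suc.prems(4)])
      show "set (filter (\<lambda>s. \<not> moves (hd us) s) ss) \<subseteq> set swaps"
        by (rule ss_filter(1))
      fix s u assume "s \<in> set (filter (\<lambda>s. \<not> moves (hd us) s) ss)" "u \<notin> set (tl us)"
      then show "swap_app s u = u"
        using ss_filter(2)[of s "hd us" u] 3(4) by (cases us) auto
    qed
    moreover have "set ?g \<subseteq> set (grow (Suc n) al ss us ds p)"
      using not_mono 3 by auto
    ultimately show ?thesis
      by blast
  qed
qed

lemma uncolored_complete:
  assumes "P E"
  shows "\<exists>w\<in>set uncolored. \<exists>E'. P E' \<and> leaf_cycles E' w"
  unfolding uncolored_def
proof (rule grow_complete[OF assms])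
  have "set [L1, L2, L3, L4, L5, L6, L7, L8, L9, L10, L11] = - {L0}"
  proof -
    have "x \<in> {L0, L1, L2, L3, L4, L5, L6, L7, L8, L9, L10, L11}" for x
      by (cases x) simp_all
    then show ?thesis
      by auto
  qed
  then show "consistent E [L1, L2, L3, L4, L5, L6, L7, L8, L9, L10, L11] [] [L0]"
    by (simp add: consistent_def)
  show "valid (start_states L0 tree_cols) [] [L0]"
    by (rule valid_start) (simp add: colors_def)
  show "set (filter (\<lambda>s. \<not> moves L0 s) swaps) \<subseteq> set swaps"
    by auto
  fix s u assume s: "s \<in> set (filter (\<lambda>s. \<not> moves L0 s) swaps)"
    "u \<notin> set [L1, L2, L3, L4, L5, L6, L7, L8, L9, L10, L11]"
  then have "u = L0"
    by (cases u) simp_all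
  then show "swap_app s u = u"
    using s(1) swap_moves[of s L0] by simp
qed simp

end

section \<open>Edge colourings from trails\<close>

text \<open>\<open>ic x\<close> is the colour of the edge by which the path enters \<open>x\<close>.
  As paths are listed backwards, the colour \<open>e\<close> at the beginning belongs to
  \<open>last p\<close>.\<close>

lemma trail_in_colors:
  assumes "trail k e p d" "distinct p" "p \<noteq> []"
  shows "\<exists>ic. ic (last p) = e \<and> d = third (lcol k (hd p)) (ic (hd p)) \<and>
    (\<forall>x\<in>set p. ic x \<noteq> lcol k x) \<and> (\<forall>(x, y)\<in>set (zip p (tl p)). ic x = third (lcol k y) (ic y))"
  using assms
proof (induction rule: trail.induct)
  case trail_Nil
  then show ?case by simp
next
  case (trail_Cons p d z)
  show ?case
  proof (cases p)
    case Nil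
    then have "d = e"
      using trail_Cons.hyps(1) by (auto elim: trail.cases)
    then show ?thesis
      using trail_Cons.hyps(2) Nil by (intro exI[of _ "\<lambda>_. e"]) simp
  next
    case (Cons y q)
    then obtain ic where ic: "ic (last p) = e" "d = third (lcol k (hd p)) (ic (hd p))"
      "\<forall>x\<in>set p. ic x \<noteq> lcol k x" "\<forall>(x, y)\<in>set (zip p (tl p)). ic x = third (lcol k y) (ic y)"
      using trail_Cons.IH trail_Cons.prems by auto
    have z: "z \<notin> set p"
      using trail_Cons.prems by simp
    have "a \<noteq> z \<and> b \<noteq> z" if "(a, b) \<in> set (zip p (tl p))" for a b
      using that z by (metis Cons list.sel(3) list.set_intros(2) set_zip_leftD set_zip_rightD)
    then have "\<forall>(x, y)\<in>set (zip p (tl p)). (ic(z := d)) x = third (lcol k y) ((ic(z := d)) y)"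
      using ic(4) by fastforce
    moreover have "zip (z # p) (tl (z # p)) = (z, y) # zip p (tl p)"
      by (simp add: Cons)
    moreover have "y \<noteq> z" "last p \<noteq> z"
      using z Cons by (auto dest: last_in_set)
    ultimately show ?thesis
      using ic(1-3) trail_Cons.hyps(2) z Cons by (intro exI[of _ "ic(z := d)"]) auto
  qed
qed

lemma zip_rotate_cases:
  "(x, y) \<in> set (zip d (tl d @ [h])) \<Longrightarrow> (x, y) \<in> set (zip d (tl d)) \<or> x = last d \<and> y = h"
  by (induction d rule: induct_list012) auto

text \<open>When the leaving colour equals the entering one, the edge that closes the cycle gets the
  same colour from both of its ends.\<close>

lemma cycle_in_colors:
  assumes "trail k e d e" "distinct d" "d \<noteq> []"
  shows "\<exists>ic. (\<forall>x\<in>set d. ic x \<noteq> lcol k x) \<and> (\<forall>(x, y)\<in>cpairs d. ic x = third (lcol k y) (ic y))"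
proof -
  obtain ic where ic: "ic (last d) = e" "e = third (lcol k (hd d)) (ic (hd d))"
    "\<forall>x\<in>set d. ic x \<noteq> lcol k x" "\<forall>(x, y)\<in>set (zip d (tl d)). ic x = third (lcol k y) (ic y)"
    using trail_in_colors[OF assms] by blast
  have "rotate1 d = tl d @ [hd d]"
    using assms(3) by (cases d) auto
  then have "(x, y) \<in> set (zip d (tl d)) \<or> x = last d \<and> y = hd d" if "(x, y) \<in> cpairs d" for x y
    using that zip_rotate_cases by (simp add: cpairs_def)
  then have "\<forall>(x, y)\<in>cpairs d. ic x = third (lcol k y) (ic y)"
    using ic by fastforce
  then show ?thesis
    using ic(3) by blast
qed

lemma word_in_colors:
  assumes "colors k w" "distinct (concat w)" "\<forall>d\<in>set w. distinct d \<and> d \<noteq> []"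
  shows "\<exists>ic. \<forall>d\<in>set w. (\<forall>x\<in>set d. ic x \<noteq> lcol k x) \<and>
    (\<forall>(x, y)\<in>cpairs d. ic x = third (lcol k y) (ic y))"
  using assms
proof (induction w)
  case Nil
  then show ?case by simp
next
  case (Cons d w)
  obtain ic where ic: "\<forall>d\<in>set w. (\<forall>x\<in>set d. ic x \<noteq> lcol k x) \<and>
    (\<forall>(x, y)\<in>cpairs d. ic x = third (lcol k y) (ic y))"
    using Cons by (auto simp: colors_def)
  obtain e where "trail k e d e"
    using Cons.prems(1) by (auto simp: colors_def)
  then obtain jc where jc: "\<forall>x\<in>set d. jc x \<noteq> lcol k x"
    "\<forall>(x, y)\<in>cpairs d. jc x = third (lcol k y) (jc y)"
    using cycle_in_colors Cons.prems(3) by (metis list.set_intros(1))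
  \<comment> \<open>The cycles are disjoint, so the entering colours chosen on each of them can be
    glued.\<close>
  define kc where "kc x = (if x \<in> set d then jc x else ic x)" for x
  have "(\<forall>x\<in>set d'. kc x \<noteq> lcol k x) \<and> (\<forall>(x, y)\<in>cpairs d'. kc x = third (lcol k y) (kc y))"
    if d': "d' \<in> set (d # w)" for d'
  proof (cases "d' = d")
    case True
    then have "kc x = jc x" if "x \<in> set d'" for x
      using that by (simp add: kc_def)
    then show ?thesis
      using jc cpairs_subset[of _ _ d'] unfolding True by fastforce
  next
    case False
    then have w: "d' \<in> set w"
      using d' by simp
    then have "kc x = ic x" if "x \<in> set d'" for x
      using that Cons.prems(2) by (auto simp: kc_def)
    then show ?thesis
      using bspec[OF ic w] cpairs_subset[of _ _ d'] by fastforce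
  qed
  then show ?case
    by blast
qed

section \<open>Assembling a proper edge colouring\<close>

fun color_nat :: "color \<Rightarrow> nat" where
  "color_nat Red = 0" | "color_nat Green = 1" | "color_nat Blue = 2"

lemma color_nat_inj: "color_nat c = color_nat d \<longleftrightarrow> c = d"
  by (cases c; cases d; simp)

lemma color_nat_less: "color_nat c < 3"
  by (cases c) simp_all

text \<open>Edges arise in several ways, as tree edges and as oriented leaf edges. The colouring is
  therefore first described by a relation, from which a choice makes a function.\<close>

lemma proper_edge_coloring_of_rel:
  fixes R :: "'a set \<Rightarrow> color \<Rightarrow> bool"
  assumes "fin_graph G" "\<And>e. e \<in> edges G \<Longrightarrow> \<exists>c. R e c"
    and "\<And>e f c d. R e c \<Longrightarrow> R f d \<Longrightarrow> e \<inter> f \<noteq> {} \<Longrightarrow> e = f \<longleftrightarrow> c = d"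
  shows "\<exists>c. proper_edge_coloring 3 G c"
proof -
  define c where "c e = color_nat (SOME c. R e c)" for e
  have "\<exists>x. c e = color_nat x \<and> R e x" if "e \<in> edges G" for e
    using someI_ex[OF assms(2)[OF that]] by (auto simp: c_def)
  then have "proper_edge_coloring 3 G c"
    unfolding proper_edge_coloring_def
  proof (intro conjI ballI impI)
    fix e
    show "c e < 3"
      by (simp add: c_def color_nat_less)
  next
    fix e f assume ef: "e \<in> edges G" "f \<in> edges G" "e \<noteq> f \<and> e \<inter> f \<noteq> {}"
    then obtain x y where "c e = color_nat x" "R e x" "c f = color_nat y" "R f y"
      using \<open>\<And>e. e \<in> edges G \<Longrightarrow> \<exists>x. c e = color_nat x \<and> R e x\<close> by meson
    then show "c e \<noteq> c f"
      using assms(3)[of e x f y] ef(3) by (simp add: color_nat_inj)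
  qed
  then show ?thesis
    by blast
qed

text \<open>The colour of the edge from \<open>n\<close> up to its parent. Entry 0 of the list is a
  filler, as the root has no such edge.\<close>

fun tree_color :: "tree_col \<Rightarrow> nat \<Rightarrow> color" where
  "tree_color (TC a b c d e f g h i) n =
     (if n < 10 then [Red, Red, Green, Blue, other Red a, other Red (\<not> a), other Green d,
        other Green (\<not> d), other Blue g, other Blue (\<not> g)] ! n
      else lcol (TC a b c d e f g h i) (all_leaves ! (n - 10)))"

lemma other_neq: "other c a \<noteq> c" "c \<noteq> other c a" "other c a \<noteq> other c (\<not> a)" "other c (\<not> a) \<noteq> other c a"
  by (cases c; cases a; simp)+

lemma tree_color_vtx: "tree_color k (vtx l) = lcol k l"
  by (cases k; cases l) (simp_all add: all_leaves_def)

lemma tree_color_children: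
  assumes "1 \<le> m" "m < 10"
  shows "distinct [tree_color k m, tree_color k (2 * m + 2), tree_color k (2 * m + 3)]"
proof -
  have "m \<in> set [1..<10]"
    using assms unfolding set_upt by simp
  moreover have "[1..<10] = [1, 2, 3, 4, 5, 6, 7, 8, 9]"
    by code_simp
  ultimately have "m = 1 \<or> m = 2 \<or> m = 3 \<or> m = 4 \<or> m = 5 \<or> m = 6 \<or> m = 7 \<or> m = 8 \<or> m = 9"
    by (simp only: list.set insert_iff empty_iff) blast
  then show ?thesis
    by (cases k, elim disjE) (simp_all add: all_leaves_def other_neq)
qed

lemma parent_cases:
  assumes "n \<in> {1..<22}"
  obtains "parent n = 0" "n = 1 \<or> n = 2 \<or> n = 3"
  | "1 \<le> parent n" "parent n < 10" "n = 2 * parent n + 2 \<or> n = 2 * parent n + 3"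
proof (cases "n \<le> 3")
  case True
  then show ?thesis
    using that(1) assms by (simp add: parent_def) arith
next
  case False
  show ?thesis
  proof (rule that(2))
    have "4 \<le> n" "n < 22"
      using False assms by auto
    have "1 \<le> (n - 2) div 2" "(n - 2) div 2 < 10"
      "n = 2 * ((n - 2) div 2) + 2 \<or> n = 2 * ((n - 2) div 2) + 3"
    proof -
      define q where "q = (n - 2) div 2"
      have q: "n - 2 = 2 * q + (n - 2) mod 2" "(n - 2) mod 2 < 2"
        by (simp_all add: q_def)
      then show "1 \<le> (n - 2) div 2" "(n - 2) div 2 < 10"
        using \<open>4 \<le> n\<close> \<open>n < 22\<close> unfolding q_def[symmetric] by linarith+
      have "(n - 2) mod 2 = 0 \<or> (n - 2) mod 2 = 1"
        using q(2) by linarith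
      then show "n = 2 * ((n - 2) div 2) + 2 \<or> n = 2 * ((n - 2) div 2) + 3"
        using q(1) \<open>4 \<le> n\<close> unfolding q_def[symmetric] by (elim disjE) linarith+
    qed
    then show "1 \<le> parent n" "parent n < 10" "n = 2 * parent n + 2 \<or> n = 2 * parent n + 3"
      using False by (simp_all add: parent_def)
  qed
qed

lemma tree_color_parent:
  assumes "n \<in> {1..<22}" "parent n \<in> {1..<22}"
  shows "tree_color k n \<noteq> tree_color k (parent n)"
  using assms(1)
proof (cases rule: parent_cases)
  case 2
  then show ?thesis
    using tree_color_children[OF 2(1,2), of k] by auto
qed (use assms in auto)

lemma tree_color_sibling:
  assumes "n \<in> {1..<22}" "m \<in> {1..<22}" "parent n = parent m" "n \<noteq> m"
  shows "tree_color k n \<noteq> tree_color k m"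
  using assms(1)
proof (cases rule: parent_cases)
  case 1
  then have "m = 1 \<or> m = 2 \<or> m = 3"
    using assms(3) by (auto intro: parent_cases[OF assms(2)])
  then show ?thesis
    using 1 assms(4) by (cases k) auto
next
  case 2
  then have "m = 2 * parent n + 2 \<or> m = 2 * parent n + 3"
    using assms(3) by (auto intro: parent_cases[OF assms(2)])
  then show ?thesis
    using 2 assms(4) tree_color_children[OF 2(1,2), of k] by auto
qed

lemma tree_color_proper:
  assumes "n \<in> {1..<22}" "m \<in> {1..<22}" "{parent n, n} \<inter> {parent m, m} \<noteq> {}"
  shows "{parent n, n} = {parent m, m} \<longleftrightarrow> tree_color k n = tree_color k m"
proof (cases "n = m")
  case False
  have "{parent n, n} \<noteq> {parent m, m}"
    using False parent_less[of n] parent_less[of m] assms(1,2) by (auto simp: doubleton_eq_iff)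
  moreover consider "parent n = parent m" | "parent n = m" | "parent m = n"
    using assms(3) False by auto
  then have "tree_color k n \<noteq> tree_color k m"
  proof cases
    case 1
    then show ?thesis
      using tree_color_sibling assms False by blast
  next
    case 2
    then show ?thesis
      using tree_color_parent[of n k] assms by simp
  next
    case 3
    then show ?thesis
      using tree_color_parent[of m k] assms by simp
  qed
  ultimately show ?thesis
    by blast
qed simp

text \<open>\<open>C\<close> orients the leaf cycles. Because paths are listed backwards, a pair (x,
  y) in \<open>C\<close> is the edge that leaves \<open>y\<close> and enters \<open>x\<close>, and
  its colour is \<open>ic x\<close>.\<close>

lemma leaf_graph_coloring:
  assumes fin: "fin_graph (leaf_graph E)" and rel: "leaf_rel E"
    and w: "leaf_cycles E w" and col: "colors k w"
  shows "\<exists>c. proper_edge_coloring 3 (leaf_graph E) c"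
proof -
  define C where "C = (\<Union>d\<in>set w. cpairs d)"
  have cyc: "cyc E d" if "d \<in> set w" for d
    using w that by (simp add: leaf_cycles_def)
  have dist: "distinct d" "3 \<le> length d" if "d \<in> set w" for d
    using cyc[OF that] by (auto simp: cyc_def)
  obtain ic where ic: "\<forall>d\<in>set w. (\<forall>x\<in>set d. ic x \<noteq> lcol k x) \<and>
    (\<forall>(x, y)\<in>cpairs d. ic x = third (lcol k y) (ic y))"
    using word_in_colors[OF col] w dist by (fastforce simp: leaf_cycles_def)
  have ic_neq: "ic x \<noteq> lcol k x" for x
  proof -
    obtain d where "d \<in> set w" "x \<in> set d"
      using w by (auto simp: leaf_cycles_def)
    then show ?thesis
      using ic by blast
  qed
  have ic_C: "ic x = third (lcol k y) (ic y)" if "(x, y) \<in> C" for x y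
    using ic that by (fastforce simp: C_def)
  have same: "d = d'" if "d \<in> set w" "d' \<in> set w" "x \<in> set d" "x \<in> set d'" for d d' x
    using w that unfolding leaf_cycles_def distinct_concat_iff by (meson disjoint_iff)
  have C_fun: "y = y'" if xy: "(x, y) \<in> C" "(x, y') \<in> C" for x y y'
  proof -
    obtain d d' where d: "d \<in> set w" "d' \<in> set w" "(x, y) \<in> cpairs d" "(x, y') \<in> cpairs d'"
      using xy unfolding C_def by blast
    then have "d' = d"
      using same[of d' d x] cpairs_subset[OF d(3)] cpairs_subset[OF d(4)] by simp
    moreover obtain a where "\<And>v. (x, v) \<in> cpairs d \<Longrightarrow> v = a"
      using cyc_neighbours[OF dist[OF d(1)]] cpairs_subset[OF d(3)] by metis
    ultimately show ?thesis
      using d by metis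
  qed
  have C_inj: "x = x'" if xy: "(x, y) \<in> C" "(x', y) \<in> C" for x x' y
  proof -
    obtain d d' where d: "d \<in> set w" "d' \<in> set w" "(x, y) \<in> cpairs d" "(x', y) \<in> cpairs d'"
      using xy unfolding C_def by blast
    then have "d' = d"
      using same[of d' d y] cpairs_subset[OF d(3)] cpairs_subset[OF d(4)] by simp
    moreover obtain a where "\<And>v. (v, y) \<in> cpairs d \<Longrightarrow> v = a"
      using cyc_neighbours[OF dist[OF d(1)]] cpairs_subset[OF d(3)] by metis
    ultimately show ?thesis
      using d by metis
  qed
  have C_asym: "(y, x) \<notin> C" if xy: "(x, y) \<in> C" for x y
  proof
    assume yx: "(y, x) \<in> C"
    obtain d where d: "d \<in> set w" "(x, y) \<in> cpairs d"
      using xy unfolding C_def by blast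
    obtain d' where d': "d' \<in> set w" "(y, x) \<in> cpairs d'"
      using yx unfolding C_def by blast
    have "d' = d"
      using same[OF d'(1) d(1), of x] cpairs_subset[OF d(2)] cpairs_subset[OF d'(2)] by simp
    moreover obtain a b where "\<And>v. (x, v) \<in> cpairs d \<Longrightarrow> v = a" "\<And>v. (v, x) \<in> cpairs d \<Longrightarrow> v = b"
      "a \<noteq> b"
      using cyc_neighbours[OF dist[OF d(1)]] cpairs_subset[OF d(2)] by metis
    ultimately show False
      using d(2) d'(2) by metis
  qed
  have C_E: "E x y \<longleftrightarrow> (x, y) \<in> C \<or> (y, x) \<in> C" for x y
    using complete_E_iff[OF rel w] by (auto simp: C_def)
  have ic_next: "ic x \<noteq> ic y" "ic x \<noteq> lcol k y" if "(x, y) \<in> C" for x y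
    using third_neq[of "lcol k y" "ic y"] ic_neq[of y] ic_C[OF that] by metis+
  define R where "R e c \<longleftrightarrow> (\<exists>n\<in>{1..<22}. e = {parent n, n} \<and> c = tree_color k n) \<or>
    (\<exists>x y. (x, y) \<in> C \<and> e = {vtx x, vtx y} \<and> c = ic x)" for e c
  have TC: "{parent n, n} \<noteq> {vtx x, vtx y} \<and> tree_color k n \<noteq> ic x"
    if "n \<in> {1..<22}" "(x, y) \<in> C" "{parent n, n} \<inter> {vtx x, vtx y} \<noteq> {}" for n x y
  proof -
    have "parent n < vtx x" "parent n < vtx y"
      using parent_less_10[of n] vtx_ge[of x] vtx_ge[of y] that(1) by auto
    then have "n = vtx x \<or> n = vtx y" "{parent n, n} \<noteq> {vtx x, vtx y}"
      using that(3) by (auto simp: doubleton_eq_iff)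
    then show ?thesis
      using ic_neq[of x] ic_next(2)[OF that(2)] by (auto simp: tree_color_vtx)
  qed
  have CC: "{vtx x, vtx y} = {vtx x', vtx y'} \<longleftrightarrow> ic x = ic x'"
    if xy: "(x, y) \<in> C" "(x', y') \<in> C" and "{vtx x, vtx y} \<inter> {vtx x', vtx y'} \<noteq> {}" for x y x' y'
  proof -
    consider "x = x'" | "y = y'" | "x = y'" "x \<noteq> x'" "y \<noteq> y'" | "y = x'" "x \<noteq> x'" "y \<noteq> y'"
      using \<open>{vtx x, vtx y} \<inter> {vtx x', vtx y'} \<noteq> {}\<close> by (auto simp: vtx_inj)
    then show ?thesis
    proof cases
      case 1
      then show ?thesis
        using C_fun xy by blast
    next
      case 2
      then show ?thesis
        using C_inj xy by blast
    next
      case 3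
      then have "ic x \<noteq> ic x'"
        using ic_next(1)[OF xy(2)] by auto
      moreover have "y \<noteq> x'"
        using C_asym[OF xy(1)] xy(2) 3(1) by auto
      ultimately show ?thesis
        using 3 by (auto simp: doubleton_eq_iff vtx_inj)
    next
      case 4
      then have "ic x \<noteq> ic x'"
        using ic_next(1)[OF xy(1)] by auto
      moreover have "x \<noteq> y'"
        using C_asym[OF xy(1)] xy(2) 4(1) by auto
      ultimately show ?thesis
        using 4 by (auto simp: doubleton_eq_iff vtx_inj)
    qed
  qed
  show ?thesis
  proof (rule proper_edge_coloring_of_rel[OF fin])
    fix e assume "e \<in> edges (leaf_graph E)"
    then consider n where "n \<in> {1..<22}" "e = {parent n, n}" | x y where "e = {vtx x, vtx y}" "E x y"
      by (auto simp: leaf_graph_def tree_edges_def)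
    then show "\<exists>c. R e c"
    proof cases
      case 1
      then show ?thesis
        unfolding R_def by blast
    next
      case 2
      then show ?thesis
        using C_E[of x y] insert_commute[of "vtx x" "vtx y" "{}"] unfolding R_def by metis
    qed
  next
    fix e f c d assume "R e c" "R f d" and ne: "e \<inter> f \<noteq> {}"
    then consider
        n m where "n \<in> {1..<22}" "m \<in> {1..<22}" "e = {parent n, n}" "f = {parent m, m}"
          "c = tree_color k n" "d = tree_color k m"
      | n x y where "n \<in> {1..<22}" "(x, y) \<in> C" "e = {parent n, n}" "f = {vtx x, vtx y}"
          "c = tree_color k n" "d = ic x"
      | n x y where "n \<in> {1..<22}" "(x, y) \<in> C" "f = {parent n, n}" "e = {vtx x, vtx y}"
          "d = tree_color k n" "c = ic x"
      | x y x' y' where "(x, y) \<in> C" "(x', y') \<in> C" "e = {vtx x, vtx y}" "f = {vtx x', vtx y'}"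
          "c = ic x" "d = ic x'"
      unfolding R_def by blast
    then show "e = f \<longleftrightarrow> c = d"
    proof cases
      case 1
      then show ?thesis
        using tree_color_proper ne by simp
    next
      case 2
      then show ?thesis
        using TC[OF 2(1,2)] ne by simp
    next
      case 3
      then have "{parent n, n} \<inter> {vtx x, vtx y} \<noteq> {}"
        using ne by (simp add: Int_commute)
      then show ?thesis
        using TC[OF 3(1,2)] 3 by auto
    next
      case 4
      then show ?thesis
        using CC[OF 4(1,2)] ne by simp
    qed
  qed
qed

section \<open>Cubic graphs given by adjacency tables\<close>

definition adj_graph :: "nat list list \<Rightarrow> nat ugraph" where
  "adj_graph A = \<lparr>verts = {0..<22}, edges = {{x, y} | x y. x < 22 \<and> y \<in> set (A ! x)}\<rparr>"

definition table_ok :: "nat list list \<Rightarrow> bool" where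
  "table_ok A \<longleftrightarrow> list_all (\<lambda>x. distinct (A ! x) \<and> length (A ! x) = 3 \<and>
     list_all (\<lambda>y. y < 22 \<and> y \<noteq> x \<and> x \<in> set (A ! y)) (A ! x)) [0..<22]"

text \<open>Paths grow at the head, so \<open>last p\<close> remains the start vertex to which the
  finished path must be adjacent.\<close>

fun closed_extensions :: "nat list list \<Rightarrow> nat \<Rightarrow> nat list \<Rightarrow> nat list list" where
  "closed_extensions A 0 p = (if last p \<in> set (A ! hd p) then [p] else [])"
| "closed_extensions A (Suc n) p =
     concat (map (\<lambda>z. closed_extensions A n (z # p)) (filter (\<lambda>z. z \<notin> set p) (A ! hd p)))"

definition cycles :: "nat list list \<Rightarrow> nat \<Rightarrow> nat list list" where
  "cycles A n = concat (map (\<lambda>v. closed_extensions A (n - 1) [v]) [0..<22])"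

text \<open>
  \<open>no_cut A vs S T b\<close>: no partition of the vertices into two sets of size at least 2, extending
  the partial one \<open>(S, T)\<close>, is crossed by at most \<open>b\<close> edges outside \<open>S \<union> T\<close>.
\<close>

fun no_cut :: "nat list list \<Rightarrow> nat list \<Rightarrow> nat list \<Rightarrow> nat list \<Rightarrow> nat \<Rightarrow> bool" where
  "no_cut A [] S T b = (length S \<le> 1 \<or> length T \<le> 1)"
| "no_cut A (v # vs) S T b =
     (let s = length (filter (\<lambda>u. u \<in> set S) (A ! v)); t = length (filter (\<lambda>u. u \<in> set T) (A ! v))
      in if if t \<le> b then no_cut A vs (v # S) T (b - t) else True
         then if s \<le> b then no_cut A vs S (v # T) (b - s) else True
         else False)"

text \<open>The arguments \<open>a\<close>, \<open>b\<close>, \<open>c\<close> collect the vertices already seeing each of the three colours.\<close>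

fun colorable :: "(nat \<times> nat) list \<Rightarrow> nat list \<Rightarrow> nat list \<Rightarrow> nat list \<Rightarrow> bool" where
  "colorable [] a b c = True"
| "colorable ((x, y) # es) a b c =
     (if if x \<in> set a \<or> y \<in> set a then False else colorable es (x # y # a) b c then True
      else if if x \<in> set b \<or> y \<in> set b then False else colorable es a (x # y # b) c then True
      else if x \<in> set c \<or> y \<in> set c then False else colorable es a b (x # y # c))"

text \<open>The search is followed along the branch given by \<open>f\<close>; \<open>ds\<close> are
  the edges decided so far and account for all entries of \<open>a\<close>, \<open>b\<close>,
  \<open>c\<close>. The order x < y makes distinct pairs distinct edges.\<close>

lemma colorable_complete:
  assumes col: "proper_edge_coloring 3 G f"
    and "\<forall>(x, y)\<in>set (ds @ es). {x, y} \<in> edges G \<and> x < y" "distinct (ds @ es)"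
    and "\<And>z. z \<in> set a \<Longrightarrow> \<exists>(x, y)\<in>set ds. z \<in> {x, y} \<and> f {x, y} = 0"
    and "\<And>z. z \<in> set b \<Longrightarrow> \<exists>(x, y)\<in>set ds. z \<in> {x, y} \<and> f {x, y} = 1"
    and "\<And>z. z \<in> set c \<Longrightarrow> \<exists>(x, y)\<in>set ds. z \<in> {x, y} \<and> f {x, y} = 2"
  shows "colorable es a b c"
  using assms(2-)
proof (induction es arbitrary: ds a b c)
  case Nil
  then show ?case by simp
next
  case (Cons e es)
  obtain x y where e: "e = (x, y)"
    by (cases e)
  have xy: "{x, y} \<in> edges G" "x < y"
    using Cons.prems(1) by (auto simp: e)
  \<comment> \<open>An end of {x, y} that already sees the colour of this edge would lie on two
    distinct edges of that colour.\<close>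
  have free: "x \<notin> Z \<and> y \<notin> Z" if Z: "\<And>z. z \<in> Z \<Longrightarrow> \<exists>(u, v)\<in>set ds. z \<in> {u, v} \<and> f {u, v} = f {x, y}" for Z
  proof -
    have "z \<notin> Z" if z: "z \<in> {x, y}" for z
    proof
      assume "z \<in> Z"
      then obtain u v where uv: "(u, v) \<in> set ds" "z \<in> {u, v}" "f {u, v} = f {x, y}"
        using Z[OF \<open>z \<in> Z\<close>] by auto
      then have "{u, v} \<in> edges G" "u < v" "(u, v) \<noteq> (x, y)"
        using Cons.prems(1,2) by (auto simp: e)
      moreover from this have "{u, v} \<noteq> {x, y}"
        using xy(2) by (auto simp: doubleton_eq_iff)
      ultimately show False
        using proper_edge_coloringD(2)[OF col _ xy(1), of "{u, v}"] uv z by auto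
    qed
    then show ?thesis
      by blast
  qed
  let ?ds = "ds @ [(x, y)]"
  have ds: "\<forall>(x, y)\<in>set (?ds @ es). {x, y} \<in> edges G \<and> x < y" "distinct (?ds @ es)"
    using Cons.prems(1,2) by (auto simp: e)
  have old: "\<exists>(u, v)\<in>set ?ds. z \<in> {u, v} \<and> f {u, v} = i"
    if "\<exists>(u, v)\<in>set ds. z \<in> {u, v} \<and> f {u, v} = i" for z i
    using that by auto
  have "f {x, y} < 3"
    using proper_edge_coloringD(1)[OF col xy(1)] .
  then consider "f {x, y} = 0" | "f {x, y} = 1" | "f {x, y} = 2"
    by linarith
  then show ?case
  proof cases
    case 1
    have "colorable es (x # y # a) b c"
    proof (rule Cons.IH[OF ds])
      show "\<exists>(u, v)\<in>set ?ds. z \<in> {u, v} \<and> f {u, v} = 0" if "z \<in> set (x # y # a)" for z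
      proof (cases "z \<in> {x, y}")
        case True
        then show ?thesis
          using 1 by (intro bexI[of _ "(x, y)"]) simp_all
      next
        case False
        then show ?thesis
          using that old[OF Cons.prems(3)[of z]] by simp
      qed
      show "\<exists>(u, v)\<in>set ?ds. z \<in> {u, v} \<and> f {u, v} = 1" if "z \<in> set b" for z
        using old[OF Cons.prems(4)[OF that]] .
      show "\<exists>(u, v)\<in>set ?ds. z \<in> {u, v} \<and> f {u, v} = 2" if "z \<in> set c" for z
        using old[OF Cons.prems(5)[OF that]] .
    qed
    moreover have "x \<notin> set a \<and> y \<notin> set a"
    proof (rule free)
      fix z assume "z \<in> set a"
      from Cons.prems(3)[OF this] show "\<exists>(u, v)\<in>set ds. z \<in> {u, v} \<and> f {u, v} = f {x, y}"
        unfolding 1 .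
    qed
    ultimately show ?thesis
      by (simp add: e)
  next
    case 2
    have "colorable es a (x # y # b) c"
    proof (rule Cons.IH[OF ds])
      show "\<exists>(u, v)\<in>set ?ds. z \<in> {u, v} \<and> f {u, v} = 1" if "z \<in> set (x # y # b)" for z
      proof (cases "z \<in> {x, y}")
        case True
        then show ?thesis
          using 2 by (intro bexI[of _ "(x, y)"]) simp_all
      next
        case False
        then show ?thesis
          using that old[OF Cons.prems(4)[of z]] by simp
      qed
      show "\<exists>(u, v)\<in>set ?ds. z \<in> {u, v} \<and> f {u, v} = 0" if "z \<in> set a" for z
        using old[OF Cons.prems(3)[OF that]] .
      show "\<exists>(u, v)\<in>set ?ds. z \<in> {u, v} \<and> f {u, v} = 2" if "z \<in> set c" for z
        using old[OF Cons.prems(5)[OF that]] .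
    qed
    moreover have "x \<notin> set b \<and> y \<notin> set b"
    proof (rule free)
      fix z assume "z \<in> set b"
      from Cons.prems(4)[OF this] show "\<exists>(u, v)\<in>set ds. z \<in> {u, v} \<and> f {u, v} = f {x, y}"
        unfolding 2 .
    qed
    ultimately show ?thesis
      by (simp add: e)
  next
    case 3
    have "colorable es a b (x # y # c)"
    proof (rule Cons.IH[OF ds])
      show "\<exists>(u, v)\<in>set ?ds. z \<in> {u, v} \<and> f {u, v} = 2" if "z \<in> set (x # y # c)" for z
      proof (cases "z \<in> {x, y}")
        case True
        then show ?thesis
          using 3 by (intro bexI[of _ "(x, y)"]) simp_all
      next
        case False
        then show ?thesis
          using that old[OF Cons.prems(5)[of z]] by simp
      qed
      show "\<exists>(u, v)\<in>set ?ds. z \<in> {u, v} \<and> f {u, v} = 0" if "z \<in> set a" for z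
        using old[OF Cons.prems(3)[OF that]] .
      show "\<exists>(u, v)\<in>set ?ds. z \<in> {u, v} \<and> f {u, v} = 1" if "z \<in> set b" for z
        using old[OF Cons.prems(4)[OF that]] .
    qed
    moreover have "x \<notin> set c \<and> y \<notin> set c"
    proof (rule free)
      fix z assume "z \<in> set c"
      from Cons.prems(5)[OF this] show "\<exists>(u, v)\<in>set ds. z \<in> {u, v} \<and> f {u, v} = f {x, y}"
        unfolding 3 .
    qed
    ultimately show ?thesis
      by (simp add: e)
  qed
qed

section \<open>Components and edge cuts\<close>

lemma component_eq:
  assumes "C \<in> components G" "D \<in> components G" "v \<in> C" "v \<in> D"
  shows "C = D"
proof -
  obtain u w where uw: "C = {x. \<exists>xs. walk G u xs x}" "D = {x. \<exists>xs. walk G w xs x}"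
    using assms(1,2) by (auto simp: components_def)
  then obtain xs ys where xs: "walk G u xs v" "walk G w ys v"
    using assms(3,4) by auto
  have wu: "walk G w (ys @ tl (rev xs)) u" "walk G u (xs @ tl (rev ys)) w"
    using walk_join[OF xs(2) walk_rev[OF xs(1)]] walk_join[OF xs(1) walk_rev[OF xs(2)]] .
  show ?thesis
    unfolding uw
  proof (intro equalityI subsetI; elim CollectE exE; intro CollectI)
    fix x zs assume "walk G u zs x"
    then show "\<exists>zs. walk G w zs x"
      using walk_join[OF wu(1)] by (intro exI)
  next
    fix x zs assume "walk G w zs x"
    then show "\<exists>zs. walk G u zs x"
      using walk_join[OF wu(2)] by (intro exI)
  qed
qed

lemma component_closed:
  assumes "C \<in> components G" "x \<in> C" "{x, y} \<in> edges G" "y \<in> verts G"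
  shows "y \<in> C"
proof -
  obtain u where u: "C = {x. \<exists>xs. walk G u xs x}"
    using assms(1) by (auto simp: components_def)
  then obtain xs where "walk G u xs x"
    using assms(2) by auto
  then show ?thesis
    unfolding u using walk_append[OF _ assms(3,4)] by (intro CollectI exI)
qed

definition crossing :: "'a ugraph \<Rightarrow> 'a set \<Rightarrow> 'a set set" where
  "crossing G B = {e \<in> edges G. e \<inter> B \<noteq> {} \<and> \<not> e \<subseteq> B}"

lemma cycle_card:
  assumes "is_cycle G xs" "set xs \<subseteq> C" "finite C"
  shows "3 \<le> card C"
  using assms card_mono[of C "set xs"] by (auto simp: is_cycle_def distinct_card)

text \<open>All edges leaving a component have been deleted, and a component with a cycle has three
  vertices. For cubic graphs the criterion loses nothing: an acyclic set of n > 0 vertices sends out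
  at least n + 2 edges, so a side of a cut with at most three edges contains a cycle once it has two
  vertices. Sets of vertices, unlike components, are easily enumerated.\<close>

lemma cyclically_4_edge_connectedI:
  assumes fin: "fin_graph G"
    and cut: "\<And>B. B \<subseteq> verts G \<Longrightarrow> card (crossing G B) \<le> 3 \<Longrightarrow> card B \<le> 1 \<or> card (verts G - B) \<le> 1"
  shows "cyclically_edge_connected 4 G"
  unfolding cyclically_edge_connected_def
proof (intro allI impI notI, elim bexE conjE exE)
  fix X C D xs ys
  assume X: "X \<subseteq> edges G" "card X < 4"
    and C: "C \<in> components (del_edges G X)" "is_cycle (del_edges G X) xs" "set xs \<subseteq> C"
    and D: "D \<in> components (del_edges G X)" "is_cycle (del_edges G X) ys" "set ys \<subseteq> D"
    and ne: "C \<noteq> D"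
  have sub: "C \<subseteq> verts G" "D \<subseteq> verts G"
    using components_subset[OF C(1)] components_subset[OF D(1)] by (simp_all add: del_edges_def)
  have finv: "finite (verts G)"
    using fin by (simp add: fin_graph_def)
  have "crossing G C \<subseteq> X"
  proof
    fix e assume e: "e \<in> crossing G C"
    then obtain x y where xy: "x \<in> e" "x \<in> C" "y \<in> e" "y \<notin> C"
      unfolding crossing_def by blast
    have eG: "e \<in> edges G"
      using e by (simp add: crossing_def)
    obtain a b where "e = {a, b}"
      by (rule fin_graph_edgeE[OF fin eG])
    then have "e = {x, y}"
      using xy by auto
    show "e \<in> X"
    proof (rule ccontr)
      assume "e \<notin> X"
      then have "{x, y} \<in> edges (del_edges G X)" "y \<in> verts (del_edges G X)"
        using eG \<open>e = {x, y}\<close> fin_graph_subset[OF fin eG] by (auto simp: del_edges_def)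
      then show False
        using component_closed[OF C(1) xy(2)] xy(4) by simp
    qed
  qed
  then have "card (crossing G C) \<le> 3"
    using card_mono[of X "crossing G C"] X finite_subset[OF X(1) finite_edges[OF fin]] by simp
  then have "card C \<le> 1 \<or> card (verts G - C) \<le> 1"
    by (rule cut[OF sub(1)])
  moreover have "3 \<le> card C"
    using cycle_card[OF C(2,3)] finite_subset[OF sub(1) finv] by blast
  moreover have "D \<subseteq> verts G - C"
  proof
    fix v assume "v \<in> D"
    then show "v \<in> verts G - C"
      using component_eq[OF C(1) D(1), of v] ne sub(2) by auto
  qed
  then have "set ys \<subseteq> verts G - C"
    using D(3) by blast
  then have "3 \<le> card (verts G - C)"
    using cycle_card[OF D(2)] finv by simp
  ultimately show False
    by linarith
qed

context
  fixes A :: "nat list list"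
  assumes A: "table_ok A"
begin

lemma
  assumes "x < 22"
  shows table_distinct: "distinct (A ! x)" and table_length: "length (A ! x) = 3"
    and table_less: "y \<in> set (A ! x) \<Longrightarrow> y < 22" and table_irrefl: "x \<notin> set (A ! x)"
    and table_sym: "y \<in> set (A ! x) \<Longrightarrow> x \<in> set (A ! y)"
proof -
  have "distinct (A ! x) \<and> length (A ! x) = 3 \<and> (\<forall>y\<in>set (A ! x). y < 22 \<and> y \<noteq> x \<and> x \<in> set (A ! y))"
    using A assms unfolding table_ok_def list_all_iff set_upt by (meson atLeastLessThan_iff zero_le)
  then show "distinct (A ! x)" "length (A ! x) = 3" "y \<in> set (A ! x) \<Longrightarrow> y < 22" "x \<notin> set (A ! x)"
    "y \<in> set (A ! x) \<Longrightarrow> x \<in> set (A ! y)"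
    by blast+
qed

lemma adj_graph_edge: "{x, y} \<in> edges (adj_graph A) \<longleftrightarrow> x < 22 \<and> y \<in> set (A ! x)"
proof
  assume "{x, y} \<in> edges (adj_graph A)"
  then obtain u v where "{x, y} = {u, v}" "u < 22" "v \<in> set (A ! u)"
    by (auto simp: adj_graph_def)
  then show "x < 22 \<and> y \<in> set (A ! x)"
    using table_less[of u v] table_sym[of u v] by (auto simp: doubleton_eq_iff)
qed (auto simp: adj_graph_def)

lemma fin_adj_graph: "fin_graph (adj_graph A)"
  unfolding fin_graph_def
proof (intro conjI ballI)
  fix e assume "e \<in> edges (adj_graph A)"
  then obtain x y where e: "e = {x, y}" "x < 22" "y \<in> set (A ! x)"
    by (auto simp: adj_graph_def)
  then have "y < 22" "x \<noteq> y"
    using table_less[OF e(2,3)] table_irrefl[OF e(2)] by auto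
  then show "e \<subseteq> verts (adj_graph A)" "card e = 2"
    using e by (auto simp: adj_graph_def)
qed (simp add: adj_graph_def)

lemma nbrs_adj_graph: "v < 22 \<Longrightarrow> nbrs (adj_graph A) v = set (A ! v)"
  by (auto simp: nbrs_def adj_graph_edge)

lemma cubic_adj_graph: "cubic (adj_graph A)"
  unfolding cubic_def
proof
  fix v assume "v \<in> verts (adj_graph A)"
  then have "v < 22"
    by (simp add: adj_graph_def)
  then show "degree (adj_graph A) v = 3"
    using degree_eq_card_nbrs[OF fin_adj_graph] nbrs_adj_graph table_distinct table_length
    by (simp add: distinct_card)
qed

section \<open>Enumeration of cycles\<close>

abbreviation is_path :: "nat list \<Rightarrow> bool" where
  "is_path xs \<equiv> distinct xs \<and> set xs \<subseteq> {0..<22} \<and>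
     successively (\<lambda>x y. {x, y} \<in> edges (adj_graph A)) xs"

lemma is_path_Cons:
  assumes "p \<noteq> []"
  shows "is_path (z # p) \<longleftrightarrow> is_path p \<and> z \<notin> set p \<and> z \<in> set (A ! hd p)"
proof -
  have "{z, hd p} \<in> edges (adj_graph A) \<and> z < 22 \<longleftrightarrow> z \<in> set (A ! hd p)" if "set p \<subseteq> {0..<22}"
  proof -
    have "hd p < 22"
      using that assms by (cases p) auto
    then show ?thesis
      using table_less[of "hd p" z] table_sym[of "hd p" z] table_sym[of z "hd p"]
      by (auto simp: adj_graph_edge)
  qed
  then show ?thesis
    using assms by (auto simp: successively_Cons)
qed

lemma set_closed_extensions:
  "p \<noteq> [] \<Longrightarrow> is_path p \<Longrightarrow> set (closed_extensions A n p) =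
     {q @ p | q. length q = n \<and> is_path (q @ p) \<and> last p \<in> set (A ! hd (q @ p))}"
proof (induction n arbitrary: p)
  case 0
  then show ?case
    by simp
next
  case (Suc n)
  let ?S = "\<lambda>n p. {q @ p | q. length q = n \<and> is_path (q @ p) \<and> last p \<in> set (A ! hd (q @ p))}"
  have IH: "set (closed_extensions A n (z # p)) = ?S n (z # p)" if "z \<in> set (A ! hd p)" "z \<notin> set p" for z
    using Suc.IH[of "z # p"] is_path_Cons[OF Suc.prems(1)] Suc.prems that by blast
  show ?case
  proof (intro equalityI subsetI)
    fix xs assume "xs \<in> set (closed_extensions A (Suc n) p)"
    then obtain z where z: "z \<in> set (A ! hd p)" "z \<notin> set p" "xs \<in> set (closed_extensions A n (z # p))"
      by auto
    then obtain q where q: "xs = q @ z # p" "length q = n" "is_path (q @ z # p)"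
      "last (z # p) \<in> set (A ! hd (q @ z # p))"
      using IH by auto
    then have "xs = (q @ [z]) @ p" "length (q @ [z]) = Suc n" "is_path ((q @ [z]) @ p)"
      "last p \<in> set (A ! hd ((q @ [z]) @ p))"
      using Suc.prems(1) by simp_all
    then show "xs \<in> ?S (Suc n) p"
      by blast
  next
    fix xs assume "xs \<in> ?S (Suc n) p"
    then obtain q' where q': "xs = q' @ p" "length q' = Suc n" "is_path (q' @ p)"
      "last p \<in> set (A ! hd (q' @ p))"
      by blast
    then obtain q z where q: "q' = q @ [z]"
      by (cases q' rule: rev_cases) auto
    have "is_path (z # p)"
      using q'(3) unfolding q by (auto simp: successively_append_iff)
    then have z: "z \<in> set (A ! hd p)" "z \<notin> set p"
      using is_path_Cons[OF Suc.prems(1)] by blast+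
    have "xs = q @ z # p" "length q = n" "is_path (q @ z # p)"
      "last (z # p) \<in> set (A ! hd (q @ z # p))"
      using q' Suc.prems(1) unfolding q by simp_all
    then have "xs \<in> set (closed_extensions A n (z # p))"
      unfolding IH[OF z] by blast
    then show "xs \<in> set (closed_extensions A (Suc n) p)"
      using z by auto
  qed
qed

lemma set_cycles:
  assumes "3 \<le> n"
  shows "set (cycles A n) = {xs. is_cycle (adj_graph A) xs \<and> length xs = n}"
proof -
  have *: "xs \<in> set (closed_extensions A (n - 1) [v]) \<longleftrightarrow>
      length xs = n \<and> is_path xs \<and> last xs \<in> set (A ! hd xs) \<and> last xs = v"
    if "v \<in> set [0..<22]" for v xs
  proof -
    have v: "v < 22"
      using that unfolding set_upt by simp
    have "set (closed_extensions A (n - 1) [v]) =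
        {q @ [v] | q. length q = n - 1 \<and> is_path (q @ [v]) \<and> last [v] \<in> set (A ! hd (q @ [v]))}"
      by (rule set_closed_extensions) (use v in simp_all)
    also have "\<dots> = {xs. length xs = n \<and> is_path xs \<and> last xs \<in> set (A ! hd xs) \<and> last xs = v}"
    proof (intro equalityI subsetI)
      fix xs assume xs: "xs \<in> {xs. length xs = n \<and> is_path xs \<and> last xs \<in> set (A ! hd xs) \<and> last xs = v}"
      then have "xs \<noteq> []"
        using assms by auto
      then have "xs = butlast xs @ [v]" "length (butlast xs) = n - 1"
        using xs append_butlast_last_id[of xs] by auto
      then show "xs \<in> {q @ [v] | q. length q = n - 1 \<and> is_path (q @ [v]) \<and>
          last [v] \<in> set (A ! hd (q @ [v]))}"
        using xs by (intro CollectI exI[of _ "butlast xs"]) auto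
    qed (use assms in auto)
    finally show ?thesis
      by blast
  qed
  have edge: "last xs \<in> set (A ! hd xs) \<longleftrightarrow> {last xs, hd xs} \<in> edges (adj_graph A)"
    if "xs \<noteq> []" "set xs \<subseteq> {0..<22}" for xs
  proof -
    have "hd xs < 22"
      using that by (cases xs) auto
    then show ?thesis
      by (subst insert_commute) (simp add: adj_graph_edge)
  qed
  have ne: "xs \<noteq> []" if "length xs = n" for xs :: "nat list"
    using that assms by auto
  show ?thesis
  proof (intro equalityI subsetI)
    fix xs assume "xs \<in> set (cycles A n)"
    then obtain v where "v \<in> set [0..<22]" "xs \<in> set (closed_extensions A (n - 1) [v])"
      unfolding cycles_def set_concat set_map by blast
    then have p: "length xs = n" "is_path xs" "last xs \<in> set (A ! hd xs)"
      using * by blast+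
    then have "{last xs, hd xs} \<in> edges (adj_graph A)"
      using edge[OF ne] by blast
    then show "xs \<in> {xs. is_cycle (adj_graph A) xs \<and> length xs = n}"
      using p assms by (simp add: is_cycle_def adj_graph_def)
  next
    fix xs assume xs: "xs \<in> {xs. is_cycle (adj_graph A) xs \<and> length xs = n}"
    then have p: "length xs = n \<and> is_path xs" "{last xs, hd xs} \<in> edges (adj_graph A)"
      by (simp_all add: is_cycle_def adj_graph_def)
    then have "last xs \<in> set (A ! hd xs)" "last xs \<in> set [0..<22]"
      using edge[OF ne] last_in_set[OF ne] unfolding set_upt by blast+
    then have "xs \<in> set (closed_extensions A (n - 1) [last xs])"
      using * p(1) by blast
    then show "xs \<in> set (cycles A n)"
      using \<open>last xs \<in> set [0..<22]\<close> unfolding cycles_def set_concat set_map by blast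
  qed
qed

lemma girth_adj_graph:
  assumes "cycles A 3 = []" "cycles A 4 = []"
  shows "girth (adj_graph A) \<ge> 5"
proof -
  have "5 \<le> length xs" if xs: "is_cycle (adj_graph A) xs" for xs
  proof -
    have "3 \<le> length xs"
      using xs by (simp add: is_cycle_def)
    moreover have "length xs \<noteq> 3" "length xs \<noteq> 4"
      using xs set_cycles[of 3] set_cycles[of 4] assms by auto
    ultimately show ?thesis
      by linarith
  qed
  then show ?thesis
    using girth_ge_iff[of 5 "adj_graph A"] by (simp add: numeral_eq_enat)
qed

text \<open>The edges from \<open>v\<close> to \<open>T\<close> cross the cut. They lie inside the
  placed part as soon as \<open>v\<close> is added to \<open>S\<close>, so they leave the set of
  crossing edges still to be counted.\<close>

lemma no_cut_step:
  assumes v: "v < 22" "v \<notin> S" "v \<notin> T" and B: "v \<in> B" "T \<inter> B = {}"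
  shows "card {e \<in> crossing (adj_graph A) B. \<not> e \<subseteq> insert v S \<union> T} +
    length (filter (\<lambda>u. u \<in> T) (A ! v)) \<le> card {e \<in> crossing (adj_graph A) B. \<not> e \<subseteq> S \<union> T}"
proof -
  let ?X = "\<lambda>S. {e \<in> crossing (adj_graph A) B. \<not> e \<subseteq> S \<union> T}"
  let ?N = "(\<lambda>u. {v, u}) ` set (filter (\<lambda>u. u \<in> T) (A ! v))"
  have fin: "finite (?X S)"
    using finite_edges[OF fin_adj_graph] by (simp add: crossing_def)
  have N: "card ?N = length (filter (\<lambda>u. u \<in> T) (A ! v))"
  proof -
    have "card ?N = card (set (filter (\<lambda>u. u \<in> T) (A ! v)))"
      by (rule card_image) (auto simp: inj_on_def doubleton_eq_iff)
    then show ?thesis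
      using table_distinct[OF v(1)] by (simp add: distinct_card del: set_filter)
  qed
  have sub: "?N \<subseteq> ?X S" "?X (insert v S) \<subseteq> ?X S"
    using v B by (auto simp: crossing_def adj_graph_edge)
  have "card ?N + card (?X (insert v S)) = card (?N \<union> ?X (insert v S))"
    using finite_subset[OF sub(2) fin] by (intro card_Un_disjoint[symmetric]) auto
  also have "\<dots> \<le> card (?X S)"
    using sub by (intro card_mono[OF fin] Un_least)
  finally show ?thesis
    using N by linarith
qed

lemma crossing_compl:
  assumes "B \<subseteq> {0..<22}"
  shows "crossing (adj_graph A) ({0..<22} - B) = crossing (adj_graph A) B"
proof -
  have "e \<subseteq> {0..<22}" if "e \<in> edges (adj_graph A)" for e
    using fin_graph_subset[OF fin_adj_graph that] by (simp add: adj_graph_def)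
  then show ?thesis
    using assms unfolding crossing_def by fast
qed

text \<open>Among the branches of \<open>no_cut\<close> the one prescribed by \<open>B\<close> is
  followed; \<open>b\<close> bounds the crossing edges not yet counted. A vertex outside
  \<open>B\<close> is treated by \<open>no_cut_step\<close> for the complement, with
  \<open>S\<close> and \<open>T\<close> exchanged.\<close>

lemma no_cut_sound:
  assumes "no_cut A vs S T b" "distinct (vs @ S @ T)" "set (vs @ S @ T) = {0..<22}"
    "B \<subseteq> {0..<22}" "set S \<subseteq> B" "set T \<inter> B = {}"
    "card {e \<in> crossing (adj_graph A) B. \<not> e \<subseteq> set S \<union> set T} \<le> b"
  shows "card B \<le> 1 \<or> card ({0..<22} - B) \<le> 1"
  using assms
proof (induction vs arbitrary: S T b)
  case Nil
  then have "B = set S" "{0..<22} - B = set T"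
    by auto
  then show ?case
    using Nil.prems(1,2) by (auto simp: distinct_card)
next
  case (Cons v vs)
  have v: "v < 22" "v \<notin> set S" "v \<notin> set T"
    using Cons.prems(2,3) by auto
  have dist: "distinct (vs @ (v # S) @ T)" "distinct (vs @ S @ (v # T))"
    using Cons.prems(2) by auto
  have sets: "set (vs @ (v # S) @ T) = {0..<22}" "set (vs @ S @ (v # T)) = {0..<22}"
    using Cons.prems(3) by auto
  show ?case
  proof (cases "v \<in> B")
    case True
    let ?t = "length (filter (\<lambda>u. u \<in> set T) (A ! v))"
    have le: "card {e \<in> crossing (adj_graph A) B. \<not> e \<subseteq> set (v # S) \<union> set T} + ?t \<le> b"
      using no_cut_step[OF v True Cons.prems(6)] Cons.prems(7) by simp
    then have "?t \<le> b"
      by linarith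
    then have "no_cut A vs (v # S) T (b - ?t)"
      using Cons.prems(1) by (simp add: Let_def split: if_splits)
    then show ?thesis
    proof (rule Cons.IH[OF _ dist(1) sets(1) Cons.prems(4) _ Cons.prems(6)])
      show "set (v # S) \<subseteq> B"
        using True Cons.prems(5) by simp
      show "card {e \<in> crossing (adj_graph A) B. \<not> e \<subseteq> set (v # S) \<union> set T} \<le> b - ?t"
        using le by linarith
    qed
  next
    case False
    let ?s = "length (filter (\<lambda>u. u \<in> set S) (A ! v))"
    let ?B = "{0..<22} - B"
    have "v \<in> ?B" "set S \<inter> ?B = {}"
      using v(1) False Cons.prems(5) by auto
    then have "card {e \<in> crossing (adj_graph A) ?B. \<not> e \<subseteq> insert v (set T) \<union> set S} + ?s \<le>
        card {e \<in> crossing (adj_graph A) ?B. \<not> e \<subseteq> set T \<union> set S}"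
      by (rule no_cut_step[OF v(1,3,2)])
    then have le: "card {e \<in> crossing (adj_graph A) B. \<not> e \<subseteq> set S \<union> set (v # T)} + ?s \<le> b"
      using Cons.prems(7) unfolding crossing_compl[OF Cons.prems(4)] by (simp add: Un_commute)
    then have "?s \<le> b"
      by linarith
    then have "no_cut A vs S (v # T) (b - ?s)"
      using Cons.prems(1) by (simp add: Let_def split: if_splits)
    then show ?thesis
    proof (rule Cons.IH[OF _ dist(2) sets(2) Cons.prems(4,5)])
      show "set (v # T) \<inter> B = {}"
        using False Cons.prems(6) by simp
      show "card {e \<in> crossing (adj_graph A) B. \<not> e \<subseteq> set S \<union> set (v # T)} \<le> b - ?s"
        using le by linarith
    qed
  qed
qed

lemma snark_adj_graph:
  assumes "cycles A 3 = []" "cycles A 4 = []"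
    and "no_cut A vs [] [] 3" "distinct vs" "set vs = {0..<22}"
    and "\<not> colorable es [] [] []" "distinct es" "list_all (\<lambda>(x, y). x < y \<and> x < 22 \<and> y \<in> set (A ! x)) es"
  shows "snark (adj_graph A)"
  unfolding snark_def
proof (intro conjI)
  show "cyclically_edge_connected 4 (adj_graph A)"
  proof (rule cyclically_4_edge_connectedI[OF fin_adj_graph])
    fix B assume "B \<subseteq> verts (adj_graph A)" and c: "card (crossing (adj_graph A) B) \<le> 3"
    then have B: "B \<subseteq> {0..<22}"
      by (simp add: adj_graph_def)
    have "{e \<in> crossing (adj_graph A) B. \<not> e \<subseteq> set [] \<union> set []} = crossing (adj_graph A) B"
      by (auto simp: crossing_def)
    then show "card B \<le> 1 \<or> card (verts (adj_graph A) - B) \<le> 1"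
      using no_cut_sound[OF assms(3) _ _ B] assms(4,5) c by (simp add: adj_graph_def)
  qed
  show "\<nexists>c. proper_edge_coloring 3 (adj_graph A) c"
  proof
    assume "\<exists>c. proper_edge_coloring 3 (adj_graph A) c"
    then obtain f where "proper_edge_coloring 3 (adj_graph A) f" ..
    then have "colorable es [] [] []"
    proof (rule colorable_complete)
      show "\<forall>(x, y)\<in>set ([] @ es). {x, y} \<in> edges (adj_graph A) \<and> x < y"
        using assms(8) by (auto simp: list_all_iff adj_graph_edge)
    qed (use assms(7) in simp_all)
    then show False
      using assms(6) by blast
  qed
qed (use fin_adj_graph cubic_adj_graph girth_adj_graph[OF assms(1,2)] in simp_all)

end

section \<open>The tree in standard form\<close>

definition std_tree :: "nat ugraph" where
  "std_tree = \<lparr>verts = {0..<22}, edges = tree_edges\<rparr>"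

lemma tree_edges_iff: "{x, y} \<in> tree_edges \<longleftrightarrow>
    x \<in> {1..<22} \<and> y = parent x \<or> y \<in> {1..<22} \<and> x = parent y"
  by (auto simp: tree_edges_def doubleton_eq_iff)

lemma fin_std_tree: "fin_graph std_tree"
  unfolding fin_graph_def
proof (intro conjI ballI)
  fix e assume "e \<in> edges std_tree"
  then obtain n where n: "n \<in> {1..<22}" "e = {parent n, n}"
    by (auto simp: std_tree_def tree_edges_def)
  then have "parent n < n"
    using parent_less by simp
  then show "e \<subseteq> verts std_tree" "card e = 2"
    using n by (auto simp: std_tree_def)
qed (simp add: std_tree_def)

lemma std_tree_walk: "n < 22 \<Longrightarrow> \<exists>xs. walk std_tree 0 xs n"
proof (induction n rule: less_induct)
  case (less n)
  show ?case
  proof (cases "n = 0")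
    case True
    then show ?thesis
      by (intro exI[of _ "[0]"]) (simp add: walk_def std_tree_def)
  next
    case False
    then obtain xs where "walk std_tree 0 xs (parent n)"
      using less.IH[of "parent n"] parent_less[of n] less.prems by auto
    then show ?thesis
      using walk_append[of std_tree 0 xs "parent n" n] False less.prems
      by (intro exI[of _ "xs @ [n]"]) (simp add: std_tree_def tree_edges_iff)
  qed
qed

lemma is_tree_std_tree: "is_tree std_tree"
  unfolding is_tree_def
proof (intro conjI)
  show "connected_graph std_tree"
    unfolding connected_graph_def
  proof (intro conjI ballI)
    fix u v assume "u \<in> verts std_tree" "v \<in> verts std_tree"
    then obtain xs ys where "walk std_tree 0 xs u" "walk std_tree 0 ys v"
      using std_tree_walk by (force simp: std_tree_def)
    then have "walk std_tree u (rev xs @ tl ys) v"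
      by (intro walk_join[OF walk_rev])
    then show "\<exists>xs. walk std_tree u xs v" ..
  qed (simp add: std_tree_def)
  show "\<nexists>xs. is_cycle std_tree xs"
  proof
    assume "\<exists>xs. is_cycle std_tree xs"
    then obtain xs where xs: "is_cycle std_tree xs" ..
    have d: "distinct xs" "3 \<le> length xs"
      using xs by (simp_all add: is_cycle_def)
    have cyc: "cyc (\<lambda>x y. {x, y} \<in> tree_edges) xs"
      using xs by (intro cyc_of_path) (simp_all add: is_cycle_def std_tree_def)
    \<comment> \<open>The largest number on a cycle would have two distinct smaller neighbours, but
      only its parent is one.\<close>
    define m where "m = Max (set xs)"
    have m: "m \<in> set xs" "\<And>x. x \<in> set xs \<Longrightarrow> x \<le> m"
      unfolding m_def using d(2) by (auto intro!: Max_in)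
    obtain a b where ab: "(m, a) \<in> cpairs xs" "(b, m) \<in> cpairs xs" "a \<noteq> b" "a \<in> set xs" "b \<in> set xs"
      using cyc_neighbours[OF d m(1)] by metis
    have "x = parent m" if x: "x \<in> set xs" "{x, m} \<in> tree_edges" for x
      using x(2) m(2)[OF x(1)] parent_less[of x] by (auto simp: tree_edges_iff)
    moreover have "{m, a} \<in> tree_edges" "{b, m} \<in> tree_edges"
      using cyc ab(1,2) by (auto simp: cyc_def)
    ultimately show False
      using ab(3-5) by (metis insert_commute)
  qed
qed (rule fin_std_tree)

lemma degree_std_tree:
  assumes "n < 22"
  shows "degree std_tree n = (if n < 10 then 3 else 1)"
proof (cases "n < 10")
  case True
  then show ?thesis
    using card_tree_edges_inner by (simp add: degree_def std_tree_def)
next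
  case False
  have "{e \<in> tree_edges. n \<in> e} = {{parent n, n}}"
  proof (intro equalityI subsetI)
    fix e assume "e \<in> {e \<in> tree_edges. n \<in> e}"
    then obtain m where m: "m \<in> {1..<22}" "e = {parent m, m}" "n = parent m \<or> n = m"
      by (auto simp: tree_edges_def)
    then show "e \<in> {{parent n, n}}"
      using parent_less_10[of m] False by auto
  next
    fix e assume "e \<in> {{parent n, n}}"
    then show "e \<in> {e \<in> tree_edges. n \<in> e}"
      using assms False by (auto simp: tree_edges_def)
  qed
  then show ?thesis
    using False by (simp add: degree_def std_tree_def)
qed

text \<open>\<open>level\<close> changes by one along every tree edge. Climbing to the root bounds
  the distance from above, and induction on the distance bounds it from below.\<close>

lemma dst_std_tree:
  assumes "n < 22"
  shows "dst std_tree 0 n = level n"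
proof (rule antisym)
  have r: "0 \<in> verts std_tree"
    by (simp add: std_tree_def)
  note dst = dst_edge[OF is_tree_std_tree r] parent_ex[OF is_tree_std_tree r]
    dst_0[OF is_tree_std_tree r] dst_root[OF is_tree_std_tree r]
  have level_parent: "level n = Suc (level (parent n))" if "n \<in> {1..<22}" for n
    using that by (auto simp: level_def parent_def)
  show "dst std_tree 0 n \<le> level n"
    using assms
  proof (induction n rule: less_induct)
    case (less n)
    show ?case
    proof (cases "n = 0")
      case False
      then have n: "n \<in> {1..<22}" "parent n < n"
        using less.prems parent_less by auto
      then have "{parent n, n} \<in> edges std_tree"
        by (simp add: std_tree_def tree_edges_iff)
      then have "dst std_tree 0 n \<le> Suc (dst std_tree 0 (parent n))"
        by (rule dst(1))
      then show ?thesis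
        using less.IH[OF n(2)] n level_parent[OF n(1)] by simp
    qed (simp add: dst(4))
  qed
  show "level n \<le> dst std_tree 0 n"
    using assms
  proof (induction "dst std_tree 0 n" arbitrary: n)
    case 0
    then have "n = 0"
      using dst(3)[of n] by (simp add: std_tree_def)
    then show ?case
      by (simp add: level_def)
  next
    case (Suc k)
    have "n \<noteq> 0"
    proof
      assume "n = 0"
      then show False
        using Suc.hyps(2) dst(4) by simp
    qed
    moreover have "n \<in> verts std_tree"
      using Suc.prems by (simp add: std_tree_def)
    ultimately obtain u where u: "{u, n} \<in> edges std_tree" "dst std_tree 0 n = Suc (dst std_tree 0 u)"
      using dst(2)[of n] by blast
    then have "u < 22"
      using fin_graph_edge(1)[OF fin_std_tree u(1)] by (simp add: std_tree_def)
    then have "level u \<le> dst std_tree 0 u"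
      using Suc.hyps u(2) by simp
    moreover have "level n \<le> Suc (level u)"
      using u(1) level_parent[of n] level_parent[of u] by (auto simp: std_tree_def tree_edges_iff)
    ultimately show ?case
      using u(2) by simp
  qed
qed

lemma is_T3_std_tree: "is_T3 std_tree"
  unfolding is_T3_def
proof (intro conjI bexI[of _ 0] ballI impI)
  have r: "0 \<in> verts std_tree"
    by (simp add: std_tree_def)
  show "is_tree std_tree" "0 \<in> verts std_tree" "degree std_tree 0 = 3"
    using is_tree_std_tree r degree_std_tree[of 0] by simp_all
  show "degree std_tree v \<in> {1, 3}" if "v \<in> verts std_tree" for v
    using degree_std_tree[of v] that by (simp add: std_tree_def)
  show "graph_dist std_tree 0 l = 3" if l: "l \<in> verts std_tree" "degree std_tree l = 1" for l
  proof -
    have "l < 22"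
      using l(1) by (simp add: std_tree_def)
    then have "\<not> l < 10"
      using l(2) degree_std_tree[of l] by auto
    then have "level l = 3"
      by (simp add: level_def)
    then show ?thesis
      using graph_dist_eq[OF is_tree_std_tree r l(1)] dst_std_tree[OF \<open>l < 22\<close>]
      by (simp add: numeral_eq_enat)
  qed
qed

lemma T3_snark_adj_graph:
  assumes "table_ok A" "snark (adj_graph A)" "list_all (\<lambda>n. n \<in> set (A ! parent n)) [1..<22]"
  shows "T3_snark (adj_graph A)"
proof -
  have "tree_edges \<subseteq> edges (adj_graph A)"
  proof
    fix e assume "e \<in> tree_edges"
    then obtain n where n: "n \<in> {1..<22}" "e = {parent n, n}"
      by (auto simp: tree_edges_def)
    then have "n \<in> set (A ! parent n)" "parent n < 22"
      using assms(3) parent_less_10[of n] unfolding list_all_iff set_upt by auto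
    then show "e \<in> edges (adj_graph A)"
      using adj_graph_edge[OF assms(1)] n(2) by simp
  qed
  then have "spanning_tree std_tree (adj_graph A)"
    using is_tree_std_tree by (simp add: spanning_tree_def std_tree_def adj_graph_def)
  then show ?thesis
    unfolding T3_snark_def using assms(2) is_T3_std_tree by blast
qed

section \<open>The three snarks\<close>

text \<open>
  Adjacency table, order of the vertices for \<open>no_cut\<close>, order of the edges for \<open>colorable\<close>, and the
  number of 6-cycles, each counted 12 times (starting point and direction).
\<close>

definition snark_data :: "(nat list list \<times> nat list \<times> (nat \<times> nat) list \<times> nat) list" where
  "snark_data = [
    ([
      [1, 2, 3], [0, 4, 5], [0, 6, 7], [0, 8, 9], [1, 10, 11], [1, 12, 13], [2, 14, 15],
      [2, 16, 17], [3, 18, 19], [3, 20, 21], [4, 12, 17], [4, 13, 14], [5, 10, 14],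
      [5, 11, 16], [6, 11, 12], [6, 19, 20], [7, 13, 18], [7, 10, 21], [8, 16, 20],
      [8, 15, 21], [9, 15, 18], [9, 17, 19]],
      [
      0, 1, 4, 10, 12, 5, 13, 11, 14, 6, 2, 7, 16, 17, 21, 9, 3, 8, 18, 20, 15, 19],
      [
      (10,12), (10,17), (4,10), (4,11), (1,4), (0,1), (1,5), (5,12), (5,13), (12,14), (11,14),
      (11,13), (13,16), (6,14), (6,15), (2,6), (0,2), (0,3), (2,7), (7,17), (7,16), (16,18),
      (17,21), (18,20), (8,18), (3,8), (3,9), (8,19), (9,20), (9,21), (15,20), (15,19), (19,21)],
      48),
    ([
      [1, 2, 3], [0, 4, 5], [0, 6, 7], [0, 8, 9], [1, 10, 11], [1, 12, 13], [2, 14, 15],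
      [2, 16, 17], [3, 18, 19], [3, 20, 21], [4, 12, 20], [4, 13, 17], [5, 10, 14],
      [5, 11, 19], [6, 12, 16], [6, 17, 21], [7, 14, 18], [7, 11, 15], [8, 16, 20],
      [8, 13, 21], [9, 10, 18], [9, 15, 19]],
      [
      0, 1, 4, 10, 12, 5, 13, 11, 17, 7, 2, 6, 14, 16, 15, 21, 19, 8, 3, 9, 20, 18],
      [
      (10,12), (10,20), (4,10), (4,11), (1,4), (0,1), (1,5), (5,12), (5,13), (12,14), (11,13),
      (11,17), (13,19), (14,16), (6,14), (6,15), (2,6), (0,2), (0,3), (2,7), (7,17), (7,16),
      (15,17), (15,21), (16,18), (18,20), (8,18), (9,20), (3,9), (3,8), (8,19), (9,21), (19,21)],
      60),
    ([
      [1, 2, 3], [0, 4, 5], [0, 6, 7], [0, 8, 9], [1, 10, 11], [1, 12, 13], [2, 14, 15],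
      [2, 16, 17], [3, 18, 19], [3, 20, 21], [4, 12, 19], [4, 13, 17], [5, 10, 14],
      [5, 11, 20], [6, 12, 16], [6, 17, 21], [7, 14, 18], [7, 11, 15], [8, 16, 20],
      [8, 10, 21], [9, 13, 18], [9, 15, 19]],
      [
      0, 1, 4, 10, 12, 5, 13, 11, 17, 7, 2, 6, 14, 16, 15, 21, 19, 8, 3, 9, 20, 18],
      [
      (10,12), (4,10), (10,19), (4,11), (1,4), (0,1), (1,5), (5,12), (5,13), (12,14), (11,13),
      (11,17), (13,20), (14,16), (6,14), (6,15), (2,6), (0,2), (0,3), (2,7), (7,17), (7,16),
      (15,17), (15,21), (16,18), (18,20), (8,18), (9,20), (3,9), (3,8), (8,19), (9,21), (19,21)],
      36)]"

lemma snark_data_ok: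
  "list_all (\<lambda>(A, vs, es, n). table_ok A \<and> cycles A 3 = [] \<and> cycles A 4 = [] \<and>
     no_cut A vs [] [] 3 \<and> distinct vs \<and> set vs = set [0..<22] \<and>
     \<not> colorable es [] [] [] \<and> distinct es \<and>
     list_all (\<lambda>(x, y). x < y \<and> x < 22 \<and> y \<in> set (A ! x)) es \<and>
     list_all (\<lambda>n. n \<in> set (A ! parent n)) [1..<22] \<and>
     length (remdups (cycles A 6)) = n) snark_data"
  by code_simp

definition T3_graph :: "nat \<Rightarrow> nat ugraph" where
  "T3_graph i = adj_graph (fst (snark_data ! i))"

lemma snark_data_mem:
  assumes "(A, vs, es, n) \<in> set snark_data"
  shows "table_ok A" "T3_snark (adj_graph A)"
    "card {xs. is_cycle (adj_graph A) xs \<and> length xs = 6} = n"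
proof -
  have ok: "table_ok A \<and> cycles A 3 = [] \<and> cycles A 4 = [] \<and>
     no_cut A vs [] [] 3 \<and> distinct vs \<and> set vs = set [0..<22] \<and>
     \<not> colorable es [] [] [] \<and> distinct es \<and>
     list_all (\<lambda>(x, y). x < y \<and> x < 22 \<and> y \<in> set (A ! x)) es \<and>
     list_all (\<lambda>n. n \<in> set (A ! parent n)) [1..<22] \<and>
     length (remdups (cycles A 6)) = n"
    using bspec[OF snark_data_ok[unfolded list_all_iff[of _ snark_data]] assms] unfolding prod.case .
  then show A: "table_ok A"
    by (elim conjE)
  have "snark (adj_graph A)"
    by (rule snark_adj_graph[OF A, of vs es]) (use ok in \<open>simp_all only: set_upt simp_thms\<close>)
  then show "T3_snark (adj_graph A)"
    using ok by (intro T3_snark_adj_graph[OF A]) simp_all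
  have "card (set (cycles A 6)) = n"
    using ok by (simp add: length_remdups_card_conv)
  then show "card {xs. is_cycle (adj_graph A) xs \<and> length xs = 6} = n"
    using set_cycles[OF A, of 6] by simp
qed

lemma snark_data_nth: "i < 3 \<Longrightarrow> \<exists>vs es. (fst (snark_data ! i), vs, es, [48, 60, 36] ! i) \<in> set snark_data"
proof -
  assume "i < 3"
  then have "i = 0 \<or> i = 1 \<or> i = 2"
    by arith
  then show ?thesis
    by (elim disjE) (simp_all add: snark_data_def)
qed

lemma
  assumes "i < 3"
  shows T3_graph_snark: "T3_snark (T3_graph i)"
    and card_6_cycles: "card {xs. is_cycle (T3_graph i) xs \<and> length xs = 6} = [48, 60, 36] ! i"
    and T3_graph_table: "table_ok (fst (snark_data ! i))"
  using snark_data_nth[OF assms] snark_data_mem unfolding T3_graph_def by blast+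

lemma T3_graph_not_iso:
  assumes "i < 3" "j < 3" "i \<noteq> j"
  shows "\<not> graph_iso (T3_graph i) (T3_graph j)"
proof
  assume iso: "graph_iso (T3_graph i) (T3_graph j)"
  have "fin_graph (T3_graph i)"
    using T3_graph_snark[OF assms(1)] by (simp add: T3_snark_def snark_def)
  then have "[48, 60, 36] ! i = [48, 60, 36 :: nat] ! j"
    using card_cycles_iso[OF iso, of 6] card_6_cycles assms(1,2) by simp
  then show False
    using assms by (auto simp: less_Suc_eq numeral_3_eq_3)
qed

section \<open>The uncolourable leaf graphs\<close>

definition word_edges :: "leaf list list \<Rightarrow> (nat \<times> nat) list" where
  "word_edges w = map (\<lambda>n. (parent n, n)) [1..<22] @
     concat (map (\<lambda>d. map (\<lambda>(u, v). (vtx u, vtx v)) (zip d (rotate1 d))) w)"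

text \<open>By \<open>complete_E_iff\<close> the cycles exhaust the leaf relation, so the word alone
  determines the graph and checks can be evaluated on it.\<close>

lemma edges_leaf_graph:
  assumes "leaf_rel E" "leaf_cycles E w"
  shows "edges (leaf_graph E) = (\<lambda>(x, y). {x, y}) ` set (word_edges w)"
proof -
  have "{{vtx u, vtx v} |u v. E u v} = (\<Union>d\<in>set w. (\<lambda>(u, v). {vtx u, vtx v}) ` cpairs d)"
    (is "?L = ?R")
  proof (intro equalityI subsetI)
    fix e assume "e \<in> ?L"
    then obtain u v where e: "e = {vtx u, vtx v}" "E u v"
      by blast
    then obtain d where "d \<in> set w" "(u, v) \<in> cpairs d \<or> (v, u) \<in> cpairs d"
      using complete_E_iff[OF assms] by blast
    then show "e \<in> ?R"
      unfolding e(1) by (force simp: insert_commute)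
  next
    fix e assume "e \<in> ?R"
    then obtain d u v where "d \<in> set w" "(u, v) \<in> cpairs d" "e = {vtx u, vtx v}"
      by auto
    then show "e \<in> ?L"
      using complete_E_iff[OF assms, of u v] by blast
  qed
  moreover have "(\<lambda>(x, y). {x, y}) ` set (word_edges w) =
      tree_edges \<union> (\<Union>d\<in>set w. (\<lambda>(u, v). {vtx u, vtx v}) ` cpairs d)"
    unfolding word_edges_def tree_edges_def cpairs_def set_append image_Un set_map set_concat
      image_UN image_image set_upt by (simp add: case_prod_unfold)
  ultimately show ?thesis
    by (simp add: leaf_graph_def)
qed

text \<open>
  \<open>Iso i f\<close>: \<open>f\<close> is an isomorphism onto the \<open>i\<close>-th of the three snarks. \<open>Cut S xs ys\<close>: at most
  three edges leave \<open>S\<close>, and \<open>xs\<close>, \<open>ys\<close> are cycles inside and outside \<open>S\<close>.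
\<close>

datatype cert = Iso nat "nat list" | Cut "nat list" "nat list" "nat list"

definition cycle_in :: "(nat \<times> nat) list \<Rightarrow> nat list \<Rightarrow> bool" where
  "cycle_in es p \<longleftrightarrow> length p \<ge> 3 \<and> distinct p \<and> list_all (\<lambda>x. x < 22) p \<and>
     list_all (\<lambda>(x, y). (x, y) \<in> set es \<or> (y, x) \<in> set es) (zip p (rotate1 p))"

fun check :: "leaf list list \<Rightarrow> cert \<Rightarrow> bool" where
  "check w (Iso i f) \<longleftrightarrow> i < 3 \<and> length f = 22 \<and> distinct f \<and> list_all (\<lambda>x. x < 22) f \<and>
     list_all (\<lambda>(x, y). f ! y \<in> set (fst (snark_data ! i) ! (f ! x))) (word_edges w)"
| "check w (Cut S xs ys) \<longleftrightarrow> cycle_in (word_edges w) xs \<and> cycle_in (word_edges w) ys \<and>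
     list_all (\<lambda>x. x \<in> set S) xs \<and> list_all (\<lambda>x. x \<notin> set S) ys \<and>
     length (filter (\<lambda>(x, y). (x \<in> set S) \<noteq> (y \<in> set S)) (word_edges w)) \<le> 3"

text \<open>Each table in \<open>snark_data\<close> is the leaf graph of the first word certified
  for its index, whence the identity permutations. Some words differ only in the direction of a
  cycle, like the first two certified by \<open>Iso 1\<close>.\<close>

definition certs :: "(leaf list list \<times> cert) list" where
  "certs = [
    ([[L11, L9, L7, L10, L8, L6], [L5, L3, L1, L4, L2, L0]],
      Cut [7, 8, 9, 16, 17, 18, 19, 20, 21] [7, 16, 18, 20, 17] [1, 4, 10, 12, 5]),
    ([[L11, L9, L7, L10, L8, L5], [L6, L3, L1, L4, L2, L0]],
      Cut [3, 8, 9, 15, 17, 18, 19, 20, 21] [3, 8, 18, 20, 9] [1, 4, 10, 12, 5]),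
    ([[L7, L11, L9, L5, L10, L8, L6, L3, L1, L4, L2, L0]],
      Iso 0 [0, 1, 2, 3, 4, 5, 6, 7, 8, 9, 10, 11, 12, 13, 14, 15, 16, 17, 18, 19, 20, 21]),
    ([[L11, L7, L9, L10, L6, L5], [L8, L3, L1, L4, L2, L0]],
      Cut [1, 4, 5, 10, 11, 12, 13, 14, 18] [1, 4, 10, 12, 5] [2, 6, 15, 16, 7]),
    ([[L7, L11, L9, L6, L10, L5], [L8, L3, L1, L4, L2, L0]],
      Cut [1, 4, 5, 10, 11, 12, 13, 14, 18] [1, 4, 10, 12, 5] [2, 6, 15, 17, 7]),
    ([[L11, L9, L7, L10, L8, L3], [L5, L6, L1, L4, L2, L0]],
      Cut [3, 8, 9, 13, 17, 18, 19, 20, 21] [3, 8, 18, 20, 9] [1, 4, 10, 12, 5]),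
    ([[L11, L9, L7, L10, L8, L1], [L5, L3, L6, L4, L2, L0]],
      Cut [3, 8, 9, 11, 17, 18, 19, 20, 21] [3, 8, 18, 20, 9] [1, 4, 10, 12, 5]),
    ([[L7, L5, L11, L9, L3, L1], [L10, L8, L6, L4, L2, L0]],
      Iso 1 [0, 1, 2, 3, 4, 5, 6, 7, 8, 9, 10, 11, 12, 13, 14, 15, 16, 17, 18, 19, 20, 21]),
    ([[L3, L9, L11, L5, L7, L1], [L10, L8, L6, L4, L2, L0]],
      Iso 1 [0, 1, 2, 3, 4, 5, 6, 7, 8, 9, 10, 11, 12, 13, 14, 15, 16, 17, 18, 19, 20, 21]),
    ([[L9, L11, L5, L7, L1, L3, L10, L8, L6, L4, L2, L0]],
      Iso 2 [0, 1, 2, 3, 4, 5, 6, 7, 8, 9, 10, 11, 12, 13, 14, 15, 16, 17, 18, 19, 20, 21]),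
    ([[L7, L3, L1, L5, L11, L9, L6, L10, L8, L4, L2, L0]],
      Iso 0 [0, 1, 2, 3, 4, 5, 7, 6, 8, 9, 11, 10, 13, 12, 16, 17, 15, 14, 18, 19, 20, 21]),
    ([[L11, L9, L7, L10, L8, L6], [L3, L5, L1, L2, L4, L0]],
      Cut [7, 8, 9, 16, 17, 18, 19, 20, 21] [7, 16, 18, 20, 17] [1, 4, 10, 13, 5]),
    ([[L11, L9, L7, L10, L8, L3], [L6, L5, L1, L2, L4, L0]],
      Cut [3, 8, 9, 13, 17, 18, 19, 20, 21] [3, 8, 18, 20, 9] [1, 4, 11, 12, 5]),
    ([[L11, L9, L7, L10, L8, L5], [L3, L6, L1, L2, L4, L0]],
      Cut [3, 8, 9, 15, 17, 18, 19, 20, 21] [3, 8, 18, 20, 9] [1, 4, 10, 13, 5]),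
    ([[L3, L7, L11, L9, L5, L10, L8, L6, L1, L2, L4, L0]],
      Iso 0 [0, 1, 2, 3, 4, 5, 6, 7, 9, 8, 11, 10, 12, 13, 14, 15, 17, 16, 21, 20, 19, 18]),
    ([[L11, L7, L9, L10, L6, L5], [L3, L8, L1, L2, L4, L0]],
      Cut [1, 4, 5, 10, 11, 12, 13, 14, 18] [1, 4, 10, 13, 5] [2, 6, 15, 16, 7]),
    ([[L7, L11, L9, L6, L10, L5], [L3, L8, L1, L2, L4, L0]],
      Cut [1, 4, 5, 10, 11, 12, 13, 14, 18] [1, 4, 10, 13, 5] [2, 6, 15, 17, 7]),
    ([[L11, L9, L7, L10, L8, L1], [L3, L5, L6, L2, L4, L0]],
      Cut [3, 8, 9, 11, 17, 18, 19, 20, 21] [3, 8, 18, 20, 9] [1, 4, 10, 13, 5]),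
    ([[L11, L9, L5, L10, L8, L3], [L7, L2, L1, L6, L4, L0]],
      Cut [3, 8, 9, 13, 15, 18, 19, 20, 21] [3, 8, 18, 20, 9] [1, 4, 11, 12, 5]),
    ([[L11, L9, L7, L10, L8, L3], [L2, L5, L1, L6, L4, L0]],
      Cut [3, 8, 9, 13, 17, 18, 19, 20, 21] [3, 8, 18, 20, 9] [1, 4, 10, 12, 5]),
    ([[L11, L9, L3, L10, L8, L2], [L7, L5, L1, L6, L4, L0]],
      Cut [5, 8, 9, 12, 13, 18, 19, 20, 21] [5, 12, 18, 20, 13] [2, 6, 14, 16, 7]),
    ([[L11, L9, L3, L10, L8, L1], [L7, L5, L2, L6, L4, L0]],
      Cut [3, 8, 9, 11, 13, 18, 19, 20, 21] [3, 8, 18, 20, 9] [2, 6, 14, 16, 7]),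
    ([[L11, L9, L3, L10, L8, L1, L7, L5, L2, L6, L4, L0]],
      Iso 0 [0, 2, 1, 3, 7, 6, 4, 5, 8, 9, 17, 16, 14, 15, 10, 11, 12, 13, 18, 19, 20, 21]),
    ([[L7, L5, L3, L11, L9, L1, L10, L8, L2, L6, L4, L0]],
      Iso 0 [0, 2, 1, 3, 6, 7, 4, 5, 8, 9, 14, 15, 16, 17, 11, 10, 13, 12, 18, 19, 20, 21]),
    ([[L11, L3, L9, L10, L2, L1], [L7, L5, L8, L6, L4, L0]],
      Cut [2, 6, 7, 10, 14, 15, 16, 17, 18] [2, 6, 14, 16, 7] [1, 4, 11, 12, 5]),
    ([[L3, L11, L9, L2, L10, L1], [L7, L5, L8, L6, L4, L0]],
      Cut [2, 6, 7, 10, 14, 15, 16, 17, 18] [2, 6, 14, 16, 7] [1, 4, 11, 13, 5]),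
    ([[L3, L9, L11, L5, L7, L2, L1, L10, L8, L6, L4, L0]],
      Iso 2 [0, 1, 2, 3, 4, 5, 7, 6, 9, 8, 11, 10, 12, 13, 17, 16, 15, 14, 21, 20, 19, 18]),
    ([[L9, L11, L5, L7, L3, L1], [L2, L10, L8, L6, L4, L0]],
      Iso 1 [0, 1, 2, 3, 4, 5, 7, 6, 9, 8, 11, 10, 13, 12, 17, 16, 15, 14, 21, 20, 19, 18]),
    ([[L3, L7, L5, L11, L9, L1], [L2, L10, L8, L6, L4, L0]],
      Iso 1 [0, 1, 2, 3, 4, 5, 7, 6, 9, 8, 11, 10, 13, 12, 17, 16, 15, 14, 21, 20, 19, 18]),
    ([[L11, L7, L3, L10, L6, L2], [L9, L5, L1, L8, L4, L0]],
      Cut [5, 7, 9, 12, 13, 16, 17, 20, 21] [5, 12, 16, 20, 13] [4, 10, 14, 18, 11]),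
    ([[L7, L11, L3, L6, L10, L2], [L9, L5, L1, L8, L4, L0]],
      Cut [5, 7, 9, 12, 13, 16, 17, 20, 21] [5, 12, 20, 16, 13] [4, 10, 14, 18, 11]),
    ([[L11, L7, L3, L9, L6, L2], [L10, L5, L1, L8, L4, L0]],
      Iso 0 [2, 0, 6, 7, 1, 3, 14, 15, 16, 17, 4, 5, 9, 8, 11, 12, 20, 19, 13, 18, 10, 21]),
    ([[L9, L7, L3, L11, L6, L2], [L10, L5, L1, L8, L4, L0]],
      Iso 0 [2, 0, 6, 7, 1, 3, 14, 15, 16, 17, 4, 5, 8, 9, 11, 12, 19, 20, 13, 18, 10, 21]),
    ([[L7, L11, L3, L6, L9, L2], [L10, L5, L1, L8, L4, L0]],
      Iso 0 [2, 0, 6, 7, 1, 3, 14, 15, 16, 17, 4, 5, 8, 9, 11, 12, 20, 19, 13, 18, 10, 21]),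
    ([[L7, L9, L3, L6, L11, L2], [L10, L5, L1, L8, L4, L0]],
      Iso 0 [2, 0, 6, 7, 1, 3, 14, 15, 16, 17, 4, 5, 9, 8, 11, 12, 19, 20, 13, 18, 10, 21]),
    ([[L11, L7, L3, L10, L5, L2], [L9, L6, L1, L8, L4, L0]],
      Iso 0 [2, 0, 7, 6, 1, 3, 16, 17, 14, 15, 5, 4, 8, 9, 13, 18, 10, 21, 11, 12, 20, 19]),
    ([[L11, L5, L3, L10, L7, L2], [L9, L6, L1, L8, L4, L0]],
      Iso 0 [2, 0, 7, 6, 1, 3, 16, 17, 14, 15, 5, 4, 9, 8, 13, 18, 10, 21, 11, 12, 19, 20]),
    ([[L7, L11, L3, L5, L10, L2], [L9, L6, L1, L8, L4, L0]],
      Iso 0 [2, 0, 7, 6, 1, 3, 16, 17, 14, 15, 5, 4, 9, 8, 13, 18, 10, 21, 11, 12, 20, 19]),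
    ([[L5, L11, L3, L7, L10, L2], [L9, L6, L1, L8, L4, L0]],
      Iso 0 [2, 0, 7, 6, 1, 3, 16, 17, 14, 15, 5, 4, 8, 9, 13, 18, 10, 21, 11, 12, 19, 20]),
    ([[L11, L7, L3, L10, L6, L1], [L9, L5, L2, L8, L4, L0]],
      Iso 0 [2, 7, 0, 6, 16, 17, 1, 3, 14, 15, 13, 18, 10, 21, 5, 4, 8, 9, 12, 11, 19, 20]),
    ([[L7, L11, L3, L6, L10, L1], [L9, L5, L2, L8, L4, L0]],
      Iso 0 [2, 7, 0, 6, 16, 17, 1, 3, 14, 15, 13, 18, 10, 21, 5, 4, 9, 8, 12, 11, 20, 19]),
    ([[L3, L7, L1, L2, L5, L11, L9, L6, L10, L8, L4, L0]],
      Iso 0 [0, 1, 2, 3, 4, 5, 7, 6, 9, 8, 10, 11, 13, 12, 17, 16, 15, 14, 21, 20, 19, 18])]"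

lemma certs_ok: "list_all (\<lambda>(w, c). check w c) certs"
  by code_simp

lemma uncolored_eq: "uncolored = map fst certs"
  by code_simp

text \<open>The images of the three neighbours of a vertex are three neighbours of its image, hence
  all of them. A bijection that preserves edges between cubic graphs therefore also reflects
  them.\<close>

lemma iso_of_embedding:
  assumes fin: "fin_graph G" "fin_graph H" and cub: "cubic G" "cubic H"
    and f: "bij_betw f (verts G) (verts H)"
    and E: "\<And>x y. {x, y} \<in> edges G \<Longrightarrow> {f x, f y} \<in> edges H"
  shows "graph_iso G H"
proof -
  have inj: "inj_on f (verts G)" and im: "verts H = f ` verts G"
    using f by (auto simp: bij_betw_def)
  have nb: "nbrs H (f x) = f ` nbrs G x" if x: "x \<in> verts G" for x
  proof -
    have sub: "nbrs G x \<subseteq> verts G"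
      using fin_graph_edge(2)[OF fin(1)] by (auto simp: nbrs_def)
    have "card (nbrs G x) = 3" "card (nbrs H (f x)) = 3"
      using cub x im degree_eq_card_nbrs[OF fin(1), of x] degree_eq_card_nbrs[OF fin(2), of "f x"]
      by (auto simp: cubic_def)
    moreover have "card (f ` nbrs G x) = card (nbrs G x)"
      using inj sub by (intro card_image) (rule inj_on_subset)
    moreover have "f ` nbrs G x \<subseteq> nbrs H (f x)"
      using E by (auto simp: nbrs_def)
    ultimately show ?thesis
      using card_subset_eq[OF finite_nbrs[OF fin(2)], of "f ` nbrs G x" "f x"] by simp
  qed
  have "edges H = (\<lambda>e. f ` e) ` edges G"
  proof (intro equalityI subsetI)
    fix e assume e: "e \<in> edges H"
    then obtain a b where ab: "e = {a, b}" "a \<in> verts H"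
      by (rule fin_graph_edgeE[OF fin(2)])
    then obtain x where x: "x \<in> verts G" "a = f x"
      using im by blast
    have "b \<in> nbrs H (f x)"
      using e ab x(2) by (simp add: nbrs_def)
    then obtain y where "{x, y} \<in> edges G" "b = f y"
      unfolding nb[OF x(1)] by (auto simp: nbrs_def)
    then show "e \<in> (\<lambda>e. f ` e) ` edges G"
      using ab(1) x(2) by (intro image_eqI[of _ _ "{x, y}"]) simp_all
  next
    fix e assume "e \<in> (\<lambda>e. f ` e) ` edges G"
    then obtain d where d: "d \<in> edges G" "e = f ` d"
      by blast
    then obtain x y where "d = {x, y}"
      using fin_graph_edgeE[OF fin(1)] by metis
    then show "e \<in> edges H"
      using d E[of x y] by simp
  qed
  then show ?thesis
    using f unfolding graph_iso_def by blast
qed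

section \<open>Refuting cyclic 4-edge connectivity\<close>

lemma walk_not_crossing:
  "successively (\<lambda>x y. {x, y} \<in> edges G - crossing G S) zs \<Longrightarrow> hd zs \<in> S \<Longrightarrow> set zs \<subseteq> S"
  by (induction zs rule: induct_list012) (auto simp: crossing_def)

lemma cycle_component:
  assumes "is_cycle G xs"
  shows "{x. \<exists>zs. walk G (hd xs) zs x} \<in> components G" "set xs \<subseteq> {x. \<exists>zs. walk G (hd xs) zs x}"
proof -
  have xs: "xs \<noteq> []" "set xs \<subseteq> verts G" "successively (\<lambda>x y. {x, y} \<in> edges G) xs"
    using assms by (auto simp: is_cycle_def)
  then have "hd xs \<in> verts G"
    using hd_in_set by blast
  then show "{x. \<exists>zs. walk G (hd xs) zs x} \<in> components G"
    unfolding components_def by (rule imageI)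
  show "set xs \<subseteq> {x. \<exists>zs. walk G (hd xs) zs x}"
  proof
    fix x assume "x \<in> set xs"
    then obtain as bs where ab: "xs = as @ x # bs"
      by (meson split_list)
    then have "successively (\<lambda>x y. {x, y} \<in> edges G) ((as @ [x]) @ bs)"
      using xs(3) by simp
    then have "successively (\<lambda>x y. {x, y} \<in> edges G) (as @ [x])"
      unfolding successively_append_iff[of _ "as @ [x]" bs] by blast
    moreover have "hd (as @ [x]) = hd xs"
      by (simp add: ab hd_append)
    ultimately have "walk G (hd xs) (as @ [x]) x"
      using xs(2) by (simp add: walk_def ab)
    then show "x \<in> {x. \<exists>zs. walk G (hd xs) zs x}"
      by blast
  qed
qed

lemma is_cycle_del_edges:
  assumes "is_cycle G xs" "\<And>x y. x \<in> set xs \<Longrightarrow> y \<in> set xs \<Longrightarrow> {x, y} \<notin> X"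
  shows "is_cycle (del_edges G X) xs"
proof -
  have xs: "xs \<noteq> []" "successively (\<lambda>x y. {x, y} \<in> edges G) xs" "{last xs, hd xs} \<in> edges G"
    using assms(1) by (auto simp: is_cycle_def)
  have "successively (\<lambda>x y. {x, y} \<in> edges G - X) xs"
    using xs(2) assms(2) by (auto intro: successively_mono)
  moreover have "{last xs, hd xs} \<in> edges G - X"
    using xs assms(2)[of "last xs" "hd xs"] by simp
  ultimately show ?thesis
    using assms(1) by (simp add: is_cycle_def del_edges_def)
qed

text \<open>Without the crossing edges a walk that starts in \<open>S\<close> never leaves it, so
  the two cycles end up in different components.\<close>

lemma not_cyclically_4_edge_connected:
  assumes fin: "fin_graph G" and card: "card (crossing G S) \<le> 3"
    and xs: "is_cycle G xs" "set xs \<subseteq> S" and ys: "is_cycle G ys" "set ys \<inter> S = {}"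
  shows "\<not> cyclically_edge_connected 4 G"
proof
  assume c: "cyclically_edge_connected 4 G"
  let ?G = "del_edges G (crossing G S)"
  let ?C = "\<lambda>xs. {x. \<exists>zs. walk ?G (hd xs) zs x}"
  have "is_cycle ?G xs"
    using xs(2) by (intro is_cycle_del_edges[OF xs(1)]) (auto simp: crossing_def)
  moreover have "is_cycle ?G ys"
    using ys(2) by (intro is_cycle_del_edges[OF ys(1)]) (auto simp: crossing_def)
  ultimately have "?C xs = ?C ys"
    using cyclically_edge_connectedD[OF c _ _ cycle_component(1) _ cycle_component(2)
        cycle_component(1) _ cycle_component(2), of "crossing G S" xs ys] card
    by (auto simp: crossing_def)
  moreover have "hd ys \<in> ?C ys"
    using cycle_component(2)[OF \<open>is_cycle ?G ys\<close>] ys(1) by (cases ys) (auto simp: is_cycle_def)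
  ultimately obtain zs where zs: "walk ?G (hd xs) zs (hd ys)"
    by blast
  have "hd xs \<in> S" "hd ys \<notin> S"
  proof -
    have "xs \<noteq> []" "ys \<noteq> []"
      using xs(1) ys(1) by (auto simp: is_cycle_def)
    then show "hd xs \<in> S" "hd ys \<notin> S"
      using xs(2) ys(2) hd_in_set[of xs] hd_in_set[of ys] by blast+
  qed
  moreover have "set zs \<subseteq> S"
    using zs \<open>hd xs \<in> S\<close> by (intro walk_not_crossing[of G]) (auto simp: walk_def del_edges_def)
  moreover have "hd ys \<in> set zs"
    using zs last_in_set[of zs] by (auto simp: walk_def)
  ultimately show False
    by blast
qed

lemma successively_of_zip:
  "xs \<noteq> [] \<Longrightarrow> (\<And>u v. (u, v) \<in> set (zip xs (tl xs @ [y])) \<Longrightarrow> P u v) \<Longrightarrow> successively P xs \<and> P (last xs) y"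
  by (induction xs rule: induct_list012) auto

lemma check_sound:
  assumes sn: "snark (leaf_graph E)" and rel: "leaf_rel E" "leaf_cycles E w" and chk: "check w c"
  shows "\<exists>i<3. graph_iso (leaf_graph E) (T3_graph i)"
proof -
  let ?G = "leaf_graph E"
  note ed = edges_leaf_graph[OF rel]
  have fin: "fin_graph ?G"
    using sn by (simp add: snark_def)
  have verts: "verts ?G = {0..<22}"
    by (simp add: leaf_graph_def)
  show ?thesis
  proof (cases c)
    case (Iso i f)
    then have f: "i < 3" "length f = 22" "distinct f" "\<forall>x\<in>set f. x < 22"
      and E: "\<And>x y. (x, y) \<in> set (word_edges w) \<Longrightarrow> f ! y \<in> set (fst (snark_data ! i) ! (f ! x))"
      using chk by (auto simp: list_all_iff)
    let ?H = "T3_graph i"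
    note A = T3_graph_table[OF f(1)]
    have "inj_on ((!) f) {0..<22}"
      using f(2,3) by (auto simp: inj_on_def nth_eq_iff_index_eq)
    moreover have "(!) f ` {0..<22} \<subseteq> {0..<22}"
      using f(2,4) by auto
    ultimately have bij: "bij_betw ((!) f) (verts ?G) (verts ?H)"
      using endo_inj_surj[of "{0..<22}" "(!) f"] by (simp add: verts T3_graph_def adj_graph_def bij_betw_def)
    have "graph_iso ?G ?H"
    proof (rule iso_of_embedding[OF fin _ _ _ bij])
      show "fin_graph ?H" "cubic ?H"
        unfolding T3_graph_def by (rule fin_adj_graph[OF A], rule cubic_adj_graph[OF A])
      show "cubic ?G"
        using sn by (simp add: snark_def)
      fix x y assume xy: "{x, y} \<in> edges ?G"
      then obtain a b where ab: "(a, b) \<in> set (word_edges w)" "{x, y} = {a, b}"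
        unfolding ed by auto
      have "a < 22"
        using fin_graph_edge(1)[OF fin, of a b] xy verts unfolding ab(2) by simp
      then have "f ! a < 22"
        using f(2,4) by simp
      then have "{f ! a, f ! b} \<in> edges ?H"
        using E[OF ab(1)] unfolding T3_graph_def adj_graph_edge[OF A] by simp
      then show "{f ! x, f ! y} \<in> edges ?H"
        using ab(2) by (auto simp: doubleton_eq_iff insert_commute)
    qed
    then show ?thesis
      using f(1) by blast
  next
    case (Cut S xs ys)
    have cyc: "is_cycle ?G p" if p: "cycle_in (word_edges w) p" for p
    proof -
      have rot: "rotate1 p = tl p @ [hd p]" "p \<noteq> []"
        using p by (cases p; simp add: cycle_in_def)+
      have "{x, y} \<in> edges ?G" if "(x, y) \<in> set (zip p (rotate1 p))" for x y
        using p that unfolding cycle_in_def ed by (force simp: list_all_iff insert_commute)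
      then have "successively (\<lambda>x y. {x, y} \<in> edges ?G) p" "{last p, hd p} \<in> edges ?G"
        using successively_of_zip[of p "hd p" "\<lambda>x y. {x, y} \<in> edges ?G"] rot by auto
      then show ?thesis
        using p verts by (auto simp: is_cycle_def cycle_in_def list_all_iff)
    qed
    let ?es = "filter (\<lambda>(x, y). (x \<in> set S) \<noteq> (y \<in> set S)) (word_edges w)"
    have "crossing ?G (set S) \<subseteq> (\<lambda>(x, y). {x, y}) ` set ?es"
      unfolding crossing_def ed by auto
    then have "card (crossing ?G (set S)) \<le> card ((\<lambda>(x, y). {x, y}) ` set ?es)"
      by (intro card_mono) simp_all
    also have "\<dots> \<le> card (set ?es)"
      by (rule card_image_le) simp
    also have "\<dots> \<le> length ?es"
      by (rule card_length)
    also have "\<dots> \<le> 3"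
      using chk unfolding Cut by simp
    finally have "\<not> cyclically_edge_connected 4 ?G"
    proof (rule not_cyclically_4_edge_connected[OF fin])
      show "is_cycle ?G xs" "is_cycle ?G ys"
        using chk cyc unfolding Cut by simp_all
      show "set xs \<subseteq> set S" "set ys \<inter> set S = {}"
        using chk unfolding Cut by (auto simp: list_all_iff)
    qed
    then show ?thesis
      using sn by (simp add: snark_def)
  qed
qed

lemma T3_snark_classification:
  fixes H :: "'a ugraph"
  assumes "T3_snark H"
  shows "\<exists>i<3. graph_iso H (T3_graph i)"
proof -
  obtain E where E: "symp E" "graph_iso H (leaf_graph E)"
    using T3_snark_leaf_graph[OF assms] .
  have H: "snark H"
    using assms by (simp add: T3_snark_def)
  \<comment> \<open>Closed under swaps because each swap extends to an isomorphism of leaf graphs.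
    Every relation in this class again has a snark as its leaf graph, since snarks are preserved by
    isomorphism.\<close>
  let ?P = "\<lambda>E. symp E \<and> graph_iso H (leaf_graph E)"
  have sn: "snark (leaf_graph E)" if "?P E" for E
    using snark_iso[OF _ H] that by blast
  have rel: "leaf_rel E" if "?P E" for E
    using leaf_rel_of_snark[OF sn[OF that]] that by blast
  have "\<exists>w\<in>set uncolored. \<exists>E'. ?P E' \<and> leaf_cycles E' w"
  proof (rule uncolored_complete)
    show "?P E"
      using E by blast
    show "?P (swap_rel s E)" if P: "?P E" and s: "s \<in> set swaps" for E s
      using graph_iso_trans[OF conjunct2[OF P] graph_iso_swap[OF s]] P by (simp add: symp_def)
    show "leaf_rel E" if "?P E" for E
      using rel[OF that] .
    show "\<not> colors k w" if P: "?P E" and w: "leaf_cycles E w" for E w k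
    proof
      assume "colors k w"
      moreover have "fin_graph (leaf_graph E)"
        using sn[OF P] by (simp add: snark_def)
      ultimately have "\<exists>c. proper_edge_coloring 3 (leaf_graph E) c"
        using leaf_graph_coloring rel[OF P] w by blast
      then show False
        using sn[OF P] by (simp add: snark_def)
    qed
  qed
  then obtain w E' where w: "w \<in> set uncolored" "?P E'" "leaf_cycles E' w"
    by blast
  then obtain c where "(w, c) \<in> set certs"
    unfolding uncolored_eq by auto
  then have "check w c"
    using certs_ok by (auto simp: list_all_iff)
  then obtain i where "i < 3" "graph_iso (leaf_graph E') (T3_graph i)"
    using check_sound[OF sn[OF w(2)] rel[OF w(2)] w(3)] by blast
  then show ?thesis
    using graph_iso_trans w(2) by blast
qed

theorem mainTheorem4:
  shows "\<exists>(G1 :: nat ugraph) (G2 :: nat ugraph) (G3 :: nat ugraph).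
    T3_snark G1 \<and> T3_snark G2 \<and> T3_snark G3 \<and>
    \<not> graph_iso G1 G2 \<and> \<not> graph_iso G1 G3 \<and> \<not> graph_iso G2 G3 \<and>
    (\<forall>H :: 'a ugraph. T3_snark H \<longrightarrow> graph_iso H G1 \<or> graph_iso H G2 \<or> graph_iso H G3)"
proof (intro exI conjI allI impI)
  show "T3_snark (T3_graph 0)" "T3_snark (T3_graph 1)" "T3_snark (T3_graph 2)"
    by (rule T3_graph_snark; simp)+
  show "\<not> graph_iso (T3_graph 0) (T3_graph 1)" "\<not> graph_iso (T3_graph 0) (T3_graph 2)"
    "\<not> graph_iso (T3_graph 1) (T3_graph 2)"
    by (rule T3_graph_not_iso; simp)+
  fix H :: "'a ugraph"
  assume "T3_snark H"
  then obtain i where i: "i < 3" "graph_iso H (T3_graph i)"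
    using T3_snark_classification by blast
  moreover have "i = 0 \<or> i = 1 \<or> i = 2"
    using i(1) by arith
  ultimately show "graph_iso H (T3_graph 0) \<or> graph_iso H (T3_graph 1) \<or> graph_iso H (T3_graph 2)"
    by blast
qed

end
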